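(* Consider the Rician block-fading channel and codes defined in the context, with parameters $\ell\ge1$, $n_c\ge2$, $\epsilon\in(0,1)$, $\rho>0$, $\kappa\ge0$, and fix an integer $n_p$ with $1\le n_p\le n_c-1$; set $n_d=n_c-n_p$, $\sigma_e^2=1/(n_p\rho)$, $\sigma_p^2=\frac{\sigma_H^2\sigma_e^2}{\sigma_H^2+\sigma_e^2}$, and $\mu_p(\hat h)=\frac{\sigma_H^2\hat h+\sigma_e^2\mu_H}{\sigma_H^2+\sigma_e^2}$ for $\hat h\in\mathbb{C}$. Then \[ R^*\ \ge\ \max\Big\{\tfrac{\log_2M}{n_c\ell}:\ M\ge2\text{ integer},\ \epsilon^{(n_p)}_{\mathrm{ub}}(M)\le\epsilon\Big\}, \] where \[ \epsilon^{(n_p)}_{\mathrm{ub}}(M)=\mathbb{E}\Big[\exp\Big\{-\Big[\sum_{k=1}^\ell\bar S_k(\hat H_k)-\ln\tfrac{M-1}{2}\Big]^+\Big\}\Big]. \] Here $\hat H_1,\dots,\hat H_\ell$ are i.i.d. with $\hat H_k\sim\mathcal{CN}(\mu_H,\sigma_H^2+\sigma_e^2)$ (the distribution of $H_k+E_k$ with $E_k\sim\mathcal{CN}(0,\sigma_e^2)$ independent of $H_k$), and, conditionally on $\hat H_k=\hat h_k$ ($k=1,\dots,\ell$), the random variables $\bar S_1(\hat h_1),\dots,\bar S_\ell(\hat h_\ell)$ are independent, with $\bar S_k(\hat h_k)$ defined as the random variable $S_k$ of the context with block length $n_d$ in place of $n_c$, $\mu=\mu_p(\hat h_k)$ and $\sigma^2=\sigma_p^2$.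 The expectation is over both $\{\hat H_k\}$ and the $\{\bar S_k\}$.
   Context: Channel model: fix integers $\ell\ge1$ (number of coherence blocks) and $n_c\ge1$ (block length of each coherence block), a Rician factor $\kappa\ge0$, and $\rho>0$. Set $\mu_H=\sqrt{\kappa/(1+\kappa)}$ and $\sigma_H^2=1/(1+\kappa)$. The channel maps an input $(\mathbf{x}_1,\dots,\mathbf{x}_\ell)\in(\mathbb{C}^{n_c})^\ell$ to $\mathbf{Y}_k=H_k\mathbf{x}_k+\mathbf{W}_k$, $k=1,\dots,\ell$, where $H_k\sim\mathcal{CN}(\mu_H,\sigma_H^2)$ (i.e., $\mu_H$ plus a circularly-symmetric complex Gaussian of variance $\sigma_H^2$) and $\mathbf{W}_k\sim\mathcal{CN}(\mathbf{0},\mathbf{I}_{n_c})$, all of $H_1,\dots,H_\ell,\mathbf{W}_1,\dots,\mathbf{W}_\ell$ mutually independent and independent of the input; neither transmitter nor receiver knows the realizations of $H_k$ (the receiver knows $\mu_H,\sigma_H^2$). Codes: an $(\ell,n_c,M,\epsilon,\rho)$-code consists of an encoder mapping each message $j\in\{1,\dots,M\}$ to a codeword $\mathbf{c}_j=(\mathbf{c}_{j,1},\dots,\mathbf{c}_{j,\ell})$ with $\mathbf{c}_{j,k}\in\mathbb{C}^{n_c}$ and $\|\mathbf{c}_{j,k}\|^2=n_c\rho$ for every $k$, and a decoder $g:\mathbb{C}^{n_c\ell}\to\{1,\dots,M\}$ such that, with message $J$ uniform on $\{1,\dots,M\}$, $\frac1M\sum_{j=1}^M\Pr\{g(\mathbf{Y}_1,\dots,\mathbf{Y}_\ell)\ne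 J\mid J=j\}\le\epsilon$. The maximum coding rate is $R^*=\sup\{\log_2(M)/(\ell n_c):\exists\ (\ell,n_c,M,\epsilon,\rho)\text{-code}\}$. Definition of $S_k$ (for given $\mu\in\mathbb{C}$, $\sigma^2>0$, and block length $m$ in place of $n_c$): let $\mathbf{e}_1=[1,0,\dots,0]^{T}\in\mathbb{C}^{m}$; let $f_{\mathbf{Y}\mid\mathbf{e}_1}$ be the density of $\mathcal{CN}\big(\mu\sqrt{m\rho}\,\mathbf{e}_1,\ \sigma^2 m\rho\,\mathbf{e}_1\mathbf{e}_1^{H}+\mathbf{I}_{m}\big)$, and let \[ f_{\mathbf{Y}}(\mathbf{y})=\frac{\Gamma(m)}{\sigma^2\pi^{m}}e^{-\|\mathbf{y}\|^2}e^{-|\mu|^2/\sigma^2}\int_0^\infty\frac{e^{-(\rho m+\sigma^{-2})z}}{(\sqrt{\|\mathbf{y}\|^2\rho m z})^{m-1}}I_0\big(2\sqrt{z|\mu|^2/\sigma^4}\big)I_{m-1}\big(2\sqrt{\|\mathbf{y}\|^2\rho m z}\big)\,\mathrm{d}z \] (the output density when the input is uniform on the sphere of radius $\sqrt{m\rho}$ and the fading is $\mathcal{CN}(\mu,\sigma^2)$). With $\mathbf{W}_k\sim\mathcal{CN}(\mathbf{0},\mathbf{I}_{m})$, set $\widetilde{\mathbf{W}}_k=\begin{bmatrix}\mu\sqrt{m\rho}\\ \mathbf{0}_{m-1}\end{bmatrix}+\begin{bmatrix}\sqrt{\sigma^2m\rho+1}\\ \mathbf{1}_{m-1}\end{bmatrix}\odot\mathbf{W}_k$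 (where $\odot$ is the entrywise product and $\mathbf{0}_{j},\mathbf{1}_j$ are the all-zero/all-one vectors of length $j$) and $S_k=\ln\dfrac{f_{\mathbf{Y}\mid\mathbf{e}_1}(\widetilde{\mathbf{W}}_k)}{f_{\mathbf{Y}}(\widetilde{\mathbf{W}}_k)}$. Also $[a]^+=\max\{0,a\}$ and $\ln$ is the natural logarithm. Pilot-assisted scheme underlying the bound (for interpretation): in each coherence block $n_p$ channel uses carry known pilot symbols of power $\rho$ each and the remaining $n_d$ carry data of total energy $n_d\rho$; the receiver forms the maximum-likelihood estimate $\hat H_k$ of $H_k$ from the pilot outputs, so that given $H_k=h_k$, $\hat H_k\sim\mathcal{CN}(h_k,\sigma_e^2)$, and given $\hat H_k=\hat h_k$ the fading coefficient is $\mathcal{CN}(\mu_p(\hat h_k),\sigma_p^2)$. *)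

theory Defs
  imports "HOL-Probability.Probability"
begin

definition cn_density :: "complex \<Rightarrow> real \<Rightarrow> complex \<Rightarrow> real" where
  "cn_density mu s z = exp (- (cmod (z - mu))\<^sup>2 / s) / (pi * s)"

definition CN :: "complex \<Rightarrow> real \<Rightarrow> complex measure" where
  "CN mu s = density lborel (\<lambda>z. ennreal (cn_density mu s z))"

definition bessel_I :: "nat \<Rightarrow> real \<Rightarrow> real" where
  "bessel_I n x = (\<Sum>k. (x / 2) ^ (2 * k + n) / (fact k * fact (k + n)))"

definition muH :: "real \<Rightarrow> complex" where
  "muH \<kappa> = complex_of_real (sqrt (\<kappa> / (1 + \<kappa>)))"

definition sigH2 :: "real \<Rightarrow> real" where
  "sigH2 \<kappa> = 1 / (1 + \<kappa>)"

text \<open>Channel inputs/outputs of the whole codeword are functions on the index set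
  {..<l} x {..<nc}: entry (k,i) is the i-th symbol of the k-th coherence block.\<close>

definition idx :: "nat \<Rightarrow> nat \<Rightarrow> (nat \<times> nat) set" where
  "idx l m = {..<l} \<times> {..<m}"

definition channel_space :: "nat \<Rightarrow> nat \<Rightarrow> real \<Rightarrow> ((nat \<Rightarrow> complex) \<times> (nat \<times> nat \<Rightarrow> complex)) measure" where
  "channel_space l nc \<kappa> =
     (PiM {..<l} (\<lambda>_. CN (muH \<kappa>) (sigH2 \<kappa>))) \<Otimes>\<^sub>M (PiM (idx l nc) (\<lambda>_. CN 0 1))"

definition channel_out :: "nat \<Rightarrow> nat \<Rightarrow> (nat \<times> nat \<Rightarrow> complex) \<Rightarrow>
    (nat \<Rightarrow> complex) \<Rightarrow> (nat \<times> nat \<Rightarrow> complex) \<Rightarrow> (nat \<times> nat \<Rightarrow> complex)" where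
  "channel_out l nc x h w = restrict (\<lambda>(k, i). h k * x (k, i) + w (k, i)) (idx l nc)"

definition is_code ::
  "nat \<Rightarrow> nat \<Rightarrow> nat \<Rightarrow> real \<Rightarrow> real \<Rightarrow> real \<Rightarrow>
   (nat \<Rightarrow> nat \<times> nat \<Rightarrow> complex) \<Rightarrow> ((nat \<times> nat \<Rightarrow> complex) \<Rightarrow> nat) \<Rightarrow> bool" where
  "is_code l nc M \<epsilon> \<rho> \<kappa> c g \<longleftrightarrow>
     M \<ge> 1 \<and>
     (\<forall>j\<in>{1..M}. \<forall>k<l. (\<Sum>i<nc. (cmod (c j (k, i)))\<^sup>2) = real nc * \<rho>) \<and>
     (\<forall>y. g y \<in> {1..M}) \<and>
     g \<in> measurable (PiM (idx l nc) (\<lambda>_. borel)) (count_space UNIV) \<and>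
     (1 / real M) * (\<Sum>j\<in>{1..M}.
        measure (channel_space l nc \<kappa>)
          {hw \<in> space (channel_space l nc \<kappa>).
             g (channel_out l nc (c j) (fst hw) (snd hw)) \<noteq> j}) \<le> \<epsilon>"

definition R_star :: "nat \<Rightarrow> nat \<Rightarrow> real \<Rightarrow> real \<Rightarrow> real \<Rightarrow> ereal" where
  "R_star l nc \<epsilon> \<rho> \<kappa> =
     Sup {ereal (log 2 (real M) / (real l * real nc)) | M. \<exists>c g. is_code l nc M \<epsilon> \<rho> \<kappa> c g}"

definition sqnorm :: "nat \<Rightarrow> (nat \<Rightarrow> complex) \<Rightarrow> real" where
  "sqnorm m y = (\<Sum>i<m. (cmod (y i))\<^sup>2)"

text \<open>Density of CN(mu sqrt(m rho) e1, s2 m rho e1 e1^H + I_m), written out explicitly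
  (determinant s2 m rho + 1, diagonal inverse covariance).\<close>
definition f_cond :: "real \<Rightarrow> complex \<Rightarrow> real \<Rightarrow> nat \<Rightarrow> (nat \<Rightarrow> complex) \<Rightarrow> real" where
  "f_cond \<rho> mu s2 m y =
     exp (- (cmod (y 0 - mu * complex_of_real (sqrt (real m * \<rho>))))\<^sup>2 / (s2 * real m * \<rho> + 1)
          - (\<Sum>i\<in>{1..<m}. (cmod (y i))\<^sup>2))
     / (pi ^ m * (s2 * real m * \<rho> + 1))"

definition f_out :: "real \<Rightarrow> complex \<Rightarrow> real \<Rightarrow> nat \<Rightarrow> (nat \<Rightarrow> complex) \<Rightarrow> real" where
  "f_out \<rho> mu s2 m y =
     Gamma (real m) / (s2 * pi ^ m) * exp (- sqnorm m y) * exp (- (cmod mu)\<^sup>2 / s2) *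
     (LINT z:{0<..}|lborel.
        exp (- (\<rho> * real m + 1 / s2) * z) / (sqrt (sqnorm m y * \<rho> * real m * z)) ^ (m - 1)
        * bessel_I 0 (2 * sqrt (z * (cmod mu)\<^sup>2 / s2\<^sup>2))
        * bessel_I (m - 1) (2 * sqrt (sqnorm m y * \<rho> * real m * z)))"

definition W_tilde :: "real \<Rightarrow> complex \<Rightarrow> real \<Rightarrow> nat \<Rightarrow> (nat \<Rightarrow> complex) \<Rightarrow> (nat \<Rightarrow> complex)" where
  "W_tilde \<rho> mu s2 m w =
     (\<lambda>i. if i = 0 then mu * complex_of_real (sqrt (real m * \<rho>))
                        + complex_of_real (sqrt (s2 * real m * \<rho> + 1)) * w 0
          else w i)"

definition S_rv :: "real \<Rightarrow> complex \<Rightarrow> real \<Rightarrow> nat \<Rightarrow> (nat \<Rightarrow> complex) \<Rightarrow> real" where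
  "S_rv \<rho> mu s2 m w =
     ln (f_cond \<rho> mu s2 m (W_tilde \<rho> mu s2 m w) / f_out \<rho> mu s2 m (W_tilde \<rho> mu s2 m w))"

definition sig_e2 :: "nat \<Rightarrow> real \<Rightarrow> real" where
  "sig_e2 np \<rho> = 1 / (real np * \<rho>)"

definition sig_p2 :: "real \<Rightarrow> nat \<Rightarrow> real \<Rightarrow> real" where
  "sig_p2 \<kappa> np \<rho> = sigH2 \<kappa> * sig_e2 np \<rho> / (sigH2 \<kappa> + sig_e2 np \<rho>)"

definition mu_p :: "real \<Rightarrow> nat \<Rightarrow> real \<Rightarrow> complex \<Rightarrow> complex" where
  "mu_p \<kappa> np \<rho> hh =
     (complex_of_real (sigH2 \<kappa>) * hh + complex_of_real (sig_e2 np \<rho>) * muH \<kappa>)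
     / complex_of_real (sigH2 \<kappa> + sig_e2 np \<rho>)"

text \<open>Joint law of (Hhat_1..Hhat_l) i.i.d. CN(muH, sigH2 + sig_e2) and independent noise
  vectors W_k ~ CN(0, I_{nd}); Sbar_k(Hhat_k) = S_rv evaluated on the k-th noise vector,
  which realises the conditional independence structure.\<close>
definition ub_space :: "nat \<Rightarrow> nat \<Rightarrow> nat \<Rightarrow> real \<Rightarrow> real \<Rightarrow>
    ((nat \<Rightarrow> complex) \<times> (nat \<times> nat \<Rightarrow> complex)) measure" where
  "ub_space l nc np \<rho> \<kappa> =
     (PiM {..<l} (\<lambda>_. CN (muH \<kappa>) (sigH2 \<kappa> + sig_e2 np \<rho>))) \<Otimes>\<^sub>M
     (PiM (idx l (nc - np)) (\<lambda>_. CN 0 1))"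

definition eps_ub :: "nat \<Rightarrow> nat \<Rightarrow> nat \<Rightarrow> real \<Rightarrow> real \<Rightarrow> nat \<Rightarrow> real" where
  "eps_ub l nc np \<rho> \<kappa> M =
     (\<integral>hw. exp (- max 0
          ((\<Sum>k<l. S_rv \<rho> (mu_p \<kappa> np \<rho> (fst hw k)) (sig_p2 \<kappa> np \<rho>) (nc - np)
                        (\<lambda>i. snd hw (k, i)))
           - ln ((real M - 1) / 2)))
      \<partial>ub_space l nc np \<rho> \<kappa>)"

end

theory Submission
  imports Defs "HOL-Real_Asymp.Real_Asymp"
begin

text \<open>
  This is the dependence-testing argument for a random code. Each codeword block carries
  \<^term>\<open>np\<close> pilots followed by data drawn uniformly from a sphere, realised as a normalised Gaussian
  vector. From an output block the decoder keeps the pilot estimate of the fading and the data part;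
  by Gaussian conjugacy, the law of this pair given the codeword has an explicit density with
  respect to a product law that does not depend on the codeword. Averaging that density over
  the sphere gives \<^const>\<open>f_out\<close>. The
  decoder picks the first message whose log-likelihood ratio exceeds \<open>ln ((M - 1) / 2)\<close>; a union bound
  over the preceding messages and the change of measure by the likelihood ratio turn the average
  error probability into exactly \<^const>\<open>eps_ub\<close>. Unitary invariance of the Gaussian law makes the law
  of the log-likelihood ratio independent of the codeword, so it may be computed for \<open>e\<^sub>1\<close>.
\<close>

section \<open>Complex Gaussian laws\<close>

text \<open>The uniform law on the sphere is never formed: the direction of a Gaussian vector
  replaces it, and one invariance, \<open>CN_vec_linear\<close>, serves both for rotating a codeword
  to the first axis and for averaging over directions. It speaks only of one linear form together
  with the squared norm, so every quantity is first rewritten as a function of these two. The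
  obstacle is the closed form of \<open>f_out\<close>: its factor \<open>I_(m-1)\<close> is the
  exponential moment of a random direction, \<open>I_0\<close> is the same fact in dimension one
  applied to the phase of the fading, and the remaining integral runs over \<open>z = |h|^2\<close>.
  The constant \<open>\<gamma> = (M - 1) / 2\<close> is the mean number of messages preceding a
  uniformly chosen one. The equation \<open>exp (- [x - ln \<gamma>]^+) = 1{x \<le> ln \<gamma>} +
  \<gamma> exp (- x) 1{x > ln \<gamma>}\<close> splits the bound into missed detection and false
  alarms, so that the only losses are the union bound and the choice of one code from the
  ensemble.\<close>

lemma nn_integral_lborel_affine:
  fixes f :: "'a::euclidean_space \<Rightarrow> ennreal"
  assumes [measurable]: "f \<in> borel_measurable borel" and r: "r \<noteq> 0"
  shows "(\<integral>\<^sup>+x. f x \<partial>lborel) = ennreal (\<bar>r\<bar> ^ DIM('a)) * (\<integral>\<^sup>+x. f (t + r *\<^sub>R x) \<partial>lborel)"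
  by (subst lborel_affine[OF r, of t])
     (simp add: nn_integral_density nn_integral_distr nn_integral_cmult)

text \<open>For \<open>c \<noteq> 0\<close> the rotation is a composition of two substitutions, each
  in one variable with the other held fixed; the factor \<open>|1/c| ^ DIM\<close> produced by the
  first is used up by the second. The case \<open>c = 0\<close> is a swap of the variables with a
  sign.\<close>

lemma nn_integral_lborel_rotation:
  fixes F :: "'a::euclidean_space \<Rightarrow> 'a \<Rightarrow> ennreal"
  assumes F [measurable]: "(\<lambda>(x, y). F x y) \<in> borel_measurable (borel \<Otimes>\<^sub>M borel)"
    and cs: "c\<^sup>2 + s\<^sup>2 = 1"
  shows "(\<integral>\<^sup>+x. \<integral>\<^sup>+y. F (c *\<^sub>R x + s *\<^sub>R y) (c *\<^sub>R y - s *\<^sub>R x) \<partial>lborel \<partial>lborel)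
       = (\<integral>\<^sup>+x. \<integral>\<^sup>+y. F x y \<partial>lborel \<partial>lborel)"
proof (cases "c = 0")
  case True
  with cs have s: "\<bar>s\<bar> = 1" "s \<noteq> 0" by (auto simp: power2_eq_1_iff)
  have "(\<integral>\<^sup>+x. \<integral>\<^sup>+y. F (s *\<^sub>R y) (- s *\<^sub>R x) \<partial>lborel \<partial>lborel)
      = (\<integral>\<^sup>+y. \<integral>\<^sup>+x. F (s *\<^sub>R y) (- s *\<^sub>R x) \<partial>lborel \<partial>lborel)"
    by (rule lborel_pair.Fubini') measurable
  also have "\<dots> = (\<integral>\<^sup>+y. \<integral>\<^sup>+x. F (s *\<^sub>R y) x \<partial>lborel \<partial>lborel)"
    using s by (subst (2) nn_integral_lborel_affine[where r="-s" and t=0]) auto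
  also have "\<dots> = (\<integral>\<^sup>+y. \<integral>\<^sup>+x. F y x \<partial>lborel \<partial>lborel)"
    using s by (subst (3) nn_integral_lborel_affine[where r="s" and t=0]) auto
  finally show ?thesis using True by simp
next
  case False
  let ?k = "ennreal (\<bar>inverse c\<bar> ^ DIM('a))"
  have cc: "c *\<^sub>R (- (inverse c * s) *\<^sub>R y + inverse c *\<^sub>R x) + s *\<^sub>R y = x" for x y :: 'a
    using False by (simp add: algebra_simps)
  have "(\<integral>\<^sup>+x. \<integral>\<^sup>+y. F (c *\<^sub>R x + s *\<^sub>R y) (c *\<^sub>R y - s *\<^sub>R x) \<partial>lborel \<partial>lborel)
      = (\<integral>\<^sup>+y. \<integral>\<^sup>+x. F (c *\<^sub>R x + s *\<^sub>R y) (c *\<^sub>R y - s *\<^sub>R x) \<partial>lborel \<partial>lborel)"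
    by (rule lborel_pair.Fubini') measurable
  also have "\<dots> = (\<integral>\<^sup>+y. ?k * (\<integral>\<^sup>+x. F x (inverse c *\<^sub>R (y - s *\<^sub>R x)) \<partial>lborel) \<partial>lborel)"
  proof (intro nn_integral_cong)
    fix y :: 'a
    have e: "c *\<^sub>R y - s *\<^sub>R (- (inverse c * s) *\<^sub>R y + inverse c *\<^sub>R x) = inverse c *\<^sub>R (y - s *\<^sub>R x)" for x
    proof -
      have "c + s * (inverse c * s) = inverse c"
        using False cs by (simp add: field_simps power2_eq_square)
      then show ?thesis
        by (simp add: algebra_simps flip: scaleR_add_left)
    qed
    show "(\<integral>\<^sup>+x. F (c *\<^sub>R x + s *\<^sub>R y) (c *\<^sub>R y - s *\<^sub>R x) \<partial>lborel) =
        ?k * (\<integral>\<^sup>+x. F x (inverse c *\<^sub>R (y - s *\<^sub>R x)) \<partial>lborel)"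
      using False
      by (subst nn_integral_lborel_affine[where r="inverse c" and t="- (inverse c * s) *\<^sub>R y"])
         (simp_all only: e cc, auto)
  qed
  also have "\<dots> = ?k * (\<integral>\<^sup>+y. (\<integral>\<^sup>+x. F x (inverse c *\<^sub>R (y - s *\<^sub>R x)) \<partial>lborel) \<partial>lborel)"
    by (rule nn_integral_cmult) measurable
  also have "(\<integral>\<^sup>+y. (\<integral>\<^sup>+x. F x (inverse c *\<^sub>R (y - s *\<^sub>R x)) \<partial>lborel) \<partial>lborel) =
     (\<integral>\<^sup>+x. (\<integral>\<^sup>+y. F x (inverse c *\<^sub>R (y - s *\<^sub>R x)) \<partial>lborel) \<partial>lborel)"
    by (rule lborel_pair.Fubini') measurable
  also have "?k * \<dots> = (\<integral>\<^sup>+x. ?k * (\<integral>\<^sup>+y. F x (inverse c *\<^sub>R (y - s *\<^sub>R x)) \<partial>lborel) \<partial>lborel)"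
    by (rule nn_integral_cmult[symmetric]) measurable
  also have "\<dots> = (\<integral>\<^sup>+x. \<integral>\<^sup>+y. F x y \<partial>lborel \<partial>lborel)"
  proof (intro nn_integral_cong)
    fix x :: 'a
    show "?k * (\<integral>\<^sup>+y. F x (inverse c *\<^sub>R (y - s *\<^sub>R x)) \<partial>lborel) = (\<integral>\<^sup>+y. F x y \<partial>lborel)"
      using False
      by (subst (2) nn_integral_lborel_affine[where r="inverse c" and t="- (inverse c * s) *\<^sub>R x"])
         (auto simp: scaleR_diff_right)
  qed
  finally show ?thesis .
qed

lemma lborel_complex_eq_distr:
  "(lborel :: complex measure) = distr (lborel \<Otimes>\<^sub>M lborel) borel (\<lambda>(x, y). Complex x y)"
proof (rule lborel_eqI)
  have [measurable]: "(\<lambda>(x, y). Complex x y) \<in> borel_measurable (lborel \<Otimes>\<^sub>M lborel)"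
    unfolding Complex_eq by measurable
  fix l u :: complex assume lu: "\<And>b. b \<in> Basis \<Longrightarrow> l \<bullet> b \<le> u \<bullet> b"
  have le: "Re l \<le> Re u" "Im l \<le> Im u" using lu[of 1] lu[of \<i>] by (auto simp: Basis_complex_def)
  have "(\<lambda>(x, y). Complex x y) -` box l u \<inter> space (lborel \<Otimes>\<^sub>M lborel)
     = {Re l<..<Re u} \<times> {Im l<..<Im u}"
    by (auto simp: box_def Basis_complex_def space_pair_measure)
  then show "emeasure (distr (lborel \<Otimes>\<^sub>M lborel) borel (\<lambda>(x, y). Complex x y)) (box l u)
     = ennreal (\<Prod>b\<in>Basis. (u - l) \<bullet> b)"
    using le by (simp add: emeasure_distr lborel.emeasure_pair_measure_Times Basis_complex_def
      ennreal_mult[symmetric])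
qed simp

lemma nn_integral_lborel_complex:
  assumes [measurable]: "f \<in> borel_measurable borel"
  shows "(\<integral>\<^sup>+z. f z \<partial>lborel) = (\<integral>\<^sup>+x. \<integral>\<^sup>+y. f (Complex x y) \<partial>lborel \<partial>lborel)"
proof -
  have [measurable]: "(\<lambda>(x, y). Complex x y) \<in> borel_measurable (lborel \<Otimes>\<^sub>M lborel)"
    unfolding Complex_eq by measurable
  show ?thesis
    by (subst lborel_complex_eq_distr, subst nn_integral_distr, measurable)
       (auto simp: lborel.nn_integral_fst[symmetric] case_prod_beta)
qed

text \<open>Multiplication by \<open>u\<close> rotates the pair of real and imaginary parts, with
  cosine \<open>Re u\<close> and sine \<open>- Im u\<close>.\<close>

lemma nn_integral_lborel_phase:
  assumes [measurable]: "f \<in> borel_measurable borel" and u: "cmod u = 1"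
  shows "(\<integral>\<^sup>+z. f (u * z) \<partial>lborel) = (\<integral>\<^sup>+z. f z \<partial>lborel)"
proof -
  have [measurable]: "(\<lambda>(x, y). f (Complex x y)) \<in> borel_measurable (borel \<Otimes>\<^sub>M borel)"
    unfolding Complex_eq by measurable
  have "(Re u)\<^sup>2 + (- Im u)\<^sup>2 = 1" using u by (simp add: cmod_def)
  from nn_integral_lborel_rotation[OF _ this, of "\<lambda>x y. f (Complex x y)"]
  show ?thesis
    by (simp add: nn_integral_lborel_complex complex_eq_iff times_complex.code algebra_simps)
qed

text \<open>The disc of radius \<open>sqrt r\<close> has area \<open>pi * r\<close>, which is linear
  in \<open>r\<close>; hence the constant density. This takes the place of polar coordinates
  throughout.\<close>

lemma distr_lborel_cmod_square:
  "distr lborel borel (\<lambda>z::complex. (cmod z)\<^sup>2) = density lborel (\<lambda>x. ennreal pi * indicator {0<..} x)"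
proof (rule measure_eqI_generator_eq[where E="range lessThan" and \<Omega>=UNIV and A="\<lambda>i. {..<real i}"])
  show "Int_stable (range (lessThan :: real \<Rightarrow> _))"
  proof (clarsimp simp: Int_stable_def)
    fix a b :: real
    have "{..<a} \<inter> {..<b} = {..<min a b}" by auto
    then show "{..<a} \<inter> {..<b} \<in> range lessThan" by blast
  qed
  have *: "emeasure (distr lborel borel (\<lambda>z::complex. (cmod z)\<^sup>2)) {..<r} = ennreal pi * ennreal r" for r
  proof -
    have "(\<lambda>z::complex. (cmod z)\<^sup>2) -` {..<r} = ball 0 (sqrt r)"
      by (auto simp: real_less_rsqrt)
         (metis abs_norm_cancel real_sqrt_abs real_sqrt_less_iff)
    moreover have "emeasure lborel (ball (0::complex) (sqrt r)) = ennreal pi * ennreal r"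
    proof (cases "r \<ge> 0")
      case True
      then show ?thesis by (simp add: emeasure_ball unit_ball_vol_2 ennreal_mult)
    next
      case False
      then have b: "ball (0::complex) (sqrt r) = {}" by (simp add: ball_eq_empty)
      show ?thesis unfolding b using False by (simp add: ennreal_neg)
    qed
    ultimately show ?thesis by (simp add: emeasure_distr)
  qed
  then show "emeasure (distr lborel borel (\<lambda>z::complex. (cmod z)\<^sup>2)) {..<real i} \<noteq> \<infinity>" for i
    by (simp add: ennreal_mult_eq_top_iff)
  fix X :: "real set" assume "X \<in> range lessThan"
  then obtain r where X: "X = {..<r}" by auto
  have "{0<..} \<inter> {..<r} = {0<..<r}" by auto
  then have "emeasure (density lborel (\<lambda>x. ennreal pi * indicator {0<..} x)) {..<r} = ennreal pi * ennreal r"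
    by (cases "r \<ge> 0")
       (auto simp: emeasure_density nn_integral_cmult mult.assoc indicator_inter_arith[symmetric] ennreal_neg)
  with * show "emeasure (distr lborel borel (\<lambda>z::complex. (cmod z)\<^sup>2)) X
      = emeasure (density lborel (\<lambda>x. ennreal pi * indicator {0<..} x)) X"
    unfolding X by simp
qed (auto simp: borel_Iio intro: reals_Archimedean2)

lemma nn_integral_lborel_cmod_square:
  assumes [measurable]: "f \<in> borel_measurable borel"
  shows "(\<integral>\<^sup>+z. f ((cmod z)\<^sup>2) \<partial>lborel) = ennreal pi * (\<integral>\<^sup>+x\<in>{0<..}. f x \<partial>lborel)"
proof -
  have "(\<integral>\<^sup>+z. f ((cmod z)\<^sup>2) \<partial>lborel) = (\<integral>\<^sup>+x. f x \<partial>distr lborel borel (\<lambda>z::complex. (cmod z)\<^sup>2))"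
    by (simp add: nn_integral_distr)
  then show ?thesis
    unfolding distr_lborel_cmod_square
    by (simp add: nn_integral_density nn_integral_cmult[symmetric] ac_simps)
qed

lemma nn_integral_exponential:
  fixes c :: real
  assumes c: "c > 0" and t: "t \<ge> 0"
  shows "(\<integral>\<^sup>+x\<in>{0<..}. ennreal (exp (- c * x)) * indicator {t<..} x \<partial>lborel) = ennreal (exp (- c * t) / c)"
proof -
  have "(\<integral>\<^sup>+x\<in>{0<..}. ennreal (exp (- c * x)) * indicator {t<..} x \<partial>lborel)
      = (\<integral>\<^sup>+x. ennreal (exp (- c * x)) * indicator {t..} x \<partial>lborel)"
    by (rule nn_integral_cong_AE)
       (use t in \<open>auto intro!: AE_I'[of "{t}"] simp: indicator_def split: if_splits\<close>)
  also have "\<dots> = ennreal (0 - (- exp (- c * t) / c))"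
  proof (rule nn_integral_FTC_atLeast)
    show "((\<lambda>x. - exp (- c * x) / c) \<longlongrightarrow> 0) at_top"
      using c by real_asymp
  qed (use c in \<open>auto intro!: derivative_eq_intros\<close>)
  finally show ?thesis by simp
qed

section \<open>The law \<open>CN\<close>: affine maps, phase, squared modulus, rotation of
  pairs\<close>

lemma cn_density_pos: "s > 0 \<Longrightarrow> cn_density mu s z > 0"
  by (simp add: cn_density_def)

lemma borel_measurable_cn_density [measurable]:
  assumes [measurable]: "f \<in> borel_measurable M" "g \<in> borel_measurable M" "h \<in> borel_measurable M"
  shows "(\<lambda>x. cn_density (f x) (g x) (h x)) \<in> borel_measurable M"
  unfolding cn_density_def by measurable

lemma sets_CN [simp, measurable_cong]: "sets (CN mu s) = sets borel"
  by (simp add: CN_def)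

lemma space_CN [simp]: "space (CN mu s) = UNIV"
  by (simp add: CN_def)

lemma nn_integral_CN:
  assumes [measurable]: "f \<in> borel_measurable borel"
  shows "(\<integral>\<^sup>+z. f z \<partial>CN mu s) = (\<integral>\<^sup>+z. ennreal (cn_density mu s z) * f z \<partial>lborel)"
  unfolding CN_def by (simp add: nn_integral_density)

text \<open>The complex plane has real dimension two, so the substitution has Jacobian
  \<open>b^2\<close>, which cancels the change of variance in the normalising constant.\<close>

lemma nn_integral_CN_affine:
  assumes [measurable]: "f \<in> borel_measurable borel" and b: "b \<noteq> 0" and s: "s > 0"
  shows "(\<integral>\<^sup>+z. f z \<partial>CN (a + of_real b * mu) (b\<^sup>2 * s)) = (\<integral>\<^sup>+z. f (a + of_real b * z) \<partial>CN mu s)"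
proof -
  have "b\<^sup>2 * cn_density (a + of_real b * mu) (b\<^sup>2 * s) (a + of_real b * z) = cn_density mu s z" for z
  proof -
    have "cmod (a + of_real b * z - (a + of_real b * mu)) = \<bar>b\<bar> * cmod (z - mu)"
      by (simp add: right_diff_distrib[symmetric] norm_mult)
    then show ?thesis using b s unfolding cn_density_def
      by (simp add: power_mult_distrib)
  qed
  then have "ennreal (b\<^sup>2) * (ennreal (cn_density (a + of_real b * mu) (b\<^sup>2 * s) (a + of_real b * z)) * x) = ennreal (cn_density mu s z) * x" for z x
    using s by (subst mult.assoc[symmetric], subst ennreal_mult[symmetric]) (simp_all add: cn_density_def)
  then show ?thesis
    unfolding nn_integral_CN[OF assms(1)]
    by (subst nn_integral_lborel_affine[where r=b and t=a], use b in \<open>simp_all add: nn_integral_CN nn_integral_cmult[symmetric]\<close>)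
       (simp add: scaleR_conv_of_real)
qed

lemma nn_integral_CN_phase:
  assumes [measurable]: "f \<in> borel_measurable borel" and u: "cmod u = 1"
  shows "(\<integral>\<^sup>+z. f (u * z) \<partial>CN 0 s) = (\<integral>\<^sup>+z. f z \<partial>CN 0 s)"
proof -
  have "cn_density 0 s (u * z) = cn_density 0 s z" for z
    using u by (simp add: cn_density_def norm_mult)
  then show ?thesis
    using nn_integral_lborel_phase[OF _ u, of "\<lambda>z. ennreal (cn_density 0 s z) * f z"]
    by (simp add: nn_integral_CN)
qed

lemma nn_integral_CN_cmod_square:
  assumes [measurable]: "f \<in> borel_measurable borel" and s: "s > 0"
  shows "(\<integral>\<^sup>+z. f ((cmod z)\<^sup>2) \<partial>CN 0 s) = (\<integral>\<^sup>+x\<in>{0<..}. ennreal (exp (- x / s) / s) * f x \<partial>lborel)"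
proof -
  have "ennreal pi * (ennreal (exp (- x / s) / (pi * s)) * y) = ennreal (exp (- x / s) / s) * y" for x y
    by (subst mult.assoc[symmetric], subst ennreal_mult[symmetric]) (use s in \<open>simp_all add: field_simps\<close>)
  then show ?thesis
    using nn_integral_lborel_cmod_square[of "\<lambda>x. ennreal (exp (- x / s) / (pi * s)) * f x"]
    by (simp add: nn_integral_CN cn_density_def nn_integral_cmult[symmetric] mult.assoc)
qed

lemma prob_space_CN_0: assumes s: "s > 0" shows "prob_space (CN 0 s)"
proof
  have "(\<integral>\<^sup>+x\<in>{0<..}. ennreal (exp (- x / s) / s) \<partial>lborel)
      = (\<integral>\<^sup>+x. ennreal (1 / s) * (ennreal (exp (- (1 / s) * x)) * indicator {0<..} x * indicator {0<..} x) \<partial>lborel)"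
    using s by (intro nn_integral_cong) (auto simp: indicator_def ennreal_mult[symmetric])
  also have "\<dots> = 1"
    using nn_integral_exponential[of "1 / s" 0] s by (simp add: nn_integral_cmult ennreal_mult[symmetric])
  finally show "emeasure (CN 0 s) (space (CN 0 s)) = 1"
    using nn_integral_CN_cmod_square[of "\<lambda>_. 1", OF _ s] by simp
qed

lemma prob_space_CN: assumes s: "s > 0" shows "prob_space (CN mu s)"
proof
  show "emeasure (CN mu s) (space (CN mu s)) = 1"
    using nn_integral_CN_affine[of "\<lambda>_. 1" 1 s mu 0] s prob_space.emeasure_space_1[OF prob_space_CN_0[OF s]]
    by simp
qed

text \<open>The joint density depends on \<open>x\<close> and \<open>y\<close> only through the sum
  of their squared moduli, which a rotation preserves. That sum is kept as a second argument because
  later uses need the joint law of a linear form and the norm.\<close>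

lemma nn_integral_CN_pair_rotation:
  assumes F [measurable]: "(\<lambda>(x, y). F x y) \<in> borel_measurable (borel \<Otimes>\<^sub>M borel)"
    and cs: "c\<^sup>2 + d\<^sup>2 = 1"
  shows "(\<integral>\<^sup>+x. \<integral>\<^sup>+y. F (of_real c * x + of_real d * y) ((cmod x)\<^sup>2 + (cmod y)\<^sup>2) \<partial>CN 0 1 \<partial>CN 0 1)
       = (\<integral>\<^sup>+x. \<integral>\<^sup>+y. F x ((cmod x)\<^sup>2 + (cmod y)\<^sup>2) \<partial>CN 0 1 \<partial>CN 0 1)"
proof -
  let ?G = "\<lambda>x y. ennreal (exp (- ((cmod x)\<^sup>2 + (cmod y)\<^sup>2)) / (pi * pi)) * F x ((cmod x)\<^sup>2 + (cmod y)\<^sup>2)"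
  have rot: "(cmod (c *\<^sub>R x + d *\<^sub>R y))\<^sup>2 + (cmod (c *\<^sub>R y - d *\<^sub>R x))\<^sup>2 = (cmod x)\<^sup>2 + (cmod y)\<^sup>2" for x y
  proof -
    have "(cmod (c *\<^sub>R x + d *\<^sub>R y))\<^sup>2 + (cmod (c *\<^sub>R y - d *\<^sub>R x))\<^sup>2 = (c\<^sup>2 + d\<^sup>2) * ((cmod x)\<^sup>2 + (cmod y)\<^sup>2)"
      unfolding cmod_power2 by (simp add: algebra_simps power2_eq_square)
    then show ?thesis using cs by simp
  qed
  have *: "ennreal (cn_density 0 1 x) * (ennreal (cn_density 0 1 y) * z) = ennreal (exp (- ((cmod x)\<^sup>2 + (cmod y)\<^sup>2)) / (pi * pi)) * z" for x y z
    by (subst mult.assoc[symmetric], subst ennreal_mult[symmetric])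
       (simp_all add: cn_density_def exp_add[symmetric])
  have "(\<integral>\<^sup>+x. \<integral>\<^sup>+y. ?G (c *\<^sub>R x + d *\<^sub>R y) (c *\<^sub>R y - d *\<^sub>R x) \<partial>lborel \<partial>lborel) = (\<integral>\<^sup>+x. \<integral>\<^sup>+y. ?G x y \<partial>lborel \<partial>lborel)"
    by (rule nn_integral_lborel_rotation) (use cs in measurable)
  then show ?thesis
    unfolding rot by (simp add: nn_integral_CN nn_integral_cmult[symmetric] * scaleR_conv_of_real)
qed

section \<open>Finite products of probability spaces\<close>

text \<open>Both sides are identified with the product of the one-coordinate image laws
  \<open>K\<close>, since a product measure is determined by its values on rectangles.\<close>

lemma distr_PiM_eq_density:
  assumes I: "finite I" and M: "\<And>i. prob_space (M i)" and N: "\<And>i. prob_space (N i)"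
    and f [measurable]: "\<And>i. f i \<in> measurable (M i) (N i)"
    and p [measurable]: "\<And>i. p i \<in> borel_measurable (N i)"
    and eq: "\<And>i. i \<in> I \<Longrightarrow> distr (M i) (N i) (f i) = density (N i) (p i)"
  shows "distr (PiM I M) (PiM I N) (\<lambda>x. \<lambda>i\<in>I. f i (x i)) = density (PiM I N) (\<lambda>x. \<Prod>i\<in>I. p i (x i))"
proof -
  define K where "K i = distr (M i) (N i) (f i)" for i
  have K: "prob_space (K i)" for i
    unfolding K_def by (intro prob_space.prob_space_distr M f)
  interpret K: product_prob_space K by (intro product_prob_spaceI K)
  interpret M: product_prob_space M by (intro product_prob_spaceI M)
  interpret N: product_prob_space N by (intro product_prob_spaceI N)
  have sets: "sets (PiM I K) = sets (PiM I N)" by (intro sets_PiM_cong) (auto simp: K_def)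
  have "distr (PiM I M) (PiM I N) (\<lambda>x. \<lambda>i\<in>I. f i (x i)) = PiM I K"
  proof (rule K.PiM_eqI[OF I])
    fix A assume A: "\<And>i. i \<in> I \<Longrightarrow> A i \<in> sets (K i)"
    then have A' [measurable]: "\<And>i. i \<in> I \<Longrightarrow> A i \<in> sets (N i)" by (simp add: K_def)
    have "(\<lambda>x. \<lambda>i\<in>I. f i (x i)) -` Pi\<^sub>E I A \<inter> space (PiM I M) = (\<Pi>\<^sub>E i\<in>I. f i -` A i \<inter> space (M i))"
      by (auto simp: space_PiM PiE_iff)
    then show "emeasure (distr (PiM I M) (PiM I N) (\<lambda>x. \<lambda>i\<in>I. f i (x i))) (Pi\<^sub>E I A) = (\<Prod>i\<in>I. emeasure (K i) (A i))"
      using I A' by (subst emeasure_distr)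
        (auto simp: M.emeasure_PiM K_def emeasure_distr intro!: sets_PiM_I_finite prod.cong)
  qed (simp add: sets)
  also have "\<dots> = density (PiM I N) (\<lambda>x. \<Prod>i\<in>I. p i (x i))"
  proof (rule K.PiM_eqI[OF I, symmetric])
    fix A assume A: "\<And>i. i \<in> I \<Longrightarrow> A i \<in> sets (K i)"
    then have A' [measurable]: "\<And>i. i \<in> I \<Longrightarrow> A i \<in> sets (N i)" by (simp add: K_def)
    have "emeasure (density (PiM I N) (\<lambda>x. \<Prod>i\<in>I. p i (x i))) (Pi\<^sub>E I A)
        = (\<integral>\<^sup>+x. (\<Prod>i\<in>I. p i (x i)) * indicator (Pi\<^sub>E I A) x \<partial>PiM I N)"
      using I A' by (intro emeasure_density) (auto intro!: sets_PiM_I_finite)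
    also have "\<dots> = (\<integral>\<^sup>+x. (\<Prod>i\<in>I. p i (x i) * indicator (A i) (x i)) \<partial>PiM I N)"
    proof (intro nn_integral_cong)
      fix x assume "x \<in> space (PiM I N)"
      then have "indicator (Pi\<^sub>E I A) x = (\<Prod>i\<in>I. indicator (A i) (x i) :: ennreal)"
        using I by (auto simp: space_PiM PiE_iff indicator_def prod_zero_iff)
      then show "(\<Prod>i\<in>I. p i (x i)) * indicator (Pi\<^sub>E I A) x = (\<Prod>i\<in>I. p i (x i) * indicator (A i) (x i))"
        by (simp add: prod.distrib)
    qed
    also have "\<dots> = (\<Prod>i\<in>I. \<integral>\<^sup>+x. p i x * indicator (A i) x \<partial>N i)"
      by (rule N.product_nn_integral_prod[OF I]) measurable
    also have "\<dots> = (\<Prod>i\<in>I. emeasure (K i) (A i))"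
      by (intro prod.cong) (auto simp: K_def eq emeasure_density)
    finally show "emeasure (density (PiM I N) (\<lambda>x. \<Prod>i\<in>I. p i (x i))) (Pi\<^sub>E I A) = (\<Prod>i\<in>I. emeasure (K i) (A i))" .
  qed (simp add: sets)
  finally show ?thesis .
qed

lemma prob_Fubini:
  assumes "prob_space M" "prob_space N"
    and "(\<lambda>(x, y). f x y) \<in> borel_measurable (M \<Otimes>\<^sub>M N)"
  shows "(\<integral>\<^sup>+x. \<integral>\<^sup>+y. f x y \<partial>N \<partial>M) = (\<integral>\<^sup>+y. \<integral>\<^sup>+x. f x y \<partial>M \<partial>N)"
  using assms(3)
  by (intro pair_sigma_finite.Fubini'[symmetric] pair_sigma_finite.intro prob_space_imp_sigma_finite assms(1,2))
     (simp add: measurable_pair_swap)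

lemma nn_integral_PiM_single:
  assumes "i \<in> I" and B: "prob_space B" and [measurable]: "f \<in> borel_measurable B"
  shows "(\<integral>\<^sup>+x. f (x i) \<partial>PiM I (\<lambda>_. B)) = (\<integral>\<^sup>+x. f x \<partial>B)"
  using assms(1) by (subst (2) distr_PiM_component[where M="\<lambda>_. B", OF B assms(1), symmetric], subst nn_integral_distr) auto

text \<open>Pairwise independence of the codewords in a random code: the sent one and a competing
  one.\<close>

lemma nn_integral_PiM_pair:
  fixes I :: "'i set"
  assumes I: "finite I" "i \<in> I" "j \<in> I" "i \<noteq> j" and B: "prob_space B"
    and f [measurable]: "(\<lambda>(x, y). f x y) \<in> borel_measurable (B \<Otimes>\<^sub>M B)"
  shows "(\<integral>\<^sup>+x. f (x i) (x j) \<partial>PiM I (\<lambda>_. B)) = (\<integral>\<^sup>+x. \<integral>\<^sup>+y. f x y \<partial>B \<partial>B)"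
proof -
  interpret B: prob_space B by fact
  interpret P: product_sigma_finite "\<lambda>_::'i. B" by standard
  define J where "J = I - {i, j}"
  have J: "I = insert j (insert i J)" "j \<notin> insert i J" "i \<notin> J" "finite J" using I by (auto simp: J_def)
  interpret PJ: prob_space "PiM J (\<lambda>_. B)" by (intro prob_space_PiM B)
  have "(\<integral>\<^sup>+x. f (x i) (x j) \<partial>PiM I (\<lambda>_. B)) = (\<integral>\<^sup>+z. \<integral>\<^sup>+x. \<integral>\<^sup>+y. f x y \<partial>B \<partial>B \<partial>PiM J (\<lambda>_. B))"
    unfolding J(1) using J I by (subst P.product_nn_integral_insert, simp, simp, measurable, subst P.product_nn_integral_insert) auto
  then show ?thesis by (simp add: PJ.emeasure_space_1)
qed

text \<open>If tilting one coordinate by \<open>p i\<close> gives \<open>f i\<close> the law of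
  \<open>S\<close>, then tilting all coordinates gives the sum of the \<open>f i\<close> the law of
  the sum of independent copies of \<open>S\<close>. The induction must generalise \<open>g\<close>:
  when one coordinate is integrated, the others enter as a shift of the test function.\<close>

lemma nn_integral_PiM_sum_law:
  fixes f :: "'i \<Rightarrow> 'b \<Rightarrow> real" and p :: "'i \<Rightarrow> 'b \<Rightarrow> ennreal"
  assumes I: "finite I" and B: "prob_space B"
    and f [measurable]: "\<And>i. f i \<in> borel_measurable B" and p [measurable]: "\<And>i. p i \<in> borel_measurable B"
    and S [measurable]: "S \<in> borel_measurable B"
    and eq: "\<And>i g. i \<in> I \<Longrightarrow> g \<in> borel_measurable borel \<Longrightarrow> (\<integral>\<^sup>+b. p i b * g (f i b) \<partial>B) = (\<integral>\<^sup>+b. g (S b) \<partial>B)"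
    and g: "g \<in> borel_measurable borel"
  shows "(\<integral>\<^sup>+x. (\<Prod>i\<in>I. p i (x i)) * g (\<Sum>i\<in>I. f i (x i)) \<partial>PiM I (\<lambda>_. B)) = (\<integral>\<^sup>+x. g (\<Sum>i\<in>I. S (x i)) \<partial>PiM I (\<lambda>_. B))"
  using I eq g
proof (induction I arbitrary: g rule: finite_induct)
  case (insert j I)
  interpret B: prob_space B by fact
  interpret P: product_sigma_finite "\<lambda>_::'i. B" by standard
  have PI: "prob_space (PiM I (\<lambda>_. B))" by (intro prob_space_PiM B)
  interpret PI: prob_space "PiM I (\<lambda>_. B)" by fact
  note [measurable] = insert.prems(2)
  have upd: "(\<Prod>i\<in>I. p i ((x(j := y)) i)) = (\<Prod>i\<in>I. p i (x i))"
    "(\<Sum>i\<in>I. f i ((x(j := y)) i)) = (\<Sum>i\<in>I. f i (x i))"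
    "(\<Sum>i\<in>I. S ((x(j := y)) i)) = (\<Sum>i\<in>I. S (x i))" for x y
    using insert.hyps by (intro prod.cong sum.cong; auto)+
  have "(\<integral>\<^sup>+x. (\<Prod>i\<in>insert j I. p i (x i)) * g (\<Sum>i\<in>insert j I. f i (x i)) \<partial>PiM (insert j I) (\<lambda>_. B))
     = (\<integral>\<^sup>+x. \<integral>\<^sup>+y. (\<Prod>i\<in>I. p i (x i)) * (p j y * g (f j y + (\<Sum>i\<in>I. f i (x i)))) \<partial>B \<partial>PiM I (\<lambda>_. B))"
    using insert.hyps
    by (subst P.product_nn_integral_insert)
       (auto simp: upd fun_upd_same mult_ac simp del: fun_upd_apply)
  also have "\<dots> = (\<integral>\<^sup>+x. (\<Prod>i\<in>I. p i (x i)) * (\<integral>\<^sup>+y. p j y * g (f j y + (\<Sum>i\<in>I. f i (x i))) \<partial>B) \<partial>PiM I (\<lambda>_. B))"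
    by (intro nn_integral_cong nn_integral_cmult) measurable
  also have "\<dots> = (\<integral>\<^sup>+x. (\<Prod>i\<in>I. p i (x i)) * (\<integral>\<^sup>+y. g (S y + (\<Sum>i\<in>I. f i (x i))) \<partial>B) \<partial>PiM I (\<lambda>_. B))"
  proof -
    have "(\<integral>\<^sup>+y. p j y * g (f j y + (\<Sum>i\<in>I. f i (x i))) \<partial>B) = (\<integral>\<^sup>+y. g (S y + (\<Sum>i\<in>I. f i (x i))) \<partial>B)" for x
      by (rule insert.prems(1)[of j "\<lambda>t. g (t + (\<Sum>i\<in>I. f i (x i)))"]) auto
    then show ?thesis by simp
  qed
  also have "\<dots> = (\<integral>\<^sup>+x. \<integral>\<^sup>+y. (\<Prod>i\<in>I. p i (x i)) * g (S y + (\<Sum>i\<in>I. f i (x i))) \<partial>B \<partial>PiM I (\<lambda>_. B))"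
    by (intro nn_integral_cong nn_integral_cmult[symmetric]) measurable
  also have "\<dots> = (\<integral>\<^sup>+y. \<integral>\<^sup>+x. (\<Prod>i\<in>I. p i (x i)) * g (S y + (\<Sum>i\<in>I. f i (x i))) \<partial>PiM I (\<lambda>_. B) \<partial>B)"
    by (rule prob_Fubini[OF PI B]) measurable
  also have "\<dots> = (\<integral>\<^sup>+y. \<integral>\<^sup>+x. g (S y + (\<Sum>i\<in>I. S (x i))) \<partial>PiM I (\<lambda>_. B) \<partial>B)"
    by (intro nn_integral_cong insert.IH[where g="\<lambda>t. g (S _ + t)"] insert.prems(1)) auto
  also have "\<dots> = (\<integral>\<^sup>+x. g (\<Sum>i\<in>insert j I. S (x i)) \<partial>PiM (insert j I) (\<lambda>_. B))"
    using insert.hyps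
    by (subst P.product_nn_integral_insert_rev)
       (auto simp: upd fun_upd_same simp del: fun_upd_apply)
  finally show ?case .
qed simp

lemma exists_le_nn_integral:
  assumes "prob_space P" and C: "C \<ge> 0" and [measurable]: "f \<in> borel_measurable P" and le: "(\<integral>\<^sup>+x. f x \<partial>P) \<le> ennreal C"
  shows "\<exists>x\<in>space P. f x \<le> ennreal C"
proof (rule ccontr)
  interpret prob_space P by fact
  assume "\<not> ?thesis"
  then have gt: "\<And>x. x \<in> space P \<Longrightarrow> ennreal C < f x" by force
  \<comment> \<open>The truncated subtraction can be undone exactly because \<open>f\<close> exceeds
    \<open>C\<close> at every point; the surplus then has integral zero while being positive
    everywhere.\<close>
  have "(\<integral>\<^sup>+x. f x - ennreal C \<partial>P) + ennreal C = (\<integral>\<^sup>+x. (f x - ennreal C) + ennreal C \<partial>P)"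
    by (subst nn_integral_add) (auto simp: emeasure_space_1)
  also have "\<dots> = (\<integral>\<^sup>+x. f x \<partial>P)"
    by (intro nn_integral_cong diff_add_cancel_ennreal less_imp_le gt)
  finally have "(\<integral>\<^sup>+x. f x - ennreal C \<partial>P) + ennreal C \<le> ennreal C" using le by simp
  then have "(\<integral>\<^sup>+x. f x - ennreal C \<partial>P) = 0"
    using C by (cases "\<integral>\<^sup>+x. f x - ennreal C \<partial>P") (auto simp flip: ennreal_plus simp: top_unique)
  then have "AE x in P. f x - ennreal C = 0" by (subst (asm) nn_integral_0_iff_AE) auto
  then have "AE x in P. False"
    using AE_space
  proof eventually_elim
    case (elim x)
    with gt[of x] show False by (simp add: ennreal_minus_eq_0 not_le leD)
  qed
  then show False by simp
qed

section \<open>Unitary invariance of Gaussian vectors\<close>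

lemma complex_unit_phase: "\<exists>u. cmod u = 1 \<and> b = of_real (cmod b) * u"
proof (cases "b = 0")
  case False
  then show ?thesis by (intro exI[of _ "b / of_real (cmod b)"]) (simp add: norm_divide)
qed (auto intro: exI[of _ 1])

text \<open>Prior of \<open>h\<close> times likelihood of \<open>v = a h + noise\<close> equals
  marginal of \<open>v\<close> times posterior of \<open>h\<close>. It is used with
  \<open>a = 1\<close> for the pilot estimate, and with \<open>t = 1\<close> for the data component
  along the codeword.\<close>

lemma cn_density_bayes:
  assumes s: "s > 0" and t: "t > 0"
  shows "cn_density mu s h * cn_density (of_real a * h) t v =
     cn_density (of_real a * mu) (s * a\<^sup>2 + t) v *
     cn_density ((of_real (s * a) * v + of_real t * mu) / of_real (s * a\<^sup>2 + t)) (s * t / (s * a\<^sup>2 + t)) h"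
proof -
  let ?d = "s * a\<^sup>2 + t"
  let ?m = "(of_real (s * a) * v + of_real t * mu) / of_real ?d"
  have d: "?d > 0" using s t by (simp add: add_nonneg_pos)
  have "h - ?m = (of_real ?d * h - (of_real (s * a) * v + of_real t * mu)) / of_real ?d"
    using d by (simp add: field_simps del: of_real_add of_real_mult)
  then have 1: "(cmod (h - ?m))\<^sup>2 = (cmod (of_real ?d * h - (of_real (s * a) * v + of_real t * mu)))\<^sup>2 / ?d\<^sup>2"
    using d by (simp add: norm_divide power_divide del: of_real_add of_real_mult)
  \<comment> \<open>Completing the square in \<open>h\<close>, multiplied through by the common
    denominator.\<close>
  have 2: "?d * t * (cmod (h - mu))\<^sup>2 + ?d * s * (cmod (v - of_real a * h))\<^sup>2 =
     s * t * (cmod (v - of_real a * mu))\<^sup>2 + (cmod (of_real ?d * h - (of_real (s * a) * v + of_real t * mu)))\<^sup>2"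
    unfolding cmod_power2 by (simp add: power2_eq_square algebra_simps)
  have "(cmod (h - mu))\<^sup>2 / s + (cmod (v - of_real a * h))\<^sup>2 / t =
      (?d * t * (cmod (h - mu))\<^sup>2 + ?d * s * (cmod (v - of_real a * h))\<^sup>2) / (s * t * ?d)"
    using s t d by (simp add: add_divide_distrib)
  also have "\<dots> = (cmod (v - of_real a * mu))\<^sup>2 / ?d + (cmod (h - ?m))\<^sup>2 / (s * t / ?d)"
    unfolding 1 2 using s t d by (simp add: add_divide_distrib power2_eq_square)
  finally have "exp (- (cmod (h - mu))\<^sup>2 / s) * exp (- (cmod (v - of_real a * h))\<^sup>2 / t) =
      exp (- (cmod (v - of_real a * mu))\<^sup>2 / ?d) * exp (- (cmod (h - ?m))\<^sup>2 / (s * t / ?d))"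
    by (simp add: exp_add[symmetric])
  moreover have "(pi * s) * (pi * t) = (pi * ?d) * (pi * (s * t / ?d))"
    using d by simp
  ultimately show ?thesis
    unfolding cn_density_def by (simp only: times_divide_times_eq)
qed

abbreviation "CN_std \<equiv> CN 0 1"

abbreviation "CN_vec I \<equiv> PiM I (\<lambda>_. CN_std)"

interpretation CN_std: prob_space CN_std by (rule prob_space_CN) simp

interpretation CN_vec: product_sigma_finite "\<lambda>_. CN_std" by standard

lemma prob_space_CN_vec: "prob_space (CN_vec I)"
  by (intro prob_space_PiM CN_std.prob_space_axioms)

text \<open>The phase of \<open>b\<close> is absorbed into \<open>y\<close>; the coefficients are
  then real and a rotation moves them both onto \<open>x\<close>. This merges two coordinates into
  one in the induction below.\<close>

lemma CN_std_pair_linear: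
  assumes F [measurable]: "(\<lambda>(x, y). F x y) \<in> borel_measurable (borel \<Otimes>\<^sub>M borel)"
  shows "(\<integral>\<^sup>+x. \<integral>\<^sup>+y. F (of_real r * x + b * y) ((cmod x)\<^sup>2 + (cmod y)\<^sup>2) \<partial>CN_std \<partial>CN_std)
       = (\<integral>\<^sup>+x. \<integral>\<^sup>+y. F (of_real (sqrt (r\<^sup>2 + (cmod b)\<^sup>2)) * x) ((cmod x)\<^sup>2 + (cmod y)\<^sup>2) \<partial>CN_std \<partial>CN_std)"
proof -
  obtain u where u: "cmod u = 1" "b = of_real (cmod b) * u"
    using complex_unit_phase[of b] by blast
  let ?R = "sqrt (r\<^sup>2 + (cmod b)\<^sup>2)"
  show ?thesis
  proof (cases "?R = 0")
    case True
    then have "r = 0" "b = 0" by (auto simp: add_nonneg_eq_0_iff)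
    then show ?thesis by simp
  next
    case False
    have "(\<integral>\<^sup>+y. F (of_real r * x + b * y) ((cmod x)\<^sup>2 + (cmod y)\<^sup>2) \<partial>CN_std) =
        (\<integral>\<^sup>+y. F (of_real r * x + of_real (cmod b) * y) ((cmod x)\<^sup>2 + (cmod y)\<^sup>2) \<partial>CN_std)" for x
      using u nn_integral_CN_phase[OF _ u(1), where f = "\<lambda>y. F (of_real r * x + of_real (cmod b) * y) ((cmod x)\<^sup>2 + (cmod y)\<^sup>2)"]
      by (simp add: norm_mult mult.assoc[symmetric])
    moreover have "(r / ?R)\<^sup>2 + (cmod b / ?R)\<^sup>2 = 1"
      using False by (simp add: power_divide add_divide_distrib[symmetric])
    note nn_integral_CN_pair_rotation[OF _ this, of "\<lambda>x. F (of_real ?R * x)"]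
    moreover have "of_real ?R * (of_real (r / ?R) * x + of_real (cmod b / ?R) * y) = of_real r * x + of_real (cmod b) * y" for x y :: complex
    proof -
      have "of_real ?R * (of_real (r / ?R) * x + of_real (cmod b / ?R) * y)
         = of_real (?R * (r / ?R)) * x + of_real (?R * (cmod b / ?R)) * y"
        by (simp only: of_real_mult distrib_left mult.assoc)
      then show ?thesis using False by simp
    qed
    ultimately show ?thesis by (simp del: of_real_divide)
  qed
qed

text \<open>Unitary invariance in the only form that is needed, without unitary matrices: the joint
  law of a linear form and the squared norm depends on the coefficients only through their
  length.\<close>

lemma CN_vec_linear:
  assumes I: "finite I" "i0 \<in> I"
    and F: "(\<lambda>(x, y). F x y) \<in> borel_measurable (borel \<Otimes>\<^sub>M borel)"
  shows "(\<integral>\<^sup>+w. F (\<Sum>i\<in>I. u i * w i) (\<Sum>i\<in>I. (cmod (w i))\<^sup>2) \<partial>CN_vec I)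
       = (\<integral>\<^sup>+w. F (of_real (sqrt (\<Sum>i\<in>I. (cmod (u i))\<^sup>2)) * w i0) (\<Sum>i\<in>I. (cmod (w i))\<^sup>2) \<partial>CN_vec I)"
proof -
  have "(\<integral>\<^sup>+w. F (\<Sum>i\<in>insert i0 J. u i * w i) (\<Sum>i\<in>insert i0 J. (cmod (w i))\<^sup>2) \<partial>CN_vec (insert i0 J))
       = (\<integral>\<^sup>+w. F (of_real (sqrt (\<Sum>i\<in>insert i0 J. (cmod (u i))\<^sup>2)) * w i0) (\<Sum>i\<in>insert i0 J. (cmod (w i))\<^sup>2) \<partial>CN_vec (insert i0 J))"
    if "finite J" "i0 \<notin> J" "(\<lambda>(x, y). F x y) \<in> borel_measurable (borel \<Otimes>\<^sub>M borel)" for J F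
    using that
  proof (induction J arbitrary: F rule: finite_induct)
    case empty
    note [measurable] = empty.prems(2)
    obtain v where v: "cmod v = 1" "u i0 = of_real (cmod (u i0)) * v"
      using complex_unit_phase[of "u i0"] by blast
    have "(\<integral>\<^sup>+w. F (u i0 * w) ((cmod w)\<^sup>2) \<partial>CN_std) = (\<integral>\<^sup>+w. F (of_real (cmod (u i0)) * w) ((cmod w)\<^sup>2) \<partial>CN_std)"
      using v nn_integral_CN_phase[OF _ v(1), where f = "\<lambda>y. F (of_real (cmod (u i0)) * y) ((cmod y)\<^sup>2)"]
      by (simp add: norm_mult mult.assoc[symmetric])
    then show ?case
      using CN_vec.product_nn_integral_singleton[of "\<lambda>w. F (u i0 * w) ((cmod w)\<^sup>2)" i0]
        CN_vec.product_nn_integral_singleton[of "\<lambda>w. F (of_real (cmod (u i0)) * w) ((cmod w)\<^sup>2)" i0]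
      by simp
  next
    case (insert j J)
    note [measurable] = insert.prems(2)
    let ?I = "insert i0 J"
    let ?r = "sqrt (\<Sum>i\<in>?I. (cmod (u i))\<^sup>2)" and ?R = "sqrt (\<Sum>i\<in>insert j ?I. (cmod (u i))\<^sup>2)"
    have ij: "i0 \<noteq> j" "j \<notin> ?I" "i0 \<notin> J" "finite J" using insert by auto
    have R: "?R = sqrt (?r\<^sup>2 + (cmod (u j))\<^sup>2)"
      using ij by (simp add: sum_nonneg add.commute add_nonneg_nonneg)
    have upd: "(\<Sum>i\<in>?I. u i * (w(j := y)) i) = (\<Sum>i\<in>?I. u i * w i)"
         "(\<Sum>i\<in>?I. (cmod ((w(j := y)) i))\<^sup>2) = (\<Sum>i\<in>?I. (cmod (w i))\<^sup>2)"
         "(\<Sum>i\<in>J. (cmod ((w(i0 := y)) i))\<^sup>2) = (\<Sum>i\<in>J. (cmod (w i))\<^sup>2)" for w y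
      using ij by (intro sum.cong; auto)+
    have "(\<integral>\<^sup>+w. F (\<Sum>i\<in>insert j ?I. u i * w i) (\<Sum>i\<in>insert j ?I. (cmod (w i))\<^sup>2) \<partial>CN_vec (insert j ?I)) =
       (\<integral>\<^sup>+y. \<integral>\<^sup>+w. F (u j * y + (\<Sum>i\<in>?I. u i * w i)) ((cmod y)\<^sup>2 + (\<Sum>i\<in>?I. (cmod (w i))\<^sup>2)) \<partial>CN_vec ?I \<partial>CN_std)"
      using ij by (subst CN_vec.product_nn_integral_insert_rev)
        (auto simp: sum.insert[of ?I j] upd(1,2) fun_upd_same fun_upd_other simp del: sum.insert fun_upd_apply)
    also have "\<dots> = (\<integral>\<^sup>+y. \<integral>\<^sup>+w. F (u j * y + of_real ?r * w i0) ((cmod y)\<^sup>2 + (\<Sum>i\<in>?I. (cmod (w i))\<^sup>2)) \<partial>CN_vec ?I \<partial>CN_std)"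
      by (intro nn_integral_cong insert.IH) (use ij in \<open>auto\<close>)
    also have "\<dots> = (\<integral>\<^sup>+w. \<integral>\<^sup>+y. F (of_real ?r * w i0 + u j * y) ((cmod y)\<^sup>2 + (\<Sum>i\<in>?I. (cmod (w i))\<^sup>2)) \<partial>CN_std \<partial>CN_vec ?I)"
      by (subst prob_Fubini[OF CN_std.prob_space_axioms prob_space_CN_vec]) (measurable, simp add: add.commute)
    also have "\<dots> = (\<integral>\<^sup>+w. \<integral>\<^sup>+x. \<integral>\<^sup>+y. F (of_real ?r * x + u j * y) (((cmod x)\<^sup>2 + (cmod y)\<^sup>2) + (\<Sum>i\<in>J. (cmod (w i))\<^sup>2)) \<partial>CN_std \<partial>CN_std \<partial>CN_vec J)"
      using ij by (subst CN_vec.product_nn_integral_insert)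
        (auto simp: sum.insert[of J i0]  upd(3) ac_simps fun_upd_same fun_upd_other simp del: sum.insert fun_upd_apply)
    also have "\<dots> = (\<integral>\<^sup>+w. \<integral>\<^sup>+x. \<integral>\<^sup>+y. F (of_real ?R * x) (((cmod x)\<^sup>2 + (cmod y)\<^sup>2) + (\<Sum>i\<in>J. (cmod (w i))\<^sup>2)) \<partial>CN_std \<partial>CN_std \<partial>CN_vec J)"
      unfolding R by (intro nn_integral_cong CN_std_pair_linear) measurable
    also have "\<dots> = (\<integral>\<^sup>+w. \<integral>\<^sup>+y. F (of_real ?R * w i0) ((cmod y)\<^sup>2 + (\<Sum>i\<in>?I. (cmod (w i))\<^sup>2)) \<partial>CN_std \<partial>CN_vec ?I)"
      using ij by (subst CN_vec.product_nn_integral_insert)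
        (auto simp: sum.insert[of J i0]  upd(3) ac_simps fun_upd_same fun_upd_other simp del: sum.insert fun_upd_apply)
    also have "\<dots> = (\<integral>\<^sup>+w. F (of_real ?R * w i0) (\<Sum>i\<in>insert j ?I. (cmod (w i))\<^sup>2) \<partial>CN_vec (insert j ?I))"
      using ij by (subst CN_vec.product_nn_integral_insert)
        (auto simp: sum.insert[of ?I j] upd(2) fun_upd_same fun_upd_other simp del: sum.insert fun_upd_apply)
    finally show ?case by (simp add: insert_commute)
  qed
  from this[OF _ _ F, of "I - {i0}"] show ?thesis using I by (simp add: insert_absorb)
qed

section \<open>Random directions and Bessel functions\<close>

lemma borel_measurable_sqnorm [measurable]:
  "(\<lambda>w. sqnorm m w) \<in> borel_measurable (PiM {..<m} (\<lambda>_. borel))"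
  "(\<lambda>w. sqnorm m w) \<in> borel_measurable (CN_vec {..<m})"
  unfolding sqnorm_def by measurable

lemma sqnorm_nonneg [simp]: "0 \<le> sqnorm m w"
  by (simp add: sqnorm_def sum_nonneg)

lemma nn_integral_CN_std_tail:
  assumes c: "c \<ge> 0"
  shows "(\<integral>\<^sup>+z. indicator {x. c < x} ((cmod z)\<^sup>2) \<partial>CN_std) = ennreal (exp (- c))"
  using nn_integral_exponential[of 1 c] c
  by (subst nn_integral_CN_cmod_square) (simp_all add: greaterThan_def mult.assoc ac_simps)

lemma nn_integral_CN_std_exp:
  assumes c: "c \<ge> 0"
  shows "(\<integral>\<^sup>+z. ennreal (exp (- c * (cmod z)\<^sup>2)) \<partial>CN_std) = ennreal (1 / (1 + c))"
proof -
  have "(\<integral>\<^sup>+x\<in>{0<..}. ennreal (exp (- x / 1) / 1) * ennreal (exp (- c * x)) \<partial>lborel)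
      = (\<integral>\<^sup>+x\<in>{0<..}. ennreal (exp (- (1 + c) * x)) * indicator {0<..} x \<partial>lborel)"
    by (intro nn_integral_cong) (auto simp: indicator_def ennreal_mult[symmetric] exp_add[symmetric] algebra_simps)
  then show ?thesis
    using nn_integral_CN_cmod_square[of "\<lambda>x. ennreal (exp (- c * x))" 1] nn_integral_exponential[of "1 + c" 0] c
    by (simp add: add_nonneg_pos)
qed

text \<open>Given the other coordinates, \<open>|w 0|^2\<close> is exponential, so the tail is a
  product of factors \<open>exp (- c |w i|^2)\<close>; each of the \<open>m - 1\<close> factors
  integrates to \<open>1 / (1 + c) = 1 - t\<close>.\<close>

lemma CN_vec_fraction_tail:
  assumes m: "m \<ge> 1" and t: "0 \<le> t" "t < 1"
  shows "(\<integral>\<^sup>+w. (if t * sqnorm m w < (cmod (w 0))\<^sup>2 then 1 else 0) \<partial>CN_vec {..<m}) = ennreal ((1 - t) ^ (m - 1))"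
proof -
  \<comment> \<open>Chosen so that \<open>t * (x + s) < x\<close> says the same as
    \<open>c * s < x\<close>, which moves the first coordinate to one side.\<close>
  define c where "c = t / (1 - t)"
  have c: "c \<ge> 0" "1 / (1 + c) = 1 - t" using t by (auto simp: c_def field_simps)
  have I: "{..<m} = insert 0 {1..<m}" using m by auto
  have 0: "0 \<in> {..<m}" using m by auto
  let ?S = "\<lambda>w. \<Sum>i\<in>{1..<m}. (cmod (w i))\<^sup>2"
  have S: "sqnorm m (w(0 := z)) = (cmod z)\<^sup>2 + ?S w" for w z
    unfolding sqnorm_def I by (subst sum.insert) (auto intro!: sum.cong)
  have iff: "t * (x + s) < x \<longleftrightarrow> c * s < x" for x s
    using t by (simp add: c_def field_simps)
  have meas: "(\<lambda>w. if t * sqnorm m w < (cmod (w 0))\<^sup>2 then 1 else 0 :: ennreal) \<in> borel_measurable (CN_vec {..<m})"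
    using 0 by measurable
  have "(\<integral>\<^sup>+w. (if t * sqnorm m w < (cmod (w 0))\<^sup>2 then 1 else 0) \<partial>CN_vec {..<m})
      = (\<integral>\<^sup>+w. \<integral>\<^sup>+z. indicator {x. c * ?S w < x} ((cmod z)\<^sup>2) \<partial>CN_std \<partial>CN_vec {1..<m})"
    unfolding I
    by (subst CN_vec.product_nn_integral_insert[OF _ _ meas[unfolded I]])
       (auto simp: S iff indicator_def simp del: fun_upd_apply simp: fun_upd_same intro!: nn_integral_cong)
  also have "\<dots> = (\<integral>\<^sup>+w. (\<Prod>i\<in>{1..<m}. ennreal (exp (- c * (cmod (w i))\<^sup>2))) \<partial>CN_vec {1..<m})"
    using c by (intro nn_integral_cong, subst nn_integral_CN_std_tail)
      (auto simp: sum_nonneg prod_ennreal exp_sum[symmetric] sum_distrib_left sum_negf)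
  also have "\<dots> = (\<Prod>i\<in>{1..<m}. ennreal (1 / (1 + c)))"
    using nn_integral_CN_std_exp[OF c(1)] by (subst CN_vec.product_nn_integral_prod) auto
  finally show ?thesis using c t by (simp add: ennreal_power)
qed

text \<open>Layer-cake formula; it turns the tail of the fraction into its moments.\<close>

lemma nn_integral_power_layer:
  assumes v: "0 \<le> v" "v \<le> 1" and k: "k \<ge> 1"
  shows "ennreal (v ^ k) = (\<integral>\<^sup>+t\<in>{0..1}. ennreal (real k * t ^ (k - 1)) * indicator {t. t < v} t \<partial>lborel)"
proof -
  have "(\<integral>\<^sup>+t\<in>{0..1}. ennreal (real k * t ^ (k - 1)) * indicator {t. t < v} t \<partial>lborel)
      = (\<integral>\<^sup>+t. ennreal (real k * t ^ (k - 1)) * indicator {0..v} t \<partial>lborel)"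
    by (rule nn_integral_cong_AE)
       (use v in \<open>auto intro!: AE_I'[of "{v}"] simp: indicator_def split: if_splits\<close>)
  also have "\<dots> = ennreal (v ^ k - 0 ^ k)"
    by (rule nn_integral_FTC_Icc) (use v in \<open>auto intro!: derivative_eq_intros\<close>)
  finally show ?thesis using k by (cases k) auto
qed

lemma nn_integral_Beta_nat:
  assumes k: "k \<ge> 1" and m: "m \<ge> 1"
  shows "(\<integral>\<^sup>+t\<in>{0..1}. ennreal (real k * t ^ (k - 1) * (1 - t) ^ (m - 1)) \<partial>lborel)
     = ennreal (fact k * fact (m - 1) / fact (k + (m - 1)))"
proof -
  obtain k' m' where km: "k = Suc k'" "m = Suc m'" using k m by (metis Suc_le_D One_nat_def)
  have "((\<lambda>t. real k * (t powr (real k - 1) * (1 - t) powr (real m - 1))) has_integral real k * Beta (real k) (real m)) {0..1}"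
    using k m by (intro has_integral_mult_right has_integral_Beta_real) auto
  then have "((\<lambda>t. real k * (t ^ (k - 1) * (1 - t) ^ (m - 1))) has_integral real k * Beta (real k) (real m)) {0..1}"
    \<comment> \<open>The endpoints are excepted because \<open>0 powr 0 = 0\<close> whereas
      \<open>0 ^ 0 = 1\<close>.\<close>
    by (rule has_integral_spike_finite[of "{0, 1}", rotated 2])
       (auto simp: km powr_realpow)
  moreover have "real k * Beta (real k) (real m) = fact k * fact (m - 1) / fact (k + (m - 1))"
  proof -
    have "Gamma (real k) = fact k'" "Gamma (real m) = fact m'"
      using Gamma_fact[of k', where 'a=real] Gamma_fact[of m', where 'a=real] by (simp_all add: km add.commute)
    moreover have "Gamma (real k + real m) = fact (k + m')"
      using Gamma_fact[of "k + m'", where 'a=real] by (simp add: km ac_simps)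
    ultimately show ?thesis by (simp add: Beta_def km)
  qed
  ultimately have "((\<lambda>t. real k * (t ^ (k - 1) * (1 - t) ^ (m - 1))) has_integral fact k * fact (m - 1) / fact (k + (m - 1))) {0..1}"
    by simp
  from nn_integral_has_integral_lebesgue[OF _ this]
  show ?thesis
    by (auto simp: ennreal_mult' mult_ac ennreal_indicator[symmetric] zero_le_mult_iff ennreal_mult''[symmetric] simp del: ennreal_indicator)
qed

text \<open>Integrating the tail against \<open>k * t ^ (k - 1)\<close> gives a Beta integral. The
  value at a zero vector is \<open>0\<close> by division by zero, which agrees with an empty tail
  event.\<close>

lemma CN_vec_fraction_moment:
  assumes m: "m \<ge> 1"
  shows "(\<integral>\<^sup>+w. ennreal (((cmod (w 0))\<^sup>2 / sqnorm m w) ^ k) \<partial>CN_vec {..<m})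
     = ennreal (fact k * fact (m - 1) / fact (k + (m - 1)))"
proof (cases "k = 0")
  case True
  then show ?thesis using prob_space.emeasure_space_1[OF prob_space_CN_vec] by simp
next
  case False
  then have k: "k \<ge> 1" by simp
  have 0 [measurable]: "0 \<in> {..<m}" using m by auto
  have le: "(cmod (w 0))\<^sup>2 \<le> sqnorm m w" for w
    unfolding sqnorm_def using 0 by (intro member_le_sum) auto
  have lt: "t < (cmod (w 0))\<^sup>2 / sqnorm m w \<longleftrightarrow> t * sqnorm m w < (cmod (w 0))\<^sup>2" if "t \<ge> 0" for w t
  proof (cases "sqnorm m w = 0")
    case True
    with le[of w] that show ?thesis by simp
  next
    case False
    then have "sqnorm m w > 0" using sqnorm_nonneg[of m w] by linarith
    then show ?thesis by (simp add: pos_less_divide_eq)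
  qed
  have "(\<integral>\<^sup>+w. ennreal (((cmod (w 0))\<^sup>2 / sqnorm m w) ^ k) \<partial>CN_vec {..<m}) =
     (\<integral>\<^sup>+w. (\<integral>\<^sup>+t\<in>{0..1}. ennreal (real k * t ^ (k - 1)) * indicator {t. t < (cmod (w 0))\<^sup>2 / sqnorm m w} t \<partial>lborel) \<partial>CN_vec {..<m})"
    using le k by (intro nn_integral_cong nn_integral_power_layer) (auto intro!: divide_le_eq_1[THEN iffD2] simp: less_le)
  also have "\<dots> = (\<integral>\<^sup>+w. (\<integral>\<^sup>+t. (ennreal (real k * t ^ (k - 1)) * indicator {0..1} t) * (if t * sqnorm m w < (cmod (w 0))\<^sup>2 then 1 else 0) \<partial>lborel) \<partial>CN_vec {..<m})"
    by (intro nn_integral_cong) (auto simp: indicator_def lt)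
  also have "\<dots> = (\<integral>\<^sup>+t. (\<integral>\<^sup>+w. (ennreal (real k * t ^ (k - 1)) * indicator {0..1} t) * (if t * sqnorm m w < (cmod (w 0))\<^sup>2 then 1 else 0) \<partial>CN_vec {..<m}) \<partial>lborel)"
    by (intro pair_sigma_finite.Fubini'[symmetric] pair_sigma_finite.intro prob_space_imp_sigma_finite prob_space_CN_vec lborel.sigma_finite_measure_axioms) measurable
  also have "\<dots> = (\<integral>\<^sup>+t. (ennreal (real k * t ^ (k - 1)) * indicator {0..1} t) * (\<integral>\<^sup>+w. (if t * sqnorm m w < (cmod (w 0))\<^sup>2 then 1 else 0) \<partial>CN_vec {..<m}) \<partial>lborel)"
    by (intro nn_integral_cong nn_integral_cmult) measurable
  also have "\<dots> = (\<integral>\<^sup>+t\<in>{0..1}. ennreal (real k * t ^ (k - 1) * (1 - t) ^ (m - 1)) \<partial>lborel)"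
  proof (rule nn_integral_cong_AE)
    \<comment> \<open>The tail formula is available only for \<open>t < 1\<close>.\<close>
    have "AE t in lborel. t \<noteq> (1::real)" by (rule AE_lborel_singleton)
    then show "AE t in lborel. ennreal (real k * t ^ (k - 1)) * indicator {0..1} t *
        (\<integral>\<^sup>+w. (if t * sqnorm m w < (cmod (w 0))\<^sup>2 then 1 else 0) \<partial>CN_vec {..<m})
      = ennreal (real k * t ^ (k - 1) * (1 - t) ^ (m - 1)) * indicator {0..1} t"
    proof eventually_elim
      case (elim t)
      then consider "t < 0 \<or> t > 1" | "0 \<le> t" "t < 1" by force
      then show ?case
      proof cases
        case 2
        then show ?thesis using CN_vec_fraction_tail[OF m 2]
          by (simp add: indicator_def ennreal_mult[symmetric])
      qed (auto simp: indicator_def)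
    qed
  qed
  also have "\<dots> = ennreal (fact k * fact (m - 1) / fact (k + (m - 1)))"
    by (rule nn_integral_Beta_nat[OF k m])
  finally show ?thesis .
qed

text \<open>This is \<open>bessel_I n (2 * sqrt t)\<close> without its factor
  \<open>sqrt t ^ n\<close>: a power series in \<open>t\<close> itself, free of roots. The
  denominator \<open>(sqrt ...) ^ (m - 1)\<close> in \<open>f_out\<close> cancels exactly that
  factor.\<close>

definition bessel_series :: "nat \<Rightarrow> real \<Rightarrow> real" where
  "bessel_series n t = (\<Sum>k. t ^ k / (fact k * fact (k + n)))"

lemma summable_bessel_series: "summable (\<lambda>k. (t::real) ^ k / (fact k * fact (k + n)))"
proof (rule summable_comparison_test')
  show "summable (\<lambda>k. \<bar>t\<bar> ^ k / fact k)" using summable_exp[of "\<bar>t\<bar>"] by (simp add: field_simps)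
  fix k :: nat
  have "(1::real) \<le> fact (k + n)" by (rule fact_ge_1)
  then show "norm (t ^ k / (fact k * fact (k + n))) \<le> \<bar>t\<bar> ^ k / fact k"
    using mult_right_mono[of 1 "fact (k + n)" "\<bar>t\<bar> ^ k"] by (simp add: power_abs abs_mult divide_simps mult.commute)
qed

lemma bessel_I_eq_series:
  assumes "t \<ge> 0"
  shows "bessel_I n (2 * sqrt t) = sqrt t ^ n * bessel_series n t"
  unfolding bessel_I_def bessel_series_def
proof -
  have "(2 * sqrt t / 2) ^ (2 * k + n) / (fact k * fact (k + n)) = sqrt t ^ n * (t ^ k / (fact k * fact (k + n)))" for k
    using assms by (simp add: power_add power_mult)
  then show "(\<Sum>k. (2 * sqrt t / 2) ^ (2 * k + n) / (fact k * fact (k + n))) = sqrt t ^ n * (\<Sum>k. t ^ k / (fact k * fact (k + n)))"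
    by (subst suminf_mult[OF summable_bessel_series, symmetric]) simp
qed

lemma bessel_series_pos: "t \<ge> 0 \<Longrightarrow> bessel_series n t > 0"
  unfolding bessel_series_def
  by (rule suminf_pos2[OF summable_bessel_series, where i=0]) auto

lemma borel_measurable_bessel_series [measurable]: "bessel_series n \<in> borel_measurable borel"
  unfolding bessel_series_def by measurable

lemma borel_measurable_bessel_I [measurable]: "bessel_I n \<in> borel_measurable borel"
  unfolding bessel_I_def by measurable

section \<open>Exponential moments of phase-invariant laws\<close>

lemma borel_measurable_cnj [measurable]: "cnj \<in> borel_measurable borel"
  by (intro borel_measurable_continuous_onI continuous_intros)

text \<open>For \<open>u = cis (pi / (j - k))\<close>, rotating by \<open>u\<close> multiplies the
  integrand by \<open>cis pi = -1\<close>, so the moment equals its own negative.\<close>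

lemma phase_invariant_moment_zero:
  fixes L :: "complex measure"
  assumes L: "sets L = sets borel"
    and inv: "\<And>u. cmod u = 1 \<Longrightarrow> distr L borel (\<lambda>z. u * z) = L"
    and jk: "j \<noteq> k"
  shows "(\<integral>z. z ^ j * cnj z ^ k \<partial>L) = 0"
proof -
  define d where "d = real j - real k"
  have d: "d \<noteq> 0" using jk by (simp add: d_def)
  define u where "u = cis (pi / d)"
  have u: "u ^ j * cnj u ^ k = -1"
  proof -
    have "u ^ j * cnj u ^ k = cis (real j * (pi / d)) * cis (- (real k * (pi / d)))"
      by (simp only: u_def cis_cnj Complex.DeMoivre mult_minus_right)
    also have "\<dots> = cis (d * (pi / d))"
      by (simp add: cis_mult d_def algebra_simps diff_divide_distrib)
    finally show ?thesis using d by simp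
  qed
  have "(\<integral>z. z ^ j * cnj z ^ k \<partial>L) = (\<integral>z. z ^ j * cnj z ^ k \<partial>distr L borel (\<lambda>z. u * z))"
    by (simp add: inv u_def)
  also have "\<dots> = (\<integral>z. (u * z) ^ j * cnj (u * z) ^ k \<partial>L)"
    using L by (intro integral_distr) (auto simp: measurable_cong_sets[OF L refl])
  also have "\<dots> = (\<integral>z. (u ^ j * cnj u ^ k) * (z ^ j * cnj z ^ k) \<partial>L)"
    by (simp add: power_mult_distrib mult_ac)
  also have "\<dots> = - (\<integral>z. z ^ j * cnj z ^ k \<partial>L)"
    unfolding u by simp
  finally show ?thesis by simp
qed

text \<open>Expand \<open>exp (2 * Re z)\<close> in powers of \<open>z + cnj z\<close>. By phase
  invariance only the balanced terms \<open>z ^ k * cnj z ^ k\<close> survive, and the bound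
  \<open>B\<close> justifies integrating term by term.\<close>

lemma phase_invariant_mgf:
  fixes L :: "complex measure"
  assumes "prob_space L" and L: "sets L = sets borel"
    and inv: "\<And>u. cmod u = 1 \<Longrightarrow> distr L borel (\<lambda>z. u * z) = L"
    and bdd: "AE z in L. cmod z \<le> B"
  shows "(\<lambda>k. (\<integral>z. (cmod z) ^ (2 * k) \<partial>L) / (fact k)\<^sup>2) sums (\<integral>z. exp (2 * Re z) \<partial>L)"
proof -
  interpret prob_space L by fact
  note [measurable_cong] = L
  have B: "B \<ge> 0"
  proof -
    have "AE z in L. 0 \<le> B" using bdd by eventually_elim (use norm_ge_zero order_trans in blast)
    then show ?thesis by simp
  qed
  have int: "integrable L (\<lambda>z. z ^ j * cnj z ^ k)" for j k
    by (rule integrable_const_bound[where B="B ^ (j + k)"])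
       (use bdd B in \<open>auto elim!: eventually_mono simp: norm_mult norm_power power_add intro!: mult_mono power_mono\<close>)
  define f where "f n z = complex_of_real ((2 * Re z) ^ n / fact n)" for n z
  have f: "f n z = (\<Sum>j\<le>n. of_nat (n choose j) / fact n * (z ^ j * cnj z ^ (n - j)))" for n z
    unfolding f_def using binomial_ring[of z "cnj z" n]
    by (simp add: complex_add_cnj sum_divide_distrib mult_ac)
  have intf: "integrable L (f n)" for n
    unfolding f by (intro Bochner_Integration.integrable_sum integrable_mult_right int)
  have mom: "(\<integral>z. f n z \<partial>L) = (if even n then of_real ((\<integral>z. (cmod z) ^ n \<partial>L) / (fact (n div 2))\<^sup>2) else 0)" for n
  proof -
    have "(\<integral>z. f n z \<partial>L) = (\<Sum>j\<le>n. of_nat (n choose j) / fact n * (\<integral>z. z ^ j * cnj z ^ (n - j) \<partial>L))"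
      unfolding f by (subst Bochner_Integration.integral_sum) (auto intro!: integrable_mult_right int)
    also have "\<dots> = (\<Sum>j\<le>n. if j = n - j then of_nat (n choose j) / fact n * (\<integral>z. z ^ j * cnj z ^ (n - j) \<partial>L) else 0)"
      by (intro sum.cong) (auto simp: phase_invariant_moment_zero[OF L inv])
    also have "\<dots> = (if even n then of_real ((\<integral>z. (cmod z) ^ n \<partial>L) / (fact (n div 2))\<^sup>2) else 0)"
    proof (cases "even n")
      case True
      then obtain k where n: "n = 2 * k" by auto
      have "(\<Sum>j\<le>n. if j = n - j then of_nat (n choose j) / fact n * (\<integral>z. z ^ j * cnj z ^ (n - j) \<partial>L) else 0)
        = (\<Sum>j\<le>n. if j = k then of_nat (n choose k) / fact n * (\<integral>z. z ^ k * cnj z ^ k \<partial>L) else 0)"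
        by (intro sum.cong) (auto simp: n mult_2)
      also have "\<dots> = of_nat (n choose k) / fact n * (\<integral>z. z ^ k * cnj z ^ k \<partial>L)"
        by (simp add: n)
      also have "(\<integral>z. z ^ k * cnj z ^ k \<partial>L) = of_real (\<integral>z. (cmod z) ^ n \<partial>L)"
        unfolding integral_complex_of_real[symmetric]
      proof (intro Bochner_Integration.integral_cong refl)
        fix z :: complex
        have "z ^ k * cnj z ^ k = of_real ((cmod z)\<^sup>2) ^ k"
          unfolding complex_norm_square by (rule power_mult_distrib[symmetric])
        then show "z ^ k * cnj z ^ k = of_real ((cmod z) ^ n)" by (simp add: n power_mult)
      qed
      \<comment> \<open>The central binomial coefficient over \<open>(2 k)!\<close> leaves
        \<open>1 / (k!)^2\<close>, the coefficient from which the Bessel series arises.\<close>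
      also have "of_nat (n choose k) / fact n = complex_of_real (1 / (fact k)\<^sup>2)"
        by (simp add: n binomial_fact power2_eq_square)
      finally show ?thesis by (simp add: n)
    next
      case False
      then have "j \<noteq> n - j" if "j \<le> n" for j using that by presburger
      then show ?thesis using False by (simp add: sum.neutral)
    qed
    finally show ?thesis .
  qed
  have nf: "norm (f n z) \<le> (2 * B) ^ n / fact n" if "cmod z \<le> B" for n z
    unfolding f_def using abs_Re_le_cmod[of z] that B
    by (auto simp: norm_divide norm_mult norm_power abs_mult power_mult_distrib intro!: divide_right_mono mult_left_mono power_mono)
  have summ: "summable (\<lambda>n. (2 * B) ^ n / fact n)" using summable_exp[of "2 * B"] by (simp add: field_simps)
  have "(\<lambda>n. \<integral>z. f n z \<partial>L) sums (\<integral>z. (\<Sum>n. f n z) \<partial>L)"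
  proof (rule sums_integral[OF intf])
    show "AE z in L. summable (\<lambda>n. norm (f n z))"
      using bdd by eventually_elim (rule summable_comparison_test'[OF summ, of 0], simp only: real_norm_def abs_norm_cancel nf)
    show "summable (\<lambda>n. \<integral>z. norm (f n z) \<partial>L)"
    proof (rule summable_comparison_test'[OF summ])
      fix n :: nat
      have "(\<integral>z. norm (f n z) \<partial>L) \<le> (\<integral>z. (2 * B) ^ n / fact n \<partial>L)"
      proof (rule integral_mono_AE)
        show "AE z in L. norm (f n z) \<le> (2 * B) ^ n / fact n"
          using bdd by eventually_elim (rule nf)
      qed (use intf in auto)
      then show "norm (\<integral>z. norm (f n z) \<partial>L) \<le> (2 * B) ^ n / fact n"
        by (simp add: prob_space)
    qed
  qed
  moreover have "(\<Sum>n. f n z) = of_real (exp (2 * Re z))" for z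
  proof -
    have "(\<lambda>n. (2 * Re z) ^ n / fact n) sums exp (2 * Re z)"
      using exp_converges[of "2 * Re z"] by (simp add: field_simps)
    then show ?thesis unfolding f_def by (intro sums_unique[symmetric] sums_of_real)
  qed
  ultimately have "(\<lambda>n. complex_of_real (if even n then (\<integral>z. (cmod z) ^ n \<partial>L) / (fact (n div 2))\<^sup>2 else 0)) sums of_real (\<integral>z. exp (2 * Re z) \<partial>L)"
    unfolding mom by (simp add: if_distrib[of complex_of_real] cong: if_cong)
  then have "(\<lambda>n. if even n then (\<integral>z. (cmod z) ^ n \<partial>L) / (fact (n div 2))\<^sup>2 else 0) sums (\<integral>z. exp (2 * Re z) \<partial>L)"
    unfolding sums_of_real_iff .
  then show ?thesis
    \<comment> \<open>The odd terms vanish, so the series may be indexed by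
      \<open>n = 2 k\<close>.\<close>
    by (subst (asm) sums_mono_reindex[of "\<lambda>k. 2 * k", symmetric]) (auto simp: strict_mono_def elim!: evenE)
qed

text \<open>The scaled first coordinate of a random direction has a bounded phase-invariant law
  \<open>L\<close>. Its even moments carry \<open>k! (m-1)! / (k+m-1)!\<close>, and dividing by
  \<open>(k!)^2\<close> gives \<open>(m-1)!\<close> times the coefficients of the Bessel
  series.\<close>

lemma CN_vec_direction_mgf:
  assumes m: "m \<ge> 1"
  shows "(\<integral>\<^sup>+w. ennreal (exp (2 * Re (b * w 0 / of_real (sqrt (sqnorm m w))))) \<partial>CN_vec {..<m})
     = ennreal (fact (m - 1) * bessel_series (m - 1) ((cmod b)\<^sup>2))"
proof -
  interpret V: prob_space "CN_vec {..<m}" by (rule prob_space_CN_vec)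
  have 0 [measurable]: "0 \<in> {..<m}" using m by auto
  define v where "v w = b * w 0 / of_real (sqrt (sqnorm m w))" for w
  have [measurable]: "v \<in> borel_measurable (CN_vec {..<m})" unfolding v_def by measurable
  define L where "L = distr (CN_vec {..<m}) borel v"
  have L: "sets L = sets borel" by (simp add: L_def)
  note [measurable_cong] = L
  interpret L: prob_space L unfolding L_def by (rule V.prob_space_distr) measurable
  have inv: "distr L borel (\<lambda>z. u * z) = L" if u: "cmod u = 1" for u
  proof (rule measure_eqI)
    fix A assume "A \<in> sets (distr L borel (\<lambda>z. u * z))"
    then have [measurable]: "A \<in> sets borel" by simp
    let ?F = "\<lambda>x y. indicator A (b * x / of_real (sqrt y)) :: ennreal"
    \<comment> \<open>Phase invariance of \<open>L\<close> is \<open>CN_vec_linear\<close> for the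
      coefficient vector \<open>u\<close> times the first axis, whose length is one.\<close>
    have s: "(\<Sum>i<m. (if i = 0 then u else 0) * w i) = u * w 0" for w
      using m by (simp add: if_distrib[of "\<lambda>x. x * _"] sum.delta cong: if_cong)
    have s2: "sqnorm m (\<lambda>i. if i = 0 then u else 0) = 1"
      unfolding sqnorm_def
      using m u by (simp add: if_distrib[of cmod] if_distrib[of "\<lambda>x. x\<^sup>2"] sum.delta cong: if_cong)
    have "(\<integral>\<^sup>+w. ?F (u * w 0) (sqnorm m w) \<partial>CN_vec {..<m}) = (\<integral>\<^sup>+w. ?F (w 0) (sqnorm m w) \<partial>CN_vec {..<m})"
      using CN_vec_linear[of "{..<m}" 0 ?F "\<lambda>i. if i = 0 then u else 0"] m
      unfolding s sqnorm_def[symmetric] s2 by simp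
    moreover have "emeasure (distr L borel (\<lambda>z. u * z)) A = (\<integral>\<^sup>+w. ?F (u * w 0) (sqnorm m w) \<partial>CN_vec {..<m})"
      by (subst nn_integral_indicator[symmetric], simp, subst nn_integral_distr, simp, simp)
         (simp add: L_def nn_integral_distr v_def mult_ac)
    moreover have "emeasure L A = (\<integral>\<^sup>+w. ?F (w 0) (sqnorm m w) \<partial>CN_vec {..<m})"
      using nn_integral_distr[of v "CN_vec {..<m}" borel "indicator A"]
      by (simp add: L_def v_def)
    ultimately show "emeasure (distr L borel (\<lambda>z. u * z)) A = emeasure L A" by simp
  qed (simp add: L)
  have vn: "(cmod (v w))\<^sup>2 = (cmod b)\<^sup>2 * ((cmod (w 0))\<^sup>2 / sqnorm m w)" for w
    by (simp add: v_def norm_divide norm_mult power_divide power_mult_distrib)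
  have vb: "cmod (v w) \<le> cmod b" for w
  proof -
    have "(cmod (w 0))\<^sup>2 \<le> sqnorm m w"
      unfolding sqnorm_def using 0 by (intro member_le_sum) auto
    then have "(cmod (w 0))\<^sup>2 / sqnorm m w \<le> 1" using sqnorm_nonneg[of m w] by (auto simp: divide_le_eq_1 less_le)
    then have "(cmod (v w))\<^sup>2 \<le> (cmod b)\<^sup>2" unfolding vn by (rule mult_left_le) simp
    then show ?thesis by (rule power2_le_imp_le) simp
  qed
  have bd: "AE z in L. cmod z \<le> cmod b" unfolding L_def by (subst AE_distr_iff) (auto simp: vb)
  have mom: "(\<integral>z. (cmod z) ^ (2 * k) \<partial>L) = (cmod b) ^ (2 * k) * (fact k * fact (m - 1) / fact (k + (m - 1)))" for k
  proof -
    have "(\<integral>z. (cmod z) ^ (2 * k) \<partial>L) = (\<integral>w. (cmod b) ^ (2 * k) * ((cmod (w 0))\<^sup>2 / sqnorm m w) ^ k \<partial>CN_vec {..<m})"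
      unfolding L_def by (subst integral_distr) (simp_all add: power_mult vn power_mult_distrib[symmetric])
    also have "\<dots> = (cmod b) ^ (2 * k) * (\<integral>w. ((cmod (w 0))\<^sup>2 / sqnorm m w) ^ k \<partial>CN_vec {..<m})"
      by (rule integral_mult_right_zero)
    also have "(\<integral>w. ((cmod (w 0))\<^sup>2 / sqnorm m w) ^ k \<partial>CN_vec {..<m}) = fact k * fact (m - 1) / fact (k + (m - 1))"
      using CN_vec_fraction_moment[OF m, of k] by (subst integral_eq_nn_integral) auto
    finally show ?thesis .
  qed
  have "(\<lambda>k. fact (m - 1) * (((cmod b)\<^sup>2) ^ k / (fact k * fact (k + (m - 1))))) sums (\<integral>z. exp (2 * Re z) \<partial>L)"
    using phase_invariant_mgf[OF L.prob_space_axioms L inv bd]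
    unfolding mom by (simp add: power_mult power2_eq_square[of "fact _"] mult.assoc mult.commute[of "fact (_ + _)"] mult.commute[of _ "fact (m - Suc 0)"])
  then have "(\<integral>z. exp (2 * Re z) \<partial>L) = fact (m - 1) * bessel_series (m - 1) ((cmod b)\<^sup>2)"
    unfolding bessel_series_def by (subst suminf_mult[OF summable_bessel_series, symmetric]) (simp add: sums_iff)
  moreover have "(\<integral>\<^sup>+z. ennreal (exp (2 * Re z)) \<partial>L) = ennreal (\<integral>z. exp (2 * Re z) \<partial>L)"
  proof (rule nn_integral_eq_integral)
    show "integrable L (\<lambda>z. exp (2 * Re z))"
      by (rule L.integrable_const_bound[where B="exp (2 * cmod b)"])
         (use bd in \<open>auto elim!: eventually_mono intro: order_trans[OF complex_Re_le_cmod]\<close>)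
  qed auto
  ultimately show ?thesis
    by (simp add: L_def nn_integral_distr v_def)
qed

section \<open>Law of the sufficient statistic of one block\<close>

text \<open>Density, relative to standard noise, of the output component along the input direction; times the
  standard Gaussian density it is \<^const>\<open>f_cond\<close>.\<close>

definition lik_ratio :: "complex \<Rightarrow> real \<Rightarrow> real \<Rightarrow> complex \<Rightarrow> real" where
  "lik_ratio mu s a v = exp ((cmod v)\<^sup>2 - (cmod (v - of_real a * mu))\<^sup>2 / (s * a\<^sup>2 + 1)) / (s * a\<^sup>2 + 1)"

lemma lik_ratio_pos: "s > 0 \<Longrightarrow> lik_ratio mu s a v > 0"
  unfolding lik_ratio_def by (simp add: add_nonneg_pos)

lemma borel_measurable_lik_ratio [measurable]:
  assumes [measurable]: "f \<in> borel_measurable M" "g \<in> borel_measurable M"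
  shows "(\<lambda>x. lik_ratio (f x) s a (g x)) \<in> borel_measurable M"
  unfolding lik_ratio_def by measurable

text \<open>The integrand is the density, relative to standard noise, of noise shifted by
  \<open>a * h\<close>. Multiplied by the density of \<open>h\<close> it factors by
  \<open>cn_density_bayes\<close>, and the posterior factor integrates to one.\<close>

lemma lik_ratio_eq_integral:
  assumes s: "s > 0"
  shows "(\<integral>\<^sup>+h. ennreal (exp (2 * Re (cnj h * of_real a * v) - (cmod h)\<^sup>2 * a\<^sup>2)) \<partial>CN mu s) = ennreal (lik_ratio mu s a v)"
proof -
  let ?d = "s * a\<^sup>2 + 1"
  let ?m = "(of_real (s * a) * v + of_real 1 * mu) / of_real ?d"
  have d: "?d > 0" using s by (simp add: add_nonneg_pos)
  have eq: "cn_density mu s h * exp (2 * Re (cnj h * of_real a * v) - (cmod h)\<^sup>2 * a\<^sup>2)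
     = lik_ratio mu s a v * cn_density ?m (s * 1 / ?d) h" for h
  proof -
    have E: "2 * Re (cnj h * of_real a * v) - (cmod h)\<^sup>2 * a\<^sup>2 = (cmod v)\<^sup>2 - (cmod (v - of_real a * h))\<^sup>2"
      unfolding cmod_power2 by (simp add: power2_eq_square algebra_simps)
    have "exp (2 * Re (cnj h * of_real a * v) - (cmod h)\<^sup>2 * a\<^sup>2)
        = pi * exp ((cmod v)\<^sup>2) * cn_density (of_real a * h) 1 v"
      unfolding E by (simp add: cn_density_def exp_diff exp_minus field_simps)
    then have "cn_density mu s h * exp (2 * Re (cnj h * of_real a * v) - (cmod h)\<^sup>2 * a\<^sup>2)
       = pi * exp ((cmod v)\<^sup>2) * (cn_density (of_real a * mu) ?d v * cn_density ?m (s * 1 / ?d) h)"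
      using cn_density_bayes[OF s, of 1 mu h a v] by simp
    moreover have "pi * exp ((cmod v)\<^sup>2) * cn_density (of_real a * mu) ?d v = lik_ratio mu s a v"
    proof -
      have "exp ((cmod v)\<^sup>2 - (cmod (v - of_real a * mu))\<^sup>2 / ?d) = exp ((cmod v)\<^sup>2) * exp (- (cmod (v - of_real a * mu))\<^sup>2 / ?d)"
        by (simp add: exp_add[symmetric])
      then show ?thesis unfolding cn_density_def lik_ratio_def by simp
    qed
    ultimately show ?thesis by (simp add: mult.assoc[symmetric])
  qed
  have eq': "ennreal (cn_density mu s h) * ennreal (exp (2 * Re (cnj h * of_real a * v) - (cmod h)\<^sup>2 * a\<^sup>2))
     = ennreal (lik_ratio mu s a v) * ennreal (cn_density ?m (s * 1 / ?d) h)" for h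
  proof -
    have "s * 1 / ?d > 0" using s d by simp
    then show ?thesis
      using eq[of h] s by (simp only: ennreal_mult[symmetric] cn_density_pos lik_ratio_pos less_imp_le exp_ge_zero)
  qed
  interpret prob_space "CN ?m (s * 1 / ?d)" using s d by (intro prob_space_CN) simp
  have "(\<integral>\<^sup>+h. ennreal (exp (2 * Re (cnj h * of_real a * v) - (cmod h)\<^sup>2 * a\<^sup>2)) \<partial>CN mu s)
     = (\<integral>\<^sup>+h. ennreal (lik_ratio mu s a v) * ennreal (cn_density ?m (s * 1 / ?d) h) \<partial>lborel)"
    unfolding eq'[symmetric] by (rule nn_integral_CN) measurable
  also have "\<dots> = ennreal (lik_ratio mu s a v) * (\<integral>\<^sup>+h. ennreal (cn_density ?m (s * 1 / ?d) h) \<partial>lborel)"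
    by (rule nn_integral_cmult) measurable
  also have "(\<integral>\<^sup>+h. ennreal (cn_density ?m (s * 1 / ?d) h) \<partial>lborel) = (\<integral>\<^sup>+h. 1 \<partial>CN ?m (s * 1 / ?d))"
    using nn_integral_CN[of "\<lambda>_. 1" ?m "s * 1 / ?d"] by (simp only: mult_1_right borel_measurable_const)
  also have "\<dots> = 1" using emeasure_space_1 by (simp only: nn_integral_const mult_1_left)
  finally show ?thesis by (simp only: mult_1_right)
qed

section \<open>Shifted noise, separation of pilots from data, posterior of the fading\<close>

lemma distr_CN_std_shift:
  "distr CN_std CN_std (\<lambda>z. a + z) = density CN_std (\<lambda>z. ennreal (exp (2 * Re (cnj a * z) - (cmod a)\<^sup>2)))"
proof (rule measure_eqI)
  fix A assume "A \<in> sets (distr CN_std CN_std (\<lambda>z. a + z))"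
  then have [measurable]: "A \<in> sets borel" and "A \<in> sets CN_std" by simp_all
  have meas: "(\<lambda>z. ennreal (exp (2 * Re (cnj a * z) - (cmod a)\<^sup>2))) \<in> borel_measurable CN_std" by measurable
  have "cn_density 0 1 z * exp (2 * Re (cnj a * z) - (cmod a)\<^sup>2) = cn_density a 1 z" for z
    unfolding cn_density_def cmod_power2 by (simp add: exp_add[symmetric] power2_eq_square algebra_simps)
  then have eq: "ennreal (cn_density 0 1 z) * (ennreal (exp (2 * Re (cnj a * z) - (cmod a)\<^sup>2)) * x) = ennreal (cn_density a 1 z) * x" for z x
    by (subst mult.assoc[symmetric], subst ennreal_mult[symmetric]) (simp_all add: cn_density_pos less_imp_le)
  have "emeasure (distr CN_std CN_std (\<lambda>z. a + z)) A = (\<integral>\<^sup>+z. indicator A (a + z) \<partial>CN_std)"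
    by (subst nn_integral_indicator[symmetric], simp, subst nn_integral_distr) auto
  also have "\<dots> = (\<integral>\<^sup>+z. indicator A z \<partial>CN a 1)"
    using nn_integral_CN_affine[of "indicator A" 1 1 a 0] by simp
  also have "\<dots> = emeasure (density CN_std (\<lambda>z. ennreal (exp (2 * Re (cnj a * z) - (cmod a)\<^sup>2)))) A"
    unfolding emeasure_density[OF meas \<open>A \<in> sets CN_std\<close>]
    using nn_integral_CN[of "indicator A" a 1]
      nn_integral_CN[of "\<lambda>z. ennreal (exp (2 * Re (cnj a * z) - (cmod a)\<^sup>2)) * indicator A z" 0 1, unfolded eq]
    by (simp only: borel_measurable_indicator \<open>A \<in> sets borel\<close>) measurable
  finally show "emeasure (distr CN_std CN_std (\<lambda>z. a + z)) A = emeasure (density CN_std (\<lambda>z. ennreal (exp (2 * Re (cnj a * z) - (cmod a)\<^sup>2)))) A" .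
qed simp

text \<open>With the faded codeword as \<open>a\<close>, this replaces the signal part of an output
  by a likelihood ratio under pure noise.\<close>

lemma CN_vec_shift:
  assumes I: "finite I" and [measurable]: "F \<in> borel_measurable (CN_vec I)"
  shows "(\<integral>\<^sup>+w. F (\<lambda>i\<in>I. a i + w i) \<partial>CN_vec I)
     = (\<integral>\<^sup>+w. ennreal (exp (2 * Re (\<Sum>i\<in>I. cnj (a i) * w i) - (\<Sum>i\<in>I. (cmod (a i))\<^sup>2))) * F w \<partial>CN_vec I)"
proof -
  have "(\<integral>\<^sup>+w. F (\<lambda>i\<in>I. a i + w i) \<partial>CN_vec I) = (\<integral>\<^sup>+w. F w \<partial>distr (CN_vec I) (CN_vec I) (\<lambda>w. \<lambda>i\<in>I. a i + w i))"
    by (subst nn_integral_distr) auto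
  also have "distr (CN_vec I) (CN_vec I) (\<lambda>w. \<lambda>i\<in>I. a i + w i)
      = density (CN_vec I) (\<lambda>w. \<Prod>i\<in>I. ennreal (exp (2 * Re (cnj (a i) * w i) - (cmod (a i))\<^sup>2)))"
  proof (rule distr_PiM_eq_density[OF I])
    show "distr CN_std CN_std (\<lambda>z. a i + z) = density CN_std (\<lambda>z. ennreal (exp (2 * Re (cnj (a i) * z) - (cmod (a i))\<^sup>2)))" for i
      by (rule distr_CN_std_shift)
  qed (auto intro: CN_std.prob_space_axioms)
  also have "\<dots> = density (CN_vec I) (\<lambda>w. ennreal (exp (2 * Re (\<Sum>i\<in>I. cnj (a i) * w i) - (\<Sum>i\<in>I. (cmod (a i))\<^sup>2))))"
    using I by (simp only: prod_ennreal exp_ge_zero exp_sum[symmetric] sum_subtractf Re_sum sum_distrib_left)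
  finally show ?thesis by (subst (asm) nn_integral_density) auto
qed

text \<open>Noise on the first \<open>n\<close> symbols (pilots) is independent of the noise on the
  remaining \<open>m\<close> (data); the latter is reindexed to start at zero.\<close>

lemma CN_vec_split:
  fixes n m :: nat
  assumes [measurable]: "(\<lambda>(x, y). F x y) \<in> borel_measurable (CN_vec {..<n} \<Otimes>\<^sub>M CN_vec {..<m})"
  shows "(\<integral>\<^sup>+w. F (\<lambda>i\<in>{..<n}. w i) (\<lambda>j\<in>{..<m}. w (n + j)) \<partial>CN_vec {..<n + m}) = (\<integral>\<^sup>+x. \<integral>\<^sup>+y. F x y \<partial>CN_vec {..<m} \<partial>CN_vec {..<n})"
proof -
  have U: "{..<n + m} = {..<n} \<union> {n..<n + m}" by auto
  have re: "distr (CN_vec {n..<n + m}) (CN_vec {..<m}) (\<lambda>w. \<lambda>j\<in>{..<m}. w (n + j)) = CN_vec {..<m}"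
    using distr_PiM_reindex[of "{n..<n + m}" "\<lambda>_. CN_std" "\<lambda>j. n + j" "{..<m}"] by (auto intro: CN_std.prob_space_axioms)
  have m1 [measurable]: "(\<lambda>w. F (\<lambda>i\<in>{..<n}. w i) (\<lambda>j\<in>{..<m}. w (n + j))) \<in> borel_measurable (CN_vec ({..<n} \<union> {n..<n + m}))"
  proof -
    have "(\<lambda>w. (\<lambda>i\<in>{..<n}. w i, \<lambda>j\<in>{..<m}. w (n + j))) \<in> measurable (CN_vec ({..<n} \<union> {n..<n + m})) (CN_vec {..<n} \<Otimes>\<^sub>M CN_vec {..<m})"
      by (intro measurable_Pair measurable_restrict measurable_component_singleton) auto
    from measurable_compose[OF this assms] show ?thesis by simp
  qed
  have "(\<integral>\<^sup>+w. F (\<lambda>i\<in>{..<n}. w i) (\<lambda>j\<in>{..<m}. w (n + j)) \<partial>CN_vec {..<n + m})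
     = (\<integral>\<^sup>+x. \<integral>\<^sup>+y. F (\<lambda>i\<in>{..<n}. merge {..<n} {n..<n + m} (x, y) i) (\<lambda>j\<in>{..<m}. merge {..<n} {n..<n + m} (x, y) (n + j)) \<partial>CN_vec {n..<n + m} \<partial>CN_vec {..<n})"
    unfolding U by (rule CN_vec.product_nn_integral_fold[OF _ _ _ m1]) auto
  also have "\<dots> = (\<integral>\<^sup>+x. \<integral>\<^sup>+y. F x (\<lambda>j\<in>{..<m}. y (n + j)) \<partial>CN_vec {n..<n + m} \<partial>CN_vec {..<n})"
  proof (intro nn_integral_cong, goal_cases)
    case (1 x y)
    have "(\<lambda>i\<in>{..<n}. merge {..<n} {n..<n + m} (x, y) i) = x"
      using 1 by (auto simp: merge_def space_PiM PiE_def extensional_def restrict_def fun_eq_iff)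
    moreover have "(\<lambda>j\<in>{..<m}. merge {..<n} {n..<n + m} (x, y) (n + j)) = (\<lambda>j\<in>{..<m}. y (n + j))"
      by (auto simp: merge_def restrict_def fun_eq_iff)
    ultimately show ?case by simp
  qed
  also have "\<dots> = (\<integral>\<^sup>+x. \<integral>\<^sup>+y. F x y \<partial>CN_vec {..<m} \<partial>CN_vec {..<n})"
  proof (intro nn_integral_cong, goal_cases)
    case (1 x)
    then have [measurable]: "F x \<in> borel_measurable (CN_vec {..<m})" by measurable
    have [measurable]: "(\<lambda>w. \<lambda>j\<in>{..<m}. w (n + j)) \<in> measurable (CN_vec {n..<n + m}) (CN_vec {..<m})"
      by (intro measurable_restrict measurable_component_singleton) auto
    show ?case by (subst re[symmetric], subst nn_integral_distr) auto
  qed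
  finally show ?thesis .
qed

text \<open>Exchanges the order of generation: fading followed by estimation error becomes estimate
  followed by fading given the estimate. The parameters on the right are those of
  \<open>mu_p\<close> and \<open>sig_p2\<close>.\<close>

lemma CN_posterior:
  assumes s: "s > 0" and t: "t > 0"
    and [measurable]: "(\<lambda>(x, y). F x y) \<in> borel_measurable (borel \<Otimes>\<^sub>M borel)"
  shows "(\<integral>\<^sup>+h. \<integral>\<^sup>+e. F h (h + e) \<partial>CN 0 t \<partial>CN mu s)
     = (\<integral>\<^sup>+v. \<integral>\<^sup>+h. F h v \<partial>CN ((of_real s * v + of_real t * mu) / of_real (s + t)) (s * t / (s + t)) \<partial>CN mu (s + t))"
proof -
  have "(\<integral>\<^sup>+h. \<integral>\<^sup>+e. F h (h + e) \<partial>CN 0 t \<partial>CN mu s) = (\<integral>\<^sup>+h. \<integral>\<^sup>+v. F h v \<partial>CN h t \<partial>CN mu s)"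
  proof (intro nn_integral_cong)
    fix h
    show "(\<integral>\<^sup>+e. F h (h + e) \<partial>CN 0 t) = (\<integral>\<^sup>+v. F h v \<partial>CN h t)"
      using nn_integral_CN_affine[of "F h" 1 t h 0] t by simp
  qed
  also have "\<dots> = (\<integral>\<^sup>+h. \<integral>\<^sup>+v. ennreal (cn_density mu s h * cn_density h t v) * F h v \<partial>lborel \<partial>lborel)"
    using s t by (simp add: nn_integral_CN nn_integral_cmult[symmetric] ennreal_mult' cn_density_pos less_imp_le mult.assoc)
  also have "\<dots> = (\<integral>\<^sup>+v. \<integral>\<^sup>+h. ennreal (cn_density mu s h * cn_density h t v) * F h v \<partial>lborel \<partial>lborel)"
    by (rule lborel_pair.Fubini'[symmetric]) measurable
  also have "\<dots> = (\<integral>\<^sup>+v. \<integral>\<^sup>+h. ennreal (cn_density mu (s + t) v * cn_density ((of_real s * v + of_real t * mu) / of_real (s + t)) (s * t / (s + t)) h) * F h v \<partial>lborel \<partial>lborel)"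
    using cn_density_bayes[OF s t, of mu _ 1] by simp
  also have "\<dots> = (\<integral>\<^sup>+v. \<integral>\<^sup>+h. F h v \<partial>CN ((of_real s * v + of_real t * mu) / of_real (s + t)) (s * t / (s + t)) \<partial>CN mu (s + t))"
    using s t by (simp add: nn_integral_CN nn_integral_cmult[symmetric] ennreal_mult' cn_density_pos less_imp_le mult.assoc)
  finally show ?thesis .
qed

text \<open>Every pilot equals \<open>sqrt \<rho>\<close>, and a unit vector \<open>u\<close> is
  scaled to data energy \<open>m * \<rho>\<close>, so each block has energy
  \<open>(np + m) * \<rho>\<close>.\<close>

definition block_word :: "nat \<Rightarrow> nat \<Rightarrow> real \<Rightarrow> (nat \<Rightarrow> complex) \<Rightarrow> nat \<Rightarrow> complex" where
  "block_word np m \<rho> u i = (if i < np then of_real (sqrt \<rho>) else of_real (sqrt (real m * \<rho>)) * u (i - np))"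

text \<open>The pilot sum divided by \<open>np * sqrt \<rho>\<close> is the maximum-likelihood
  estimate: the fading plus noise of variance \<open>1 / (np * \<rho>)\<close>.\<close>

definition block_stat :: "nat \<Rightarrow> nat \<Rightarrow> real \<Rightarrow> (nat \<Rightarrow> complex) \<Rightarrow> complex \<times> (nat \<Rightarrow> complex)" where
  "block_stat np m \<rho> y = ((\<Sum>i<np. y i) / of_real (real np * sqrt \<rho>), \<lambda>j\<in>{..<m}. y (np + j))"

definition cdot :: "nat \<Rightarrow> (nat \<Rightarrow> complex) \<Rightarrow> (nat \<Rightarrow> complex) \<Rightarrow> complex" where
  "cdot m u w = (\<Sum>j<m. cnj (u j) * w j)"

lemma borel_measurable_cdot [measurable]: "cdot m u \<in> borel_measurable (CN_vec {..<m})"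
  unfolding cdot_def by measurable

lemma sigH2_pos: "\<kappa> \<ge> 0 \<Longrightarrow> sigH2 \<kappa> > 0"
  by (simp add: sigH2_def)

lemma sig_e2_pos: "np \<ge> 1 \<Longrightarrow> \<rho> > 0 \<Longrightarrow> sig_e2 np \<rho> > 0"
  by (simp add: sig_e2_def)

lemma sig_p2_pos: "\<kappa> \<ge> 0 \<Longrightarrow> np \<ge> 1 \<Longrightarrow> \<rho> > 0 \<Longrightarrow> sig_p2 \<kappa> np \<rho> > 0"
  unfolding sig_p2_def by (intro divide_pos_pos mult_pos_pos add_pos_pos sigH2_pos sig_e2_pos)

lemma borel_measurable_mu_p [measurable]: "mu_p \<kappa> np \<rho> \<in> borel_measurable borel"
  unfolding mu_p_def by measurable

text \<open>The sum is a linear form whose equal coefficients have squared length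
  \<open>sig_e2 np \<rho>\<close>, so \<open>CN_vec_linear\<close> reduces it to a single scaled
  Gaussian.\<close>

lemma CN_vec_pilot_mean:
  assumes np: "np \<ge> 1" and \<rho>: "\<rho> > 0" and [measurable]: "f \<in> borel_measurable borel"
  shows "(\<integral>\<^sup>+w. f ((\<Sum>i<np. w i) / of_real (real np * sqrt \<rho>)) \<partial>CN_vec {..<np}) = (\<integral>\<^sup>+e. f e \<partial>CN 0 (sig_e2 np \<rho>))"
proof -
  define r where "r = sqrt (sig_e2 np \<rho>)"
  have r: "r \<noteq> 0" "r\<^sup>2 = sig_e2 np \<rho>" using sig_e2_pos[OF np \<rho>] by (auto simp: r_def)
  have "cmod (1 / of_real (real np * sqrt \<rho>)) = 1 / (real np * sqrt \<rho>)"
    using \<rho> by (simp add: norm_divide norm_mult)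
  then have "(\<Sum>i<np. (cmod (1 / of_real (real np * sqrt \<rho>)))\<^sup>2) = sig_e2 np \<rho>"
    using np \<rho> by (simp add: sig_e2_def power_divide power_mult_distrib power2_eq_square)
  then have "(\<integral>\<^sup>+w. f (\<Sum>i<np. 1 / of_real (real np * sqrt \<rho>) * w i) \<partial>CN_vec {..<np}) = (\<integral>\<^sup>+w. f (of_real r * w 0) \<partial>CN_vec {..<np})"
    using CN_vec_linear[of "{..<np}" 0 "\<lambda>x _. f x" "\<lambda>_. 1 / of_real (real np * sqrt \<rho>)"] np
    by (simp add: r_def del: of_real_mult)
  also have "\<dots> = (\<integral>\<^sup>+z. f (of_real r * z) \<partial>CN_std)"
    using np by (intro nn_integral_PiM_single CN_std.prob_space_axioms) auto
  also have "\<dots> = (\<integral>\<^sup>+e. f e \<partial>CN 0 (sig_e2 np \<rho>))"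
    using nn_integral_CN_affine[of f r 1 0 0] r by simp
  finally show ?thesis by (simp add: sum_divide_distrib del: of_real_mult)
qed

text \<open>Given \<open>h\<close>, shifting the data noise produces the density \<open>E h\<close>
  and the pilots produce \<open>h + e\<close>. Passing to the posterior of \<open>h\<close> given
  the estimate \<open>v\<close>, and averaging \<open>E\<close> over it, leaves the likelihood
  ratio. The reference law on the right is free of \<open>u\<close>.\<close>

lemma block_law:
  assumes np: "np \<ge> 1" and \<rho>: "\<rho> > 0" and \<kappa>: "\<kappa> \<ge> 0" and u: "sqnorm m u = 1"
    and F [measurable]: "(\<lambda>(h, w). F h w) \<in> borel_measurable (borel \<Otimes>\<^sub>M CN_vec {..<m})"
  shows "(\<integral>\<^sup>+h. \<integral>\<^sup>+w. case_prod F (block_stat np m \<rho> (\<lambda>i. h * block_word np m \<rho> u i + w i)) \<partial>CN_vec {..<np + m} \<partial>CN (muH \<kappa>) (sigH2 \<kappa>))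
     = (\<integral>\<^sup>+v. \<integral>\<^sup>+w. ennreal (lik_ratio (mu_p \<kappa> np \<rho> v) (sig_p2 \<kappa> np \<rho>) (sqrt (real m * \<rho>)) (cdot m u w)) * F v w \<partial>CN_vec {..<m} \<partial>CN (muH \<kappa>) (sigH2 \<kappa> + sig_e2 np \<rho>))"
proof -
  let ?a = "sqrt (real m * \<rho>)" and ?e = "sig_e2 np \<rho>" and ?s = "sigH2 \<kappa>"
  let ?N = "CN_vec {..<m}"
  interpret N: prob_space ?N by (rule prob_space_CN_vec)
  define E where "E h w = exp (2 * Re (cnj h * of_real ?a * cdot m u w) - (cmod h)\<^sup>2 * ?a\<^sup>2)" for h w
  have [measurable]: "(\<lambda>(h, w). E h w) \<in> borel_measurable (borel \<Otimes>\<^sub>M ?N)"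
    unfolding E_def by measurable
  have e: "?e > 0" "?s > 0" using sig_e2_pos[OF np \<rho>] sigH2_pos[OF \<kappa>] by auto
  have stat: "block_stat np m \<rho> (\<lambda>i. h * block_word np m \<rho> u i + w i)
     = (h + (\<Sum>i<np. w i) / of_real (real np * sqrt \<rho>), \<lambda>j\<in>{..<m}. (h * (of_real ?a * u j)) + w (np + j))" for h w
    using np \<rho> by (auto simp: block_stat_def block_word_def sum.distrib add_divide_distrib)
  have shift: "(\<integral>\<^sup>+y. F v (\<lambda>j\<in>{..<m}. (h * (of_real ?a * u j)) + y j) \<partial>?N) = (\<integral>\<^sup>+y. ennreal (E h y) * F v y \<partial>?N)" for h v
  proof -
    have "(\<Sum>j<m. cnj (h * (of_real ?a * u j)) * y j) = cnj h * of_real ?a * cdot m u y" for y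
      by (simp add: cdot_def sum_distrib_left mult_ac)
    moreover have "(\<Sum>j<m. (cmod (h * (of_real ?a * u j)))\<^sup>2) = (cmod h)\<^sup>2 * ?a\<^sup>2"
      using u \<rho> by (simp add: norm_mult power_mult_distrib sqnorm_def sum_distrib_left[symmetric])
    ultimately show ?thesis
      using CN_vec_shift[of "{..<m}" "F v" "\<lambda>j. h * (of_real ?a * u j)"]
      unfolding E_def by (simp only: finite_lessThan) measurable
  qed
  have "(\<integral>\<^sup>+w. case_prod F (block_stat np m \<rho> (\<lambda>i. h * block_word np m \<rho> u i + w i)) \<partial>CN_vec {..<np + m})
      = (\<integral>\<^sup>+e. \<integral>\<^sup>+y. ennreal (E h y) * F (h + e) y \<partial>?N \<partial>CN 0 ?e)" for h
  proof -
    have "(\<integral>\<^sup>+w. case_prod F (block_stat np m \<rho> (\<lambda>i. h * block_word np m \<rho> u i + w i)) \<partial>CN_vec {..<np + m})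
     = (\<integral>\<^sup>+x. \<integral>\<^sup>+y. F (h + (\<Sum>i<np. x i) / of_real (real np * sqrt \<rho>)) (\<lambda>j\<in>{..<m}. (h * (of_real ?a * u j)) + y j) \<partial>?N \<partial>CN_vec {..<np})"
      by (subst CN_vec_split[symmetric]) (measurable, simp add: stat cong: restrict_cong)
    also have "\<dots> = (\<integral>\<^sup>+x. \<integral>\<^sup>+y. ennreal (E h y) * F (h + (\<Sum>i<np. x i) / of_real (real np * sqrt \<rho>)) y \<partial>?N \<partial>CN_vec {..<np})"
      unfolding shift ..
    also have "\<dots> = (\<integral>\<^sup>+e. \<integral>\<^sup>+y. ennreal (E h y) * F (h + e) y \<partial>?N \<partial>CN 0 ?e)"
      by (rule CN_vec_pilot_mean[OF np \<rho>]) measurable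
    finally show ?thesis .
  qed
  then have "(\<integral>\<^sup>+h. \<integral>\<^sup>+w. case_prod F (block_stat np m \<rho> (\<lambda>i. h * block_word np m \<rho> u i + w i)) \<partial>CN_vec {..<np + m} \<partial>CN (muH \<kappa>) ?s)
     = (\<integral>\<^sup>+h. \<integral>\<^sup>+e. (\<integral>\<^sup>+y. ennreal (E h y) * F (h + e) y \<partial>?N) \<partial>CN 0 ?e \<partial>CN (muH \<kappa>) ?s)"
    by simp
  also have "\<dots> = (\<integral>\<^sup>+v. \<integral>\<^sup>+h. \<integral>\<^sup>+y. ennreal (E h y) * F v y \<partial>?N \<partial>CN (mu_p \<kappa> np \<rho> v) (sig_p2 \<kappa> np \<rho>) \<partial>CN (muH \<kappa>) (?s + ?e))"
    unfolding mu_p_def sig_p2_def by (rule CN_posterior[OF e(2,1)]) measurable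
  also have "\<dots> = (\<integral>\<^sup>+v. \<integral>\<^sup>+y. \<integral>\<^sup>+h. ennreal (E h y) * F v y \<partial>CN (mu_p \<kappa> np \<rho> v) (sig_p2 \<kappa> np \<rho>) \<partial>?N \<partial>CN (muH \<kappa>) (?s + ?e))"
    by (intro nn_integral_cong prob_Fubini prob_space_CN prob_space_CN_vec sig_p2_pos np \<rho> \<kappa>) measurable
  also have "\<dots> = (\<integral>\<^sup>+v. \<integral>\<^sup>+y. ennreal (lik_ratio (mu_p \<kappa> np \<rho> v) (sig_p2 \<kappa> np \<rho>) ?a (cdot m u y)) * F v y \<partial>?N \<partial>CN (muH \<kappa>) (?s + ?e))"
  proof (intro nn_integral_cong, goal_cases)
    case (1 v y)
    then have [measurable]: "(\<lambda>h. ennreal (E h y)) \<in> borel_measurable borel"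
      by measurable
    show ?case
      by (subst nn_integral_multc, simp)
         (simp only: E_def lik_ratio_eq_integral[OF sig_p2_pos[OF \<kappa> np \<rho>]])
  qed
  finally show ?thesis .
qed

section \<open>Averaging over the sphere\<close>

text \<open>The zero vector is sent to \<open>e\<^sub>1\<close>, so that every seed yields a codeword of exactly the prescribed power.\<close>

definition unit_dir :: "nat \<Rightarrow> (nat \<Rightarrow> complex) \<Rightarrow> nat \<Rightarrow> complex" where
  "unit_dir m g j = (if sqnorm m g = 0 then (if j = 0 then 1 else 0) else g j / of_real (sqrt (sqnorm m g)))"

lemma sqnorm_unit_dir:
  assumes "m \<ge> 1" shows "sqnorm m (unit_dir m g) = 1"
proof (cases "sqnorm m g = 0")
  case True
  then show ?thesis
    using assms by (simp add: sqnorm_def[of m "unit_dir m g"] unit_dir_def if_distrib[of cmod] if_distrib[of "\<lambda>x. x\<^sup>2"] sum.delta cong: if_cong)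
next
  case False
  then have "sqnorm m (unit_dir m g) = (\<Sum>i<m. (cmod (g i))\<^sup>2) / sqnorm m g"
    unfolding sqnorm_def[of m "unit_dir m g"] by (simp add: unit_dir_def norm_divide power_divide sum_divide_distrib)
  then show ?thesis using False by (simp add: sqnorm_def)
qed

lemma measurable_unit_dir [measurable]: "j < m \<Longrightarrow> (\<lambda>g. unit_dir m g j) \<in> borel_measurable (CN_vec {..<m})"
  unfolding unit_dir_def by measurable

lemma measurable_cdot_unit_dir [measurable]:
  assumes f: "f \<in> measurable M (CN_vec {..<m})" and h [measurable]: "\<And>j. j < m \<Longrightarrow> (\<lambda>x. h x j) \<in> borel_measurable M"
  shows "(\<lambda>x. cdot m (unit_dir m (f x)) (h x)) \<in> borel_measurable M"
proof -
  have [measurable]: "(\<lambda>x. unit_dir m (f x) j) \<in> borel_measurable M" if "j < m" for j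
    by (rule measurable_compose[OF f measurable_unit_dir[OF that]])
  show ?thesis unfolding cdot_def by measurable
qed

lemma AE_sqnorm_neq_0:
  assumes m: "m \<ge> 1" shows "AE w in CN_vec {..<m}. sqnorm m w \<noteq> 0"
proof -
  have 0 [measurable]: "0 \<in> {..<m}" using m by auto
  have "(\<integral>\<^sup>+w. indicator {0} (w 0) \<partial>CN_vec {..<m}) = (\<integral>\<^sup>+z. indicator {0} z \<partial>CN_std)"
    using 0 by (intro nn_integral_PiM_single CN_std.prob_space_axioms) auto
  also have "\<dots> = (\<integral>\<^sup>+z. ennreal (cn_density 0 1 z) * indicator {0} z \<partial>lborel)"
    by (rule nn_integral_CN) measurable
  also have "\<dots> = 0" by (subst nn_integral_0_iff_AE) (auto intro!: AE_I'[of "{0}"] simp: indicator_def split: if_splits)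
  finally have "AE w in CN_vec {..<m}. indicator {0} (w 0) = (0::ennreal)"
    by (subst (asm) nn_integral_0_iff_AE) auto
  then show ?thesis
  proof eventually_elim
    case (elim w)
    then have "w 0 \<noteq> 0" by (auto simp: indicator_def)
    moreover have "(cmod (w 0))\<^sup>2 \<le> sqnorm m w"
      unfolding sqnorm_def using 0 by (intro member_le_sum) auto
    moreover have "(cmod (w 0))\<^sup>2 > 0" using calculation(1) by simp
    ultimately show ?case by linarith
  qed
qed

text \<open>The Bessel function \<open>I\<^sub>0\<close> arises by averaging over the phase, which is the direction of a
  one-dimensional Gaussian vector.\<close>

lemma nn_integral_CN_noncentral:
  assumes s: "s > 0" and k [measurable]: "k \<in> borel_measurable borel"
  shows "(\<integral>\<^sup>+h. k ((cmod h)\<^sup>2) \<partial>CN mu s) =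
    (\<integral>\<^sup>+z\<in>{0<..}. ennreal (exp (- z / s - (cmod mu)\<^sup>2 / s) / s * bessel_series 0 (z * (cmod mu)\<^sup>2 / s\<^sup>2)) * k z \<partial>lborel)"
proof -
  interpret V: prob_space "CN_vec {..<Suc 0}" by (rule prob_space_CN_vec)
  define c where "c z = ennreal (exp (- z / s - (cmod mu)\<^sup>2 / s) / (pi * s)) * k z" for z
  have [measurable]: "c \<in> borel_measurable borel" unfolding c_def by measurable
  define b where "b h = cnj mu * h / of_real s" for h
  have [measurable]: "b \<in> borel_measurable borel" unfolding b_def by measurable
  have b2: "(cmod (b h))\<^sup>2 = (cmod h)\<^sup>2 * (cmod mu)\<^sup>2 / s\<^sup>2" for h
    by (simp add: b_def norm_divide norm_mult power_divide power_mult_distrib mult.commute)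
  have dens: "cn_density mu s h = exp (- (cmod h)\<^sup>2 / s - (cmod mu)\<^sup>2 / s) / (pi * s) * exp (2 * Re (b h))" for h
  proof -
    have "- (cmod (h - mu))\<^sup>2 / s = (- (cmod h)\<^sup>2 / s - (cmod mu)\<^sup>2 / s) + 2 * Re (b h)"
      using s unfolding cmod_power2 b_def by (simp add: power2_eq_square field_simps)
    then show ?thesis unfolding cn_density_def by (simp add: exp_add)
  qed
  have "(\<integral>\<^sup>+h. k ((cmod h)\<^sup>2) \<partial>CN mu s) = (\<integral>\<^sup>+h. c ((cmod h)\<^sup>2) * ennreal (exp (2 * Re (b h))) \<partial>lborel)"
  proof (subst nn_integral_CN, measurable, intro nn_integral_cong)
    fix h
    have "ennreal (cn_density mu s h) = ennreal (exp (- (cmod h)\<^sup>2 / s - (cmod mu)\<^sup>2 / s) / (pi * s)) * ennreal (exp (2 * Re (b h)))"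
      unfolding dens by (rule ennreal_mult'') simp
    then show "ennreal (cn_density mu s h) * k ((cmod h)\<^sup>2) = c ((cmod h)\<^sup>2) * ennreal (exp (2 * Re (b h)))"
      by (simp only: c_def mult_ac)
  qed
  \<comment> \<open>A dummy one-dimensional Gaussian vector is introduced; the inner integral is
    constant in \<open>w\<close>. Lebesgue measure then allows \<open>h\<close> to be rotated by the
    phase of \<open>w 0\<close>, and integrating \<open>w\<close> first averages over that
    phase.\<close>
  also have "\<dots> = (\<integral>\<^sup>+w. (\<integral>\<^sup>+h. c ((cmod h)\<^sup>2) * ennreal (exp (2 * Re (b h))) \<partial>lborel) \<partial>CN_vec {..<Suc 0})"
    by (simp add: V.emeasure_space_1)
  also have "\<dots> = (\<integral>\<^sup>+w. (\<integral>\<^sup>+h. c ((cmod h)\<^sup>2) * ennreal (exp (2 * Re (b h * w 0 / of_real (sqrt (sqnorm (Suc 0) w))))) \<partial>lborel) \<partial>CN_vec {..<Suc 0})"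
  proof (rule nn_integral_cong_AE)
    show "AE w in CN_vec {..<Suc 0}. (\<integral>\<^sup>+h. c ((cmod h)\<^sup>2) * ennreal (exp (2 * Re (b h))) \<partial>lborel) =
       (\<integral>\<^sup>+h. c ((cmod h)\<^sup>2) * ennreal (exp (2 * Re (b h * w 0 / of_real (sqrt (sqnorm (Suc 0) w))))) \<partial>lborel)"
      using AE_sqnorm_neq_0[of "Suc 0", simplified]
    proof eventually_elim
      case (elim w)
      define u where "u = w 0 / of_real (sqrt (sqnorm (Suc 0) w))"
      have u: "cmod u = 1" using elim by (simp add: u_def sqnorm_def norm_divide)
      have "(\<integral>\<^sup>+h. c ((cmod (u * h))\<^sup>2) * ennreal (exp (2 * Re (b (u * h)))) \<partial>lborel) = (\<integral>\<^sup>+h. c ((cmod h)\<^sup>2) * ennreal (exp (2 * Re (b h))) \<partial>lborel)"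
        by (rule nn_integral_lborel_phase[OF _ u]) measurable
      moreover have "b (u * h) = b h * w 0 / of_real (sqrt (sqnorm (Suc 0) w))" for h
        by (simp add: b_def u_def mult_ac)
      ultimately show ?case using u by (simp add: norm_mult)
    qed
  qed
  also have "\<dots> = (\<integral>\<^sup>+h. (\<integral>\<^sup>+w. c ((cmod h)\<^sup>2) * ennreal (exp (2 * Re (b h * w 0 / of_real (sqrt (sqnorm (Suc 0) w))))) \<partial>CN_vec {..<Suc 0}) \<partial>lborel)"
    by (intro pair_sigma_finite.Fubini'[symmetric] pair_sigma_finite.intro prob_space_imp_sigma_finite prob_space_CN_vec lborel.sigma_finite_measure_axioms) measurable
  also have "\<dots> = (\<integral>\<^sup>+h. c ((cmod h)\<^sup>2) * ennreal (bessel_series 0 ((cmod h)\<^sup>2 * (cmod mu)\<^sup>2 / s\<^sup>2)) \<partial>lborel)"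
  proof (intro nn_integral_cong)
    fix h
    show "(\<integral>\<^sup>+w. c ((cmod h)\<^sup>2) * ennreal (exp (2 * Re (b h * w 0 / of_real (sqrt (sqnorm (Suc 0) w))))) \<partial>CN_vec {..<Suc 0})
      = c ((cmod h)\<^sup>2) * ennreal (bessel_series 0 ((cmod h)\<^sup>2 * (cmod mu)\<^sup>2 / s\<^sup>2))"
      using CN_vec_direction_mgf[of "Suc 0" "b h"]
      by (subst nn_integral_cmult) (simp_all add: b2)
  qed
  also have "\<dots> = ennreal pi * (\<integral>\<^sup>+z\<in>{0<..}. c z * ennreal (bessel_series 0 (z * (cmod mu)\<^sup>2 / s\<^sup>2)) \<partial>lborel)"
    by (rule nn_integral_lborel_cmod_square) measurable
  also have "\<dots> = (\<integral>\<^sup>+z\<in>{0<..}. ennreal pi * (c z * ennreal (bessel_series 0 (z * (cmod mu)\<^sup>2 / s\<^sup>2))) \<partial>lborel)"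
    by (subst nn_integral_cmult[symmetric]) (simp_all add: mult.assoc)
  also have "\<dots> = (\<integral>\<^sup>+z\<in>{0<..}. ennreal (exp (- z / s - (cmod mu)\<^sup>2 / s) / s * bessel_series 0 (z * (cmod mu)\<^sup>2 / s\<^sup>2)) * k z \<partial>lborel)"
  proof (intro nn_integral_cong, goal_cases)
    case (1 z)
    show ?case
    proof (cases "z > 0")
      case True
      then have "z * (cmod mu)\<^sup>2 / s\<^sup>2 \<ge> 0" by simp
      then have "bessel_series 0 (z * (cmod mu)\<^sup>2 / s\<^sup>2) \<ge> 0" by (intro less_imp_le[OF bessel_series_pos])
      moreover have "exp (- z / s - (cmod mu)\<^sup>2 / s) / s = pi * (exp (- z / s - (cmod mu)\<^sup>2 / s) / (pi * s))" by simp
      ultimately have "ennreal (exp (- z / s - (cmod mu)\<^sup>2 / s) / s * bessel_series 0 (z * (cmod mu)\<^sup>2 / s\<^sup>2))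
         = ennreal pi * ennreal (exp (- z / s - (cmod mu)\<^sup>2 / s) / (pi * s)) * ennreal (bessel_series 0 (z * (cmod mu)\<^sup>2 / s\<^sup>2))"
        using s by (simp only: ennreal_mult[symmetric] pi_ge_zero divide_nonneg_nonneg exp_ge_zero mult_nonneg_nonneg less_imp_le)
      then show ?thesis by (simp add: c_def mult_ac)
    qed simp
  qed
  finally show ?thesis .
qed

lemma cdot_le:
  assumes "sqnorm m u = 1" shows "(cmod (cdot m u w))\<^sup>2 \<le> sqnorm m w"
proof -
  have "cmod (cdot m u w) \<le> (\<Sum>j<m. \<bar>cmod (u j)\<bar> * \<bar>cmod (w j)\<bar>)"
    unfolding cdot_def by (rule order_trans[OF norm_sum]) (simp add: norm_mult)
  also have "\<dots> \<le> L2_set (\<lambda>j. cmod (u j)) {..<m} * L2_set (\<lambda>j. cmod (w j)) {..<m}"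
    by (rule L2_set_mult_ineq)
  also have "\<dots> = sqrt (sqnorm m w)" using assms by (simp add: L2_set_def sqnorm_def)
  finally show ?thesis using power_mono[of "cmod (cdot m u w)" "sqrt (sqnorm m w)" 2] by simp
qed

lemma lik_ratio_le:
  assumes "s > 0" shows "lik_ratio mu s a v \<le> exp ((cmod v)\<^sup>2)"
proof -
  have "lik_ratio mu s a v \<le> exp ((cmod v)\<^sup>2 - (cmod (v - of_real a * mu))\<^sup>2 / (s * a\<^sup>2 + 1)) / 1"
    unfolding lik_ratio_def using assms by (intro divide_left_mono) (auto simp: add_nonneg_pos)
  also have "\<dots> \<le> exp ((cmod v)\<^sup>2)" using assms by (simp add: add_nonneg_nonneg)
  finally show ?thesis .
qed

text \<open>Roles are exchanged: with \<open>w\<close> fixed, the scalar product is, up to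
  conjugation, a linear form in the random vector \<open>g\<close> with coefficients of length
  \<open>sqrt (sqnorm m w)\<close>. Conjugation does not affect the real part.\<close>

lemma unit_dir_mgf:
  assumes m: "m \<ge> 1"
  shows "(\<integral>\<^sup>+g. ennreal (exp (2 * Re (c * cdot m (unit_dir m g) w))) \<partial>CN_vec {..<m})
     = ennreal (fact (m - 1) * bessel_series (m - 1) ((cmod c)\<^sup>2 * sqnorm m w))"
proof -
  let ?F = "\<lambda>x y. ennreal (exp (2 * Re (cnj c * x / of_real (sqrt y))))"
  have "(\<integral>\<^sup>+g. ennreal (exp (2 * Re (c * cdot m (unit_dir m g) w))) \<partial>CN_vec {..<m})
     = (\<integral>\<^sup>+g. ?F (\<Sum>j<m. cnj (w j) * g j) (\<Sum>j<m. (cmod (g j))\<^sup>2) \<partial>CN_vec {..<m})"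
  proof (rule nn_integral_cong_AE)
    show "AE g in CN_vec {..<m}. ennreal (exp (2 * Re (c * cdot m (unit_dir m g) w))) = ?F (\<Sum>j<m. cnj (w j) * g j) (\<Sum>j<m. (cmod (g j))\<^sup>2)"
      using AE_sqnorm_neq_0[OF m]
    proof eventually_elim
      case (elim g)
      define X where "X = (\<Sum>j<m. cnj (w j) * g j) / of_real (sqrt (sqnorm m g))"
      have "cdot m (unit_dir m g) w = cnj X"
        using elim unfolding cdot_def unit_dir_def X_def by (simp add: sum_divide_distrib mult.commute)
      then have "Re (c * cdot m (unit_dir m g) w) = Re (cnj c * X)" by simp
      also have "cnj c * X = cnj c * (\<Sum>j<m. cnj (w j) * g j) / of_real (sqrt (sqnorm m g))"
        by (simp add: X_def)
      finally have "Re (c * cdot m (unit_dir m g) w) = Re (cnj c * (\<Sum>j<m. cnj (w j) * g j) / of_real (sqrt (sqnorm m g)))" .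
      then show ?case by (simp only: sqnorm_def)
    qed
  qed
  also have "\<dots> = (\<integral>\<^sup>+g. ?F (of_real (sqrt (\<Sum>j<m. (cmod (cnj (w j)))\<^sup>2)) * g 0) (\<Sum>j<m. (cmod (g j))\<^sup>2) \<partial>CN_vec {..<m})"
    by (rule CN_vec_linear) (use m in auto)
  also have "\<dots> = (\<integral>\<^sup>+g. ennreal (exp (2 * Re ((cnj c * of_real (sqrt (sqnorm m w))) * g 0 / of_real (sqrt (sqnorm m g))))) \<partial>CN_vec {..<m})"
    by (simp only: sqnorm_def[symmetric] complex_mod_cnj mult.assoc)
  also have "\<dots> = ennreal (fact (m - 1) * bessel_series (m - 1) ((cmod (cnj c * of_real (sqrt (sqnorm m w))))\<^sup>2))"
    by (rule CN_vec_direction_mgf[OF m])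
  finally show ?thesis by (simp add: norm_mult power_mult_distrib)
qed

text \<open>Write the likelihood ratio as an average over the fading \<open>h\<close> and swap the
  integrals. Averaging over directions gives \<open>I_(m-1)\<close>; integrating \<open>h\<close>
  through \<open>z = |h|^2\<close> then gives \<open>I_0\<close> and the integral in
  \<open>f_out\<close>. At \<open>w = 0\<close> and \<open>m \<ge> 2\<close> that formula divides by
  zero, whence the last assumption.\<close>

lemma f_out_eq_average:
  assumes m: "m \<ge> 1" and s: "s > 0" and \<rho>: "\<rho> > 0" and w: "sqnorm m w \<noteq> 0"
  shows "(\<integral>\<^sup>+g. ennreal (lik_ratio mu s (sqrt (real m * \<rho>)) (cdot m (unit_dir m g) w)) \<partial>CN_vec {..<m})
      = ennreal (f_out \<rho> mu s m w * (pi ^ m * exp (sqnorm m w)))" (is "?L = _")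
    and "f_out \<rho> mu s m w > 0"
proof -
  interpret V: prob_space "CN_vec {..<m}" by (rule prob_space_CN_vec)
  have N: "sqnorm m w > 0" using w sqnorm_nonneg[of m w] by linarith
  let ?a = "sqrt (real m * \<rho>)"
  let ?A = "sqnorm m w * \<rho> * real m"
  have a2: "?a\<^sup>2 = \<rho> * real m" using \<rho> by simp
  define J where "J z = exp (- (\<rho> * real m + 1 / s) * z) * bessel_series 0 (z * (cmod mu)\<^sup>2 / s\<^sup>2) * bessel_series (m - 1) (?A * z)" for z
  have [measurable]: "J \<in> borel_measurable borel" unfolding J_def by measurable
  have J: "J z \<ge> 0" if "z > 0" for z
    unfolding J_def using that N \<rho> by (intro mult_nonneg_nonneg less_imp_le[OF bessel_series_pos]) auto
  \<comment> \<open>\<open>fact (m - 1)\<close> comes from the average over directions and is the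
    \<open>Gamma (real m)\<close> of \<open>f_out\<close>; the rest is the part of the radial
    density of the fading that does not depend on \<open>z\<close>.\<close>
  define K where "K = fact (m - 1) / s * exp (- (cmod mu)\<^sup>2 / s)"
  have K: "K > 0" using s by (simp add: K_def)
  have "?L = (\<integral>\<^sup>+g. \<integral>\<^sup>+h. ennreal (exp (2 * Re (cnj h * of_real ?a * cdot m (unit_dir m g) w) - (cmod h)\<^sup>2 * ?a\<^sup>2)) \<partial>CN mu s \<partial>CN_vec {..<m})"
    by (simp only: lik_ratio_eq_integral[OF s])
  also have "\<dots> = (\<integral>\<^sup>+h. \<integral>\<^sup>+g. ennreal (exp (2 * Re (cnj h * of_real ?a * cdot m (unit_dir m g) w) - (cmod h)\<^sup>2 * ?a\<^sup>2)) \<partial>CN_vec {..<m} \<partial>CN mu s)"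
    by (rule prob_Fubini[OF prob_space_CN_vec prob_space_CN[OF s]]) measurable
  also have "\<dots> = (\<integral>\<^sup>+h. ennreal (exp (- ((cmod h)\<^sup>2 * ?a\<^sup>2)) * (fact (m - 1) * bessel_series (m - 1) ((cmod h)\<^sup>2 * ?a\<^sup>2 * sqnorm m w))) \<partial>CN mu s)"
  proof (intro nn_integral_cong)
    fix h
    have "(\<integral>\<^sup>+g. ennreal (exp (2 * Re (cnj h * of_real ?a * cdot m (unit_dir m g) w) - (cmod h)\<^sup>2 * ?a\<^sup>2)) \<partial>CN_vec {..<m})
      = (\<integral>\<^sup>+g. ennreal (exp (- ((cmod h)\<^sup>2 * ?a\<^sup>2))) * ennreal (exp (2 * Re (cnj h * of_real ?a * cdot m (unit_dir m g) w))) \<partial>CN_vec {..<m})"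
      by (simp only: ennreal_mult[symmetric] exp_ge_zero exp_add[symmetric] uminus_add_conv_diff)
    also have "\<dots> = ennreal (exp (- ((cmod h)\<^sup>2 * ?a\<^sup>2))) * ennreal (fact (m - 1) * bessel_series (m - 1) ((cmod (cnj h * of_real ?a))\<^sup>2 * sqnorm m w))"
      unfolding unit_dir_mgf[OF m, symmetric] by (rule nn_integral_cmult) measurable
    also have "(cmod (cnj h * of_real ?a))\<^sup>2 = (cmod h)\<^sup>2 * ?a\<^sup>2"
      using \<rho> by (simp add: norm_mult power_mult_distrib)
    finally show "(\<integral>\<^sup>+g. ennreal (exp (2 * Re (cnj h * of_real ?a * cdot m (unit_dir m g) w) - (cmod h)\<^sup>2 * ?a\<^sup>2)) \<partial>CN_vec {..<m})
       = ennreal (exp (- ((cmod h)\<^sup>2 * ?a\<^sup>2)) * (fact (m - 1) * bessel_series (m - 1) ((cmod h)\<^sup>2 * ?a\<^sup>2 * sqnorm m w)))"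
      by (simp only: ennreal_mult' exp_ge_zero)
  qed
  also have "\<dots> = (\<integral>\<^sup>+z\<in>{0<..}. ennreal (exp (- z / s - (cmod mu)\<^sup>2 / s) / s * bessel_series 0 (z * (cmod mu)\<^sup>2 / s\<^sup>2))
      * ennreal (exp (- (z * ?a\<^sup>2)) * (fact (m - 1) * bessel_series (m - 1) (z * ?a\<^sup>2 * sqnorm m w))) \<partial>lborel)"
    by (rule nn_integral_CN_noncentral[OF s]) measurable
  also have "\<dots> = (\<integral>\<^sup>+z. ennreal K * ennreal (indicator {0<..} z * J z) \<partial>lborel)"
  proof (intro nn_integral_cong, goal_cases)
    case (1 z)
    show ?case
    proof (cases "z > 0")
      case True
      have "exp (- z / s - (cmod mu)\<^sup>2 / s) * exp (- (z * ?a\<^sup>2)) = exp (- (cmod mu)\<^sup>2 / s) * exp (- (\<rho> * real m + 1 / s) * z)"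
        unfolding a2 by (simp add: exp_add[symmetric] algebra_simps)
      then have "(exp (- z / s - (cmod mu)\<^sup>2 / s) / s * bessel_series 0 (z * (cmod mu)\<^sup>2 / s\<^sup>2)) *
        (exp (- (z * ?a\<^sup>2)) * (fact (m - 1) * bessel_series (m - 1) (z * ?a\<^sup>2 * sqnorm m w))) = K * J z"
        unfolding K_def J_def a2 by (simp add: mult_ac)
      moreover have "exp (- z / s - (cmod mu)\<^sup>2 / s) / s * bessel_series 0 (z * (cmod mu)\<^sup>2 / s\<^sup>2) \<ge> 0"
        using s True by (intro mult_nonneg_nonneg less_imp_le[OF bessel_series_pos]) auto
      ultimately show ?thesis using True K J by (simp add: ennreal_mult'[symmetric] del: mult_minus_left minus_diff_eq)
    qed simp
  qed
  also have "\<dots> = ennreal K * (\<integral>\<^sup>+z. ennreal (indicator {0<..} z * J z) \<partial>lborel)"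
    by (rule nn_integral_cmult) measurable
  finally have L: "?L = ennreal K * (\<integral>\<^sup>+z. ennreal (indicator {0<..} z * J z) \<partial>lborel)" .
  \<comment> \<open>Finiteness must be proved: the Lebesgue integral in \<open>f_out\<close> would
    be \<open>0\<close> by convention if it diverged. The Cauchy-Schwarz bound on
    \<open>cdot\<close> gives an integrable constant.\<close>
  have "?L \<le> (\<integral>\<^sup>+g. ennreal (exp (sqnorm m w)) \<partial>CN_vec {..<m})"
    by (intro nn_integral_mono ennreal_leI order_trans[OF lik_ratio_le[OF s]]) (simp add: cdot_le sqnorm_unit_dir[OF m])
  then have "?L < \<infinity>" by (simp add: V.emeasure_space_1 order_le_less_trans[OF _ ennreal_less_top])
  then have fin: "(\<integral>\<^sup>+z. ennreal (indicator {0<..} z * J z) \<partial>lborel) \<noteq> \<infinity>"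
    unfolding L using K by (auto simp: ennreal_mult_less_top)
  define I where "I = (LINT z|lborel. indicator {0<..} z * J z)"
  have I: "(\<integral>\<^sup>+z. ennreal (indicator {0<..} z * J z) \<partial>lborel) = ennreal I"
    unfolding I_def using fin J
    by (subst integral_eq_nn_integral) (auto simp: indicator_def less_top)
  have "f_out \<rho> mu s m w = Gamma (real m) / (s * pi ^ m) * exp (- sqnorm m w) * exp (- (cmod mu)\<^sup>2 / s) * I"
    unfolding f_out_def I_def set_lebesgue_integral_def
  proof (rule arg_cong[where f="\<lambda>x. _ * x"], rule Bochner_Integration.integral_cong[OF refl], goal_cases)
    case (1 z)
    show ?case
    proof (cases "z > 0")
      case True
      then have "?A * z > 0" using N \<rho> m by simp
      moreover have "z * (cmod mu)\<^sup>2 / s\<^sup>2 \<ge> 0" using True by simp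
      ultimately show ?thesis using True N \<rho> m
        by (simp add: J_def bessel_I_eq_series)
    qed simp
  qed
  moreover have "Gamma (real m) = fact (m - 1)"
    using Gamma_fact[of "m - 1", where 'a=real] m by (simp add: of_nat_diff)
  ultimately have fo: "f_out \<rho> mu s m w * (pi ^ m * exp (sqnorm m w)) = K * I"
    using s by (simp add: K_def exp_minus field_simps)
  show 1: "?L = ennreal (f_out \<rho> mu s m w * (pi ^ m * exp (sqnorm m w)))"
    unfolding L I fo using K by (simp add: ennreal_mult')
  have "?L \<noteq> 0"
  proof
    assume "?L = 0"
    then have "AE g in CN_vec {..<m}. ennreal (lik_ratio mu s ?a (cdot m (unit_dir m g) w)) = 0"
      by (subst (asm) nn_integral_0_iff_AE) measurable
    then have "AE g in CN_vec {..<m}. False"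
      by eventually_elim (metis ennreal_eq_0_iff not_le lik_ratio_pos[OF s])
    then show False by simp
  qed
  then have "0 < f_out \<rho> mu s m w * (pi ^ m * exp (sqnorm m w))"
    unfolding 1 by (simp add: ennreal_eq_0_iff not_le)
  then show "f_out \<rho> mu s m w > 0" by (rule zero_less_mult_pos2) simp
qed

section \<open>Law of the information density\<close>

text \<open>Makes explicit that \<open>f_out\<close> sees the output only through its squared norm,
  as \<open>CN_vec_linear\<close> requires.\<close>

definition f_out_radial :: "real \<Rightarrow> complex \<Rightarrow> real \<Rightarrow> nat \<Rightarrow> real \<Rightarrow> real" where
  "f_out_radial \<rho> mu s m N = Gamma (real m) / (s * pi ^ m) * exp (- N) * exp (- (cmod mu)\<^sup>2 / s) *
     (LINT z:{0<..}|lborel.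
        exp (- (\<rho> * real m + 1 / s) * z) / (sqrt (N * \<rho> * real m * z)) ^ (m - 1)
        * bessel_I 0 (2 * sqrt (z * (cmod mu)\<^sup>2 / s\<^sup>2))
        * bessel_I (m - 1) (2 * sqrt (N * \<rho> * real m * z)))"

lemma f_out_eq_radial: "f_out \<rho> mu s m y = f_out_radial \<rho> mu s m (sqnorm m y)"
  by (simp add: f_out_def f_out_radial_def)

lemma borel_measurable_f_out_radial [measurable]:
  assumes [measurable]: "f \<in> borel_measurable M" "g \<in> borel_measurable M"
  shows "(\<lambda>x. f_out_radial \<rho> (f x) s m (g x)) \<in> borel_measurable M"
  unfolding f_out_radial_def set_lebesgue_integral_def by measurable

lemma f_cond_eq_lik_ratio:
  assumes m: "m \<ge> 1" and \<rho>: "\<rho> > 0"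
  shows "f_cond \<rho> mu s m y * (pi ^ m * exp (sqnorm m y)) = lik_ratio mu s (sqrt (real m * \<rho>)) (y 0)"
proof -
  have I: "{..<m} = insert 0 {1..<m}" using m by auto
  have N: "sqnorm m y = (cmod (y 0))\<^sup>2 + (\<Sum>i\<in>{1..<m}. (cmod (y i))\<^sup>2)"
    unfolding sqnorm_def I by (subst sum.insert) auto
  have "exp (- (cmod (y 0 - mu * of_real (sqrt (real m * \<rho>))))\<^sup>2 / (s * real m * \<rho> + 1) - (\<Sum>i\<in>{1..<m}. (cmod (y i))\<^sup>2)) * exp (sqnorm m y)
     = exp ((cmod (y 0))\<^sup>2 - (cmod (y 0 - of_real (sqrt (real m * \<rho>)) * mu))\<^sup>2 / (s * (sqrt (real m * \<rho>))\<^sup>2 + 1))"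
    unfolding N using \<rho> by (simp add: exp_add[symmetric] mult_ac)
  then show ?thesis
    unfolding f_cond_def lik_ratio_def using \<rho> by (simp add: mult_ac)
qed

text \<open>The map is the first coordinate of \<open>W_tilde\<close>. Its law is Gaussian with mean
  \<open>mu * a\<close> and variance \<open>s * a^2 + 1\<close>, and \<open>lik_ratio\<close> is the
  quotient of that density by the standard one.\<close>

lemma distr_CN_std_affine_lik_ratio:
  assumes s: "s > 0"
  shows "distr CN_std CN_std (\<lambda>z. mu * of_real a + of_real (sqrt (s * a\<^sup>2 + 1)) * z)
     = density CN_std (\<lambda>z. ennreal (lik_ratio mu s a z))"
proof (rule measure_eqI)
  let ?d = "s * a\<^sup>2 + 1"
  let ?f = "\<lambda>z. mu * of_real a + of_real (sqrt ?d) * z"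
  have d: "?d > 0" using s by (simp add: add_nonneg_pos)
  fix A assume "A \<in> sets (distr CN_std CN_std ?f)"
  then have [measurable]: "A \<in> sets borel" and A: "A \<in> sets CN_std" by simp_all
  have "cn_density 0 1 z * lik_ratio mu s a z = cn_density (mu * of_real a) ?d z" for z
  proof -
    have "exp ((cmod z)\<^sup>2 - (cmod (z - of_real a * mu))\<^sup>2 / ?d) = exp ((cmod z)\<^sup>2) * exp (- (cmod (z - of_real a * mu))\<^sup>2 / ?d)"
      by (simp add: exp_add[symmetric])
    then show ?thesis unfolding cn_density_def lik_ratio_def by (simp add: exp_minus mult.commute)
  qed
  then have eq: "ennreal (cn_density 0 1 z) * (ennreal (lik_ratio mu s a z) * x) = ennreal (cn_density (mu * of_real a) ?d z) * x" for z x
    by (subst mult.assoc[symmetric], subst ennreal_mult[symmetric]) (simp_all add: cn_density_pos lik_ratio_pos s less_imp_le)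
  have meas: "(\<lambda>z. ennreal (lik_ratio mu s a z)) \<in> borel_measurable CN_std" by measurable
  have "emeasure (distr CN_std CN_std ?f) A = (\<integral>\<^sup>+z. indicator A (?f z) \<partial>CN_std)"
    by (subst nn_integral_indicator[symmetric], simp, subst nn_integral_distr) auto
  also have "\<dots> = (\<integral>\<^sup>+z. indicator A z \<partial>CN (mu * of_real a) ?d)"
    using nn_integral_CN_affine[of "indicator A" "sqrt ?d" 1 "mu * of_real a" 0] d by simp
  also have "\<dots> = emeasure (density CN_std (\<lambda>z. ennreal (lik_ratio mu s a z))) A"
    unfolding emeasure_density[OF meas A]
    using nn_integral_CN[of "indicator A" "mu * of_real a" ?d]
      nn_integral_CN[of "\<lambda>z. ennreal (lik_ratio mu s a z) * indicator A z" 0 1, unfolded eq]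
    by (simp only: borel_measurable_indicator \<open>A \<in> sets borel\<close>) measurable
  finally show "emeasure (distr CN_std CN_std ?f) A = emeasure (density CN_std (\<lambda>z. ennreal (lik_ratio mu s a z))) A" .
qed simp

text \<open>The logarithm of \<open>f_cond / f_out\<close>, both taken relative to standard noise:
  \<open>pi ^ m * exp N\<close> is the inverse of the noise density, and \<open>lik_ratio\<close>
  already contains it for the numerator. Only a projection \<open>v\<close> and a squared norm
  \<open>N\<close> remain as arguments.\<close>

definition info :: "real \<Rightarrow> complex \<Rightarrow> real \<Rightarrow> nat \<Rightarrow> complex \<Rightarrow> real \<Rightarrow> real" where
  "info \<rho> mu s m v N = ln (lik_ratio mu s (sqrt (real m * \<rho>)) v / (f_out_radial \<rho> mu s m N * (pi ^ m * exp N)))"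

lemma borel_measurable_info [measurable]:
  assumes [measurable]: "f \<in> borel_measurable M" "g \<in> borel_measurable M" "h \<in> borel_measurable M"
  shows "(\<lambda>x. info \<rho> (f x) s m (g x) (h x)) \<in> borel_measurable M"
  unfolding info_def by measurable

lemma S_rv_eq_info:
  assumes m: "m \<ge> 1" and \<rho>: "\<rho> > 0"
  shows "S_rv \<rho> mu s m w = info \<rho> mu s m (W_tilde \<rho> mu s m w 0) (sqnorm m (W_tilde \<rho> mu s m w))"
proof -
  have "pi ^ m * exp N \<noteq> 0" for N :: real by simp
  then show ?thesis
    unfolding S_rv_def info_def f_out_eq_radial f_cond_eq_lik_ratio[OF m \<rho>, symmetric]
    by simp
qed

lemma borel_measurable_S_rv [measurable]:
  assumes m: "m \<ge> 1" and \<rho>: "\<rho> > 0"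
    and [measurable]: "f \<in> borel_measurable M" and h [measurable]: "\<And>j. j < m \<Longrightarrow> (\<lambda>x. h x j) \<in> borel_measurable M"
  shows "(\<lambda>x. S_rv \<rho> (f x) s m (h x)) \<in> borel_measurable M"
proof -
  have [measurable]: "(\<lambda>x. h x 0) \<in> borel_measurable M" using m by (intro h) simp
  have [measurable]: "(\<lambda>x. W_tilde \<rho> (f x) s m (h x) j) \<in> borel_measurable M" if "j < m" for j
    using that unfolding W_tilde_def by measurable
  have [measurable]: "(\<lambda>x. W_tilde \<rho> (f x) s m (h x) 0) \<in> borel_measurable M"
    unfolding W_tilde_def by measurable
  show ?thesis unfolding S_rv_eq_info[OF m \<rho>] sqnorm_def by measurable
qed

text \<open>\<open>CN_vec_linear\<close> turns \<open>u\<close> into the first axis, and tilting by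
  the likelihood ratio then amounts to replacing the noise by \<open>W_tilde\<close>. Hence the law
  of the information density under the true channel is that of \<open>S_rv\<close> for every
  direction \<open>u\<close>.\<close>

lemma info_law:
  assumes m: "m \<ge> 1" and \<rho>: "\<rho> > 0" and s: "s > 0" and u: "sqnorm m u = 1"
    and [measurable]: "f \<in> borel_measurable borel"
  shows "(\<integral>\<^sup>+w. ennreal (lik_ratio mu s (sqrt (real m * \<rho>)) (cdot m u w)) * f (info \<rho> mu s m (cdot m u w) (sqnorm m w)) \<partial>CN_vec {..<m})
     = (\<integral>\<^sup>+w. f (S_rv \<rho> mu s m w) \<partial>CN_vec {..<m})"
proof -
  let ?a = "sqrt (real m * \<rho>)" and ?N = "CN_vec {..<m}"
  let ?F = "\<lambda>x y. ennreal (lik_ratio mu s ?a x) * f (info \<rho> mu s m x y)"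
  have 0 [measurable]: "0 \<in> {..<m}" using m by auto
  have u': "(\<Sum>j<m. (cmod (cnj (u j)))\<^sup>2) = 1" using u by (simp add: sqnorm_def)
  let ?T = "\<lambda>j z. if j = 0 then mu * of_real ?a + of_real (sqrt (s * ?a\<^sup>2 + 1)) * z else z"
  let ?p = "\<lambda>j z. if j = 0 then ennreal (lik_ratio mu s ?a z) else 1"
  have T: "distr ?N ?N (\<lambda>w. \<lambda>j\<in>{..<m}. ?T j (w j)) = density ?N (\<lambda>w. \<Prod>j\<in>{..<m}. ?p j (w j))"
  proof (rule distr_PiM_eq_density)
    fix j
    show "distr CN_std CN_std (?T j) = density CN_std (?p j)"
    proof (cases "j = 0")
      case True
      show ?thesis
        unfolding True if_P[OF refl] by (rule distr_CN_std_affine_lik_ratio[OF s])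
    next
      case False
      then show ?thesis by (simp add: distr_id2 density_1)
    qed
  qed (auto intro: CN_std.prob_space_axioms)
  have p: "(\<Prod>j\<in>{..<m}. ?p j (w j)) = ennreal (lik_ratio mu s ?a (w 0))" for w
    using m by (simp add: prod.delta)
  have "(\<integral>\<^sup>+w. ?F (cdot m u w) (sqnorm m w) \<partial>?N) = (\<integral>\<^sup>+w. ?F (of_real (sqrt 1) * w 0) (sqnorm m w) \<partial>?N)"
    using CN_vec_linear[of "{..<m}" 0 ?F "\<lambda>j. cnj (u j)"] m
    unfolding u' cdot_def sqnorm_def by simp
  also have "\<dots> = (\<integral>\<^sup>+w. f (info \<rho> mu s m (w 0) (sqnorm m w)) \<partial>density ?N (\<lambda>w. \<Prod>j\<in>{..<m}. ?p j (w j)))"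
    unfolding p by (subst nn_integral_density) auto
  also have "\<dots> = (\<integral>\<^sup>+w. f (info \<rho> mu s m ((\<lambda>j\<in>{..<m}. ?T j (w j)) 0) (sqnorm m (\<lambda>j\<in>{..<m}. ?T j (w j)))) \<partial>?N)"
    unfolding T[symmetric] by (rule nn_integral_distr) auto
  also have "\<dots> = (\<integral>\<^sup>+w. f (S_rv \<rho> mu s m w) \<partial>?N)"
  proof -
    have "?a\<^sup>2 = real m * \<rho>" using \<rho> by simp
    then have W: "W_tilde \<rho> mu s m w j = ?T j (w j)" for w j
      by (simp add: W_tilde_def mult.assoc)
    have "sqnorm m (\<lambda>j\<in>{..<m}. ?T j (w j)) = sqnorm m (W_tilde \<rho> mu s m w)" for w
      unfolding sqnorm_def W by (intro sum.cong) auto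
    moreover have "(\<lambda>j\<in>{..<m}. ?T j (w j)) 0 = W_tilde \<rho> mu s m w 0" for w
      unfolding W using 0 by simp
    ultimately show ?thesis unfolding S_rv_eq_info[OF m \<rho>] by simp
  qed
  finally show ?thesis .
qed

section \<open>Decomposition into coherence blocks\<close>

lemma CN_vec_idx_prod:
  assumes g [measurable]: "\<And>k. g k \<in> borel_measurable (CN_vec {..<m})"
  shows "(\<integral>\<^sup>+w. (\<Prod>k<l. g k (\<lambda>i\<in>{..<m}. w (k, i))) \<partial>CN_vec (idx l m)) = (\<Prod>k<l. \<integral>\<^sup>+w. g k w \<partial>CN_vec {..<m})"
proof (induction l)
  case 0
  then show ?case using prob_space.emeasure_space_1[OF prob_space_CN_vec] by simp
next
  case (Suc l)
  let ?J = "{l} \<times> {..<m}"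
  have U: "idx (Suc l) m = idx l m \<union> ?J" by (auto simp: idx_def)
  have row: "(\<lambda>w. \<lambda>i\<in>{..<m}. w (k, i)) \<in> measurable (CN_vec K) (CN_vec {..<m})" if "{k} \<times> {..<m} \<subseteq> K" for k K
    using that by (intro measurable_restrict measurable_component_singleton) auto
  have re: "distr (CN_vec ?J) (CN_vec {..<m}) (\<lambda>w. \<lambda>i\<in>{..<m}. w (l, i)) = CN_vec {..<m}"
    using distr_PiM_reindex[of ?J "\<lambda>_. CN_std" "\<lambda>i. (l, i)" "{..<m}"] by (auto intro: CN_std.prob_space_axioms inj_onI)
  have meas: "(\<lambda>w. \<Prod>k<n. g k (\<lambda>i\<in>{..<m}. w (k, i))) \<in> borel_measurable (CN_vec (idx n m))" for n
    by (intro borel_measurable_prod_ennreal measurable_compose[OF row g]) (auto simp: idx_def)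
  have ml: "(\<lambda>y. g l (\<lambda>i\<in>{..<m}. y (l, i))) \<in> borel_measurable (CN_vec ?J)"
    by (intro measurable_compose[OF row g]) auto
  have "(\<integral>\<^sup>+w. (\<Prod>k<Suc l. g k (\<lambda>i\<in>{..<m}. w (k, i))) \<partial>CN_vec (idx (Suc l) m))
     = (\<integral>\<^sup>+x. \<integral>\<^sup>+y. (\<Prod>k<Suc l. g k (\<lambda>i\<in>{..<m}. merge (idx l m) ?J (x, y) (k, i))) \<partial>CN_vec ?J \<partial>CN_vec (idx l m))"
    unfolding U by (rule CN_vec.product_nn_integral_fold[OF _ _ _ meas[of "Suc l", unfolded U]]) (auto simp: idx_def)
  also have "\<dots> = (\<integral>\<^sup>+x. \<integral>\<^sup>+y. (\<Prod>k<l. g k (\<lambda>i\<in>{..<m}. x (k, i))) * g l (\<lambda>i\<in>{..<m}. y (l, i)) \<partial>CN_vec ?J \<partial>CN_vec (idx l m))"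
  proof -
    have A: "(\<lambda>i\<in>{..<m}. merge (idx l m) ?J (x, y) (k, i)) = (\<lambda>i\<in>{..<m}. x (k, i))" if "k \<in> {..<l}" for x y and k :: nat
      using that by (auto simp: merge_def idx_def restrict_def fun_eq_iff)
    have B: "(\<lambda>i\<in>{..<m}. merge (idx l m) ?J (x, y) (l, i)) = (\<lambda>i\<in>{..<m}. y (l, i))" for x y
      by (auto simp: merge_def idx_def restrict_def fun_eq_iff)
    have "(\<Prod>k<Suc l. g k (\<lambda>i\<in>{..<m}. merge (idx l m) ?J (x, y) (k, i))) = (\<Prod>k<l. g k (\<lambda>i\<in>{..<m}. x (k, i))) * g l (\<lambda>i\<in>{..<m}. y (l, i))" for x y
      unfolding prod.lessThan_Suc B by (intro arg_cong2[where f="(*)"] prod.cong refl) (simp only: A)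
    then show ?thesis by (simp only:)
  qed
  also have "\<dots> = (\<integral>\<^sup>+x. (\<Prod>k<l. g k (\<lambda>i\<in>{..<m}. x (k, i))) * (\<integral>\<^sup>+w. g l w \<partial>CN_vec {..<m}) \<partial>CN_vec (idx l m))"
  proof -
    have "(\<integral>\<^sup>+y. g l (\<lambda>i\<in>{..<m}. y (l, i)) \<partial>CN_vec ?J) = (\<integral>\<^sup>+w. g l w \<partial>CN_vec {..<m})"
      by (subst re[symmetric], subst nn_integral_distr) (auto intro!: row)
    then show ?thesis by (simp add: nn_integral_cmult[OF ml])
  qed
  also have "\<dots> = (\<Prod>k<l. \<integral>\<^sup>+w. g k w \<partial>CN_vec {..<m}) * (\<integral>\<^sup>+w. g l w \<partial>CN_vec {..<m})"
    by (simp add: nn_integral_multc[OF meas] Suc.IH)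
  finally show ?case unfolding prod.lessThan_Suc .
qed

definition blocks :: "nat \<Rightarrow> nat \<Rightarrow> (nat \<Rightarrow> complex) \<times> (nat \<times> nat \<Rightarrow> complex) \<Rightarrow> nat \<Rightarrow> complex \<times> (nat \<Rightarrow> complex)" where
  "blocks l m = (\<lambda>(h, w). \<lambda>k\<in>{..<l}. (h k, \<lambda>i\<in>{..<m}. w (k, i)))"

lemma measurable_blocks [measurable]:
  "blocks l m \<in> measurable (PiM {..<l} (\<lambda>_. A) \<Otimes>\<^sub>M CN_vec (idx l m)) (PiM {..<l} (\<lambda>_. A \<Otimes>\<^sub>M CN_vec {..<m}))"
  unfolding blocks_def case_prod_beta
  by (intro measurable_restrict measurable_Pair measurable_compose[OF measurable_fst measurable_component_singleton]
     measurable_compose[OF measurable_snd measurable_component_singleton]) (auto simp: idx_def)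

text \<open>Regroups all fading values and one noise array into independent pairs of a fading value
  and its noise row. On rectangles, the noise integral factors over rows and the fading integral
  over coordinates.\<close>

lemma distr_blocks:
  assumes A: "prob_space A"
  shows "distr (PiM {..<l} (\<lambda>_. A) \<Otimes>\<^sub>M CN_vec (idx l m)) (PiM {..<l} (\<lambda>_. A \<Otimes>\<^sub>M CN_vec {..<m})) (blocks l m)
    = PiM {..<l} (\<lambda>_. A \<Otimes>\<^sub>M CN_vec {..<m})"
proof -
  interpret A: prob_space A by fact
  interpret N: prob_space "CN_vec {..<m}" by (rule prob_space_CN_vec)
  interpret W: prob_space "CN_vec (idx l m)" by (rule prob_space_CN_vec)
  interpret AN: pair_prob_space A "CN_vec {..<m}" ..
  interpret PA: product_sigma_finite "\<lambda>_::nat. A" by standard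
  interpret PB: product_sigma_finite "\<lambda>_::nat. A \<Otimes>\<^sub>M CN_vec {..<m}" by standard
  show ?thesis
  proof (rule PB.PiM_eqI)
    fix E :: "nat \<Rightarrow> _" assume E0: "\<And>k. k \<in> {..<l} \<Longrightarrow> E k \<in> sets (A \<Otimes>\<^sub>M CN_vec {..<m})"
    \<comment> \<open>Padding with the empty set makes the family measurable at every index, not
      only below \<open>l\<close>.\<close>
    define E' where "E' k = (if k < l then E k else {})" for k
    have E [measurable]: "E' k \<in> sets (A \<Otimes>\<^sub>M CN_vec {..<m})" for k using E0 by (simp add: E'_def)
    have EE: "Pi\<^sub>E {..<l} E = Pi\<^sub>E {..<l} E'" by (intro PiE_cong) (simp add: E'_def)
    have [measurable]: "Pi\<^sub>E {..<l} E' \<in> sets (PiM {..<l} (\<lambda>_. A \<Otimes>\<^sub>M CN_vec {..<m}))"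
      by (intro sets_PiM_I_finite) auto
    define e where "e k h w = (indicator (E' k) (h, w) :: ennreal)" for k h w
    have [measurable]: "(\<lambda>(h, w). e k h w) \<in> borel_measurable (A \<Otimes>\<^sub>M CN_vec {..<m})" for k
      unfolding e_def by measurable
    have "emeasure (distr (PiM {..<l} (\<lambda>_. A) \<Otimes>\<^sub>M CN_vec (idx l m)) (PiM {..<l} (\<lambda>_. A \<Otimes>\<^sub>M CN_vec {..<m})) (blocks l m)) (Pi\<^sub>E {..<l} E')
       = (\<integral>\<^sup>+hw. indicator (Pi\<^sub>E {..<l} E') (blocks l m hw) \<partial>(PiM {..<l} (\<lambda>_. A) \<Otimes>\<^sub>M CN_vec (idx l m)))"
      by (subst nn_integral_indicator[symmetric], simp, subst nn_integral_distr) auto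
    also have "\<dots> = (\<integral>\<^sup>+h. \<integral>\<^sup>+w. indicator (Pi\<^sub>E {..<l} E') (blocks l m (h, w)) \<partial>CN_vec (idx l m) \<partial>PiM {..<l} (\<lambda>_. A))"
      by (rule W.nn_integral_fst[symmetric]) measurable
    also have "\<dots> = (\<integral>\<^sup>+h. \<integral>\<^sup>+w. (\<Prod>k<l. e k (h k) (\<lambda>i\<in>{..<m}. w (k, i))) \<partial>CN_vec (idx l m) \<partial>PiM {..<l} (\<lambda>_. A))"
    proof -
      have "indicator (Pi\<^sub>E {..<l} E') (blocks l m (h, w)) = (\<Prod>k<l. e k (h k) (\<lambda>i\<in>{..<m}. w (k, i)))" for h w
        by (auto simp: blocks_def e_def indicator_def PiE_iff)
      then show ?thesis by simp
    qed
    also have "\<dots> = (\<integral>\<^sup>+h. (\<Prod>k<l. \<integral>\<^sup>+w. e k (h k) w \<partial>CN_vec {..<m}) \<partial>PiM {..<l} (\<lambda>_. A))"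
    proof (intro nn_integral_cong, goal_cases)
      case (1 h)
      define e' where "e' k = (if k < l then e k (h k) else (\<lambda>_. 0))" for k
      have "e' k \<in> borel_measurable (CN_vec {..<m})" for k
      proof (cases "k < l")
        case True
        then have "h k \<in> space A" using 1 by (auto simp: space_PiM PiE_iff)
        then show ?thesis using True by (simp add: e'_def)
      qed (simp add: e'_def)
      from CN_vec_idx_prod[of e' m l, OF this] show ?case by (simp add: e'_def cong: prod.cong_simp)
    qed
    also have "\<dots> = (\<Prod>k<l. \<integral>\<^sup>+h. \<integral>\<^sup>+w. e k h w \<partial>CN_vec {..<m} \<partial>A)"
      by (rule PA.product_nn_integral_prod) auto
    also have "\<dots> = (\<Prod>k<l. emeasure (A \<Otimes>\<^sub>M CN_vec {..<m}) (E' k))"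
      by (intro prod.cong refl) (simp add: e_def N.emeasure_pair_measure[OF E])
    finally show "emeasure (distr (PiM {..<l} (\<lambda>_. A) \<Otimes>\<^sub>M CN_vec (idx l m)) (PiM {..<l} (\<lambda>_. A \<Otimes>\<^sub>M CN_vec {..<m})) (blocks l m)) (Pi\<^sub>E {..<l} E)
       = (\<Prod>k\<in>{..<l}. emeasure (A \<Otimes>\<^sub>M CN_vec {..<m}) (E k))"
      unfolding EE by (simp add: E'_def)
  qed auto
qed

section \<open>Random coding with threshold decoding\<close>

text \<open>Codewords are generated independently from seeds. Message \<open>j\<close> can fail only
  if its own test fails or one of its \<open>j - 1\<close> predecessors passes; averaging over
  \<open>j\<close> gives the factor \<open>(M - 1) / 2\<close>, and some codebook does no worse than
  the ensemble average.\<close>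

lemma threshold_decoding_random_code:
  fixes thr :: real and t :: "'g \<Rightarrow> 'y \<Rightarrow> real"
  assumes G: "prob_space G" and Ch: "prob_space Ch"
    and out [measurable]: "(\<lambda>(g, c). out g c) \<in> measurable (G \<Otimes>\<^sub>M Ch) Y"
    and t [measurable]: "(\<lambda>(g, y). t g y) \<in> borel_measurable (G \<Otimes>\<^sub>M Y)"
    and M: "M \<ge> 1"
    and bound: "(\<integral>\<^sup>+g. \<integral>\<^sup>+c. indicator {..thr} (t g (out g c)) \<partial>Ch \<partial>G)
      + ennreal ((real M - 1) / 2) * (\<integral>\<^sup>+g'. \<integral>\<^sup>+g. \<integral>\<^sup>+c. indicator {thr<..} (t g' (out g c)) \<partial>Ch \<partial>G \<partial>G) \<le> ennreal \<epsilon>"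
      (is "?a + _ * ?b \<le> _")
    and \<epsilon>: "\<epsilon> \<ge> 0"
  obtains cb dec where "\<And>j. j \<in> {1..M} \<Longrightarrow> cb j \<in> space G" "\<And>y. dec y \<in> {1..M}"
    "dec \<in> measurable Y (count_space UNIV)"
    "(1 / real M) * (\<Sum>j\<in>{1..M}. measure Ch {c \<in> space Ch. dec (out (cb j) c) \<noteq> j}) \<le> \<epsilon>"
proof -
  interpret G: prob_space G by fact
  interpret Ch: prob_space Ch by fact
  define \<alpha> where "\<alpha> g = (\<integral>\<^sup>+c. indicator {..thr} (t g (out g c)) \<partial>Ch)" for g
  define \<beta> where "\<beta> g' g = (\<integral>\<^sup>+c. indicator {thr<..} (t g' (out g c)) \<partial>Ch)" for g' g
  have \<alpha>': "\<alpha> = (\<lambda>g. \<integral>\<^sup>+c. indicator {..thr} (t g (out g c)) \<partial>Ch)"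
    and \<beta>': "\<beta> = (\<lambda>g' g. \<integral>\<^sup>+c. indicator {thr<..} (t g' (out g c)) \<partial>Ch)"
    by (simp_all add: fun_eq_iff \<alpha>_def \<beta>_def)
  have [measurable]: "\<alpha> \<in> borel_measurable G" unfolding \<alpha>_def by measurable
  have [measurable]: "(\<lambda>(g', g). \<beta> g' g) \<in> borel_measurable (G \<Otimes>\<^sub>M G)" unfolding \<beta>_def by measurable
  let ?P = "PiM {1..M} (\<lambda>_. G)"
  have P: "prob_space ?P" by (intro prob_space_PiM G)
  \<comment> \<open>Union bound on the sum of all \<open>M\<close> error probabilities for the seeds
    \<open>x\<close>. In \<open>\<beta>\<close> the first argument is the competing codeword, the
    second the one sent.\<close>
  define f where "f x = (\<Sum>j\<in>{1..M}. \<alpha> (x j) + (\<Sum>i\<in>{1..<j}. \<beta> (x i) (x j)))" for x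
  have [measurable]: "f \<in> borel_measurable ?P" unfolding f_def by measurable
  have "(\<integral>\<^sup>+x. f x \<partial>?P) = (\<Sum>j\<in>{1..M}. (\<integral>\<^sup>+x. \<alpha> (x j) \<partial>?P) + (\<Sum>i\<in>{1..<j}. \<integral>\<^sup>+x. \<beta> (x i) (x j) \<partial>?P))"
  proof -
    have [measurable]: "(\<lambda>x. \<alpha> (x j)) \<in> borel_measurable ?P" if "j \<in> {1..M}" for j
      using that by measurable
    have m2 [measurable]: "(\<lambda>x. \<beta> (x i) (x j)) \<in> borel_measurable ?P" if "i \<in> {1..M}" "j \<in> {1..M}" for i j
      using that by measurable
    have m3: "(\<lambda>x. \<beta> (x i) (x j)) \<in> borel_measurable ?P" if "i \<in> {1..<j}" "j \<in> {1..M}" for i j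
      using that by (intro m2) auto
    have "(\<integral>\<^sup>+x. f x \<partial>?P) = (\<Sum>j\<in>{1..M}. (\<integral>\<^sup>+x. \<alpha> (x j) + (\<Sum>i\<in>{1..<j}. \<beta> (x i) (x j)) \<partial>?P))"
      unfolding f_def by (intro nn_integral_sum) (use m3 in auto)
    also have "\<dots> = (\<Sum>j\<in>{1..M}. (\<integral>\<^sup>+x. \<alpha> (x j) \<partial>?P) + (\<integral>\<^sup>+x. (\<Sum>i\<in>{1..<j}. \<beta> (x i) (x j)) \<partial>?P))"
      by (intro sum.cong refl nn_integral_add) (use m3 in auto)
    also have "\<dots> = (\<Sum>j\<in>{1..M}. (\<integral>\<^sup>+x. \<alpha> (x j) \<partial>?P) + (\<Sum>i\<in>{1..<j}. \<integral>\<^sup>+x. \<beta> (x i) (x j) \<partial>?P))"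
      by (intro sum.cong refl arg_cong2[where f="(+)"] nn_integral_sum) (use m3 in auto)
    finally show ?thesis .
  qed
  also have "\<dots> = (\<Sum>j\<in>{1..M}. ?a + (\<Sum>i\<in>{1..<j}. ?b))"
  proof (intro sum.cong refl arg_cong2[where f="(+)"])
    fix j assume j: "j \<in> {1..M}"
    show "(\<integral>\<^sup>+x. \<alpha> (x j) \<partial>?P) = ?a"
      using j by (subst nn_integral_PiM_single[OF _ G]) (auto simp: \<alpha>')
    fix i assume i: "i \<in> {1..<j}"
    show "(\<integral>\<^sup>+x. \<beta> (x i) (x j) \<partial>?P) = ?b"
      using i j by (subst nn_integral_PiM_pair[OF _ _ _ _ G]) (auto simp: \<beta>')
  qed
  also have "\<dots> = of_nat M * ?a + of_nat (\<Sum>j\<in>{1..M}. j - 1) * ?b"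
    by (simp add: sum.distrib sum_distrib_right)
  \<comment> \<open>The number of pairs \<open>i < j\<close> of messages is
    \<open>M * (M - 1) / 2\<close>.\<close>
  also have "of_nat (\<Sum>j\<in>{1..M}. j - 1) = ennreal (real M * ((real M - 1) / 2))"
  proof -
    have "real (\<Sum>j\<in>{1..n}. j - 1) = real n * ((real n - 1) / 2)" for n
      by (induction n) (auto simp: field_simps)
    then show ?thesis by (metis ennreal_of_nat_eq_real_of_nat)
  qed
  also have "of_nat M * ?a + ennreal (real M * ((real M - 1) / 2)) * ?b = ennreal (real M) * (?a + ennreal ((real M - 1) / 2) * ?b)"
  proof -
    have "ennreal (real M * ((real M - 1) / 2)) = ennreal (real M) * ennreal ((real M - 1) / 2)"
      using M by (intro ennreal_mult) auto
    then show ?thesis by (simp only: distrib_left mult.assoc ennreal_of_nat_eq_real_of_nat)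
  qed
  also have "\<dots> \<le> ennreal (real M) * ennreal \<epsilon>" by (intro mult_left_mono bound) simp
  also have "\<dots> = ennreal (real M * \<epsilon>)" using \<epsilon> by (simp add: ennreal_mult)
  finally obtain cb where cb: "cb \<in> space ?P" "f cb \<le> ennreal (real M * \<epsilon>)"
    using exists_le_nn_integral[OF P _ \<open>f \<in> borel_measurable ?P\<close>, of "real M * \<epsilon>"] \<epsilon> by auto
  have cbG: "cb j \<in> space G" if "j \<in> {1..M}" for j using cb that by (auto simp: space_PiM)
  \<comment> \<open>message \<open>M\<close> is the default when no test succeeds\<close>
  define D where "D y i \<longleftrightarrow> i \<in> {1..M} \<and> (thr < t (cb i) y \<or> i = M)" for y i
  define dec where "dec y = (LEAST i. D y i)" for y
  have DM: "D y M" for y using M by (simp add: D_def)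
  have Ddec: "D y (dec y)" for y unfolding dec_def using DM by (rule LeastI)
  have tcb: "t (cb i) \<in> borel_measurable Y" if "i \<in> {1..M}" for i
    using measurable_compose[OF measurable_Pair1' t] cbG[OF that] by simp
  have outcb: "out (cb i) \<in> measurable Ch Y" if "i \<in> {1..M}" for i
    using measurable_compose[OF measurable_Pair1' out] cbG[OF that] by simp
  have dec: "dec \<in> measurable Y (count_space UNIV)"
    unfolding dec_def
  proof (rule measurable_Least)
    fix i
    show "(\<lambda>y. D y i) \<in> measurable Y (count_space UNIV)"
    proof (cases "i \<in> {1..M}")
      case True
      then have [measurable]: "t (cb i) \<in> borel_measurable Y" by (rule tcb)
      show ?thesis unfolding D_def by measurable
    qed (simp add: D_def)
  qed
  have err: "emeasure Ch {c \<in> space Ch. dec (out (cb j) c) \<noteq> j} \<le> \<alpha> (cb j) + (\<Sum>i\<in>{1..<j}. \<beta> (cb i) (cb j))"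
    if j: "j \<in> {1..M}" for j
  proof -
    note [measurable] = dec outcb[OF j]
    have m1: "(\<lambda>c. t (cb i) (out (cb j) c)) \<in> borel_measurable Ch" if "i \<in> {1..M}" for i
      using measurable_compose[OF outcb[OF j] tcb[OF that]] .
    note [measurable] = m1[OF j]
    have m2: "(\<lambda>c. indicator {thr<..} (t (cb i) (out (cb j) c)) :: ennreal) \<in> borel_measurable Ch" if "i \<in> {1..<j}" for i
    proof -
      have [measurable]: "(\<lambda>c. t (cb i) (out (cb j) c)) \<in> borel_measurable Ch" using that j by (intro m1) auto
      show ?thesis by measurable
    qed
    have "emeasure Ch {c \<in> space Ch. dec (out (cb j) c) \<noteq> j} = (\<integral>\<^sup>+c. indicator {c \<in> space Ch. dec (out (cb j) c) \<noteq> j} c \<partial>Ch)"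
      by (rule nn_integral_indicator[symmetric]) measurable
    also have "\<dots> \<le> (\<integral>\<^sup>+c. indicator {..thr} (t (cb j) (out (cb j) c)) + (\<Sum>i\<in>{1..<j}. indicator {thr<..} (t (cb i) (out (cb j) c))) \<partial>Ch)"
    proof (intro nn_integral_mono)
      fix c
      let ?y = "out (cb j) c"
      consider "dec ?y = j" | "t (cb j) ?y \<le> thr" | "dec ?y \<noteq> j" "thr < t (cb j) ?y" by force
      then show "indicator {c \<in> space Ch. dec (out (cb j) c) \<noteq> j} c \<le>
          indicator {..thr} (t (cb j) ?y) + (\<Sum>i\<in>{1..<j}. indicator {thr<..} (t (cb i) ?y) :: ennreal)"
      proof cases
        case 3
        then have "D ?y j" using j by (simp add: D_def)
        then have "dec ?y \<le> j" unfolding dec_def by (rule Least_le)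
        with 3 have lt: "dec ?y < j" by simp
        \<comment> \<open>Since \<open>dec ?y < j \<le> M\<close>, the default message
          \<open>M\<close> was not chosen, so the test of \<open>dec ?y\<close> really
          succeeded.\<close>
        with Ddec[of ?y] j have d: "dec ?y \<in> {1..<j}" "thr < t (cb (dec ?y)) ?y" by (auto simp: D_def)
        have "(1::ennreal) = indicator {thr<..} (t (cb (dec ?y)) ?y)" using d by simp
        also have "\<dots> \<le> (\<Sum>i\<in>{1..<j}. indicator {thr<..} (t (cb i) ?y))"
          using d by (intro member_le_sum) auto
        finally have "1 \<le> indicator {..thr} (t (cb j) ?y) + (\<Sum>i\<in>{1..<j}. indicator {thr<..} (t (cb i) ?y) :: ennreal)"
          by (rule add_increasing[OF zero_le])
        then show ?thesis by (rule order_trans[rotated]) (simp add: indicator_def)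
      qed (auto simp: indicator_def split: if_splits)
    qed
    also have "\<dots> = \<alpha> (cb j) + (\<Sum>i\<in>{1..<j}. \<beta> (cb i) (cb j))"
    proof -
      have "(\<integral>\<^sup>+c. (\<Sum>i\<in>{1..<j}. indicator {thr<..} (t (cb i) (out (cb j) c))) \<partial>Ch) = (\<Sum>i\<in>{1..<j}. \<beta> (cb i) (cb j))"
        unfolding \<beta>_def by (rule nn_integral_sum) (rule m2)
      moreover have "(\<lambda>c. \<Sum>i\<in>{1..<j}. indicator {thr<..} (t (cb i) (out (cb j) c)) :: ennreal) \<in> borel_measurable Ch"
        by (rule borel_measurable_sum) (rule m2)
      ultimately show ?thesis
        unfolding \<alpha>_def by (subst nn_integral_add) auto
    qed
    finally show ?thesis .
  qed
  have "ennreal (\<Sum>j\<in>{1..M}. measure Ch {c \<in> space Ch. dec (out (cb j) c) \<noteq> j}) = (\<Sum>j\<in>{1..M}. emeasure Ch {c \<in> space Ch. dec (out (cb j) c) \<noteq> j})"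
    by (subst sum_ennreal[symmetric]) (auto simp: Ch.emeasure_eq_measure)
  also have "\<dots> \<le> f cb" unfolding f_def by (intro sum_mono err)
  also have "\<dots> \<le> ennreal (real M * \<epsilon>)" by (rule cb)
  finally have "(\<Sum>j\<in>{1..M}. measure Ch {c \<in> space Ch. dec (out (cb j) c) \<noteq> j}) \<le> real M * \<epsilon>"
    using \<epsilon> by (simp add: ennreal_le_iff)
  then have "(1 / real M) * (\<Sum>j\<in>{1..M}. measure Ch {c \<in> space Ch. dec (out (cb j) c) \<noteq> j}) \<le> \<epsilon>"
    using M by (simp add: field_simps)
  moreover have "dec y \<in> {1..M}" for y using Ddec[of y] by (simp add: D_def)
  ultimately show ?thesis using that cbG dec by blast
qed

section \<open>The pilot-assisted scheme\<close>

lemma measurable_CN_vec_component [measurable]: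
  "f \<in> measurable M (CN_vec {..<n}) \<Longrightarrow> j < n \<Longrightarrow> (\<lambda>x. f x j) \<in> borel_measurable M"
  by (rule measurable_compose[of f M "CN_vec {..<n}"]) auto

text \<open>\<open>m\<close> is the number of data symbols; writing the block length as
  \<open>np + m\<close> avoids truncated subtraction.\<close>

locale pilot_scheme =
  fixes l np m :: nat and \<rho> \<kappa> :: real
  assumes m: "m \<ge> 1" and np: "np \<ge> 1" and \<rho>: "\<rho> > 0" and \<kappa>: "\<kappa> \<ge> 0"
begin

abbreviation "fading_law \<equiv> CN (muH \<kappa>) (sigH2 \<kappa>)"

abbreviation "estimate_law \<equiv> CN (muH \<kappa>) (sigH2 \<kappa> + sig_e2 np \<rho>)"

abbreviation "channel_block \<equiv> fading_law \<Otimes>\<^sub>M CN_vec {..<np + m}"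

abbreviation "stat_block \<equiv> estimate_law \<Otimes>\<^sub>M CN_vec {..<m}"

abbreviation "seed_law \<equiv> PiM {..<l} (\<lambda>_. CN_vec {..<m})"

abbreviation "stat_law \<equiv> PiM {..<l} (\<lambda>_. stat_block)"

definition lr :: "(nat \<Rightarrow> complex) \<Rightarrow> complex \<times> (nat \<Rightarrow> complex) \<Rightarrow> real" where
  "lr g b = lik_ratio (mu_p \<kappa> np \<rho> (fst b)) (sig_p2 \<kappa> np \<rho>) (sqrt (real m * \<rho>)) (cdot m (unit_dir m g) (snd b))"

definition block_info :: "(nat \<Rightarrow> complex) \<Rightarrow> complex \<times> (nat \<Rightarrow> complex) \<Rightarrow> real" where
  "block_info g b = info \<rho> (mu_p \<kappa> np \<rho> (fst b)) (sig_p2 \<kappa> np \<rho>) m (cdot m (unit_dir m g) (snd b)) (sqnorm m (snd b))"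

text \<open>The output density averaged over codewords, taken relative to \<open>stat_block\<close>:
  the last factor divides out the standard noise density.\<close>

definition out_density :: "complex \<times> (nat \<Rightarrow> complex) \<Rightarrow> real" where
  "out_density b = f_out \<rho> (mu_p \<kappa> np \<rho> (fst b)) (sig_p2 \<kappa> np \<rho>) m (snd b) * (pi ^ m * exp (sqnorm m (snd b)))"

definition block_S :: "complex \<times> (nat \<Rightarrow> complex) \<Rightarrow> real" where
  "block_S b = S_rv \<rho> (mu_p \<kappa> np \<rho> (fst b)) (sig_p2 \<kappa> np \<rho>) m (snd b)"

definition codeword :: "(nat \<Rightarrow> nat \<Rightarrow> complex) \<Rightarrow> nat \<times> nat \<Rightarrow> complex" where
  "codeword G = (\<lambda>(k, i). block_word np m \<rho> (unit_dir m (G k)) i)"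

definition stats :: "(nat \<times> nat \<Rightarrow> complex) \<Rightarrow> nat \<Rightarrow> complex \<times> (nat \<Rightarrow> complex)" where
  "stats y = (\<lambda>k\<in>{..<l}. block_stat np m \<rho> (\<lambda>i. y (k, i)))"

definition channel_stats :: "(nat \<Rightarrow> nat \<Rightarrow> complex) \<Rightarrow> (nat \<Rightarrow> complex) \<times> (nat \<times> nat \<Rightarrow> complex) \<Rightarrow> nat \<Rightarrow> complex \<times> (nat \<Rightarrow> complex)" where
  "channel_stats G hw = stats (channel_out l (np + m) (codeword G) (fst hw) (snd hw))"

definition block_channel_stat :: "(nat \<Rightarrow> complex) \<Rightarrow> complex \<times> (nat \<Rightarrow> complex) \<Rightarrow> complex \<times> (nat \<Rightarrow> complex)" where
  "block_channel_stat g c = block_stat np m \<rho> (\<lambda>i. fst c * block_word np m \<rho> (unit_dir m g) i + snd c i)"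

lemma sig_pos: "sig_p2 \<kappa> np \<rho> > 0" "sigH2 \<kappa> > 0" "sigH2 \<kappa> + sig_e2 np \<rho> > 0"
  using sig_p2_pos[OF \<kappa> np \<rho>] sigH2_pos[OF \<kappa>] sig_e2_pos[OF np \<rho>] by auto

lemma prob_spaces:
  "prob_space fading_law" "prob_space estimate_law" "prob_space channel_block" "prob_space stat_block"
  "prob_space seed_law" "prob_space stat_law"
proof -
  show 1: "prob_space fading_law" "prob_space estimate_law" using sig_pos by (auto intro: prob_space_CN)
  have pr: "prob_space (A \<Otimes>\<^sub>M CN_vec I)" if "prob_space A" for A :: "complex measure" and I :: "nat set"
  proof -
    interpret A: prob_space A by fact
    interpret N: prob_space "CN_vec I" by (rule prob_space_CN_vec)
    interpret pair_prob_space A "CN_vec I" ..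
    show ?thesis by (rule prob_space_axioms)
  qed
  show 2: "prob_space channel_block" "prob_space stat_block" using 1 by (auto intro: pr)
  show "prob_space seed_law" "prob_space stat_law" using 2 by (auto intro: prob_space_PiM prob_space_CN_vec)
qed

lemma measurable_block_fns:
  assumes f [measurable]: "f \<in> measurable M (CN_vec {..<m})" and h [measurable]: "h \<in> measurable M stat_block"
  shows "(\<lambda>x. lr (f x) (h x)) \<in> borel_measurable M"
    "(\<lambda>x. block_info (f x) (h x)) \<in> borel_measurable M"
proof -
  have [measurable]: "(\<lambda>x. snd (h x)) \<in> measurable M (CN_vec {..<m})" "(\<lambda>x. fst (h x)) \<in> borel_measurable M"
    by (rule measurable_compose[OF h], measurable)+
  have [measurable]: "(\<lambda>x. cdot m (unit_dir m (f x)) (snd (h x))) \<in> borel_measurable M"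
    by (intro measurable_cdot_unit_dir f measurable_CN_vec_component) auto
  show "(\<lambda>x. lr (f x) (h x)) \<in> borel_measurable M" "(\<lambda>x. block_info (f x) (h x)) \<in> borel_measurable M"
    unfolding lr_def block_info_def by measurable
qed

lemma measurable_block_S [measurable]: "block_S \<in> borel_measurable stat_block"
  unfolding block_S_def
  by (rule borel_measurable_S_rv[OF m \<rho>]) auto

lemma measurable_block_channel_stat [measurable]: "block_channel_stat g \<in> measurable channel_block stat_block"
proof -
  have [measurable]: "(\<lambda>x. snd x i) \<in> borel_measurable channel_block" if "i < np + m" for i
    using that by (intro measurable_CN_vec_component) auto
  have [measurable]: "(\<lambda>x. snd x i) \<in> borel_measurable channel_block" if "i < np" for i
    using that by (intro measurable_CN_vec_component[where n="np + m"]) auto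
  show ?thesis
    unfolding block_channel_stat_def block_stat_def
    by (intro measurable_Pair measurable_restrict) (auto simp: measurable_cong_sets[OF refl sets_CN])
qed

text \<open>\<open>block_law\<close> tested on indicators. The codeword enters only through the
  density, so all codewords share one reference law.\<close>

lemma distr_block_channel_stat:
  "distr channel_block stat_block (block_channel_stat g) = density stat_block (\<lambda>b. ennreal (lr g b))"
proof -
  interpret N1: prob_space "CN_vec {..<np + m}" by (rule prob_space_CN_vec)
  interpret N2: prob_space "CN_vec {..<m}" by (rule prob_space_CN_vec)
  have [measurable]: "lr g \<in> borel_measurable stat_block"
    unfolding lr_def by measurable
  show ?thesis
  proof (rule measure_eqI)
    fix A assume "A \<in> sets (distr channel_block stat_block (block_channel_stat g))"
    then have [measurable]: "A \<in> sets stat_block" by simp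
    have [measurable]: "A \<in> sets (borel \<Otimes>\<^sub>M CN_vec {..<m})"
      using \<open>A \<in> sets stat_block\<close> by (simp add: sets_pair_measure_cong[OF sets_CN refl])
    have "emeasure (distr channel_block stat_block (block_channel_stat g)) A = (\<integral>\<^sup>+c. indicator A (block_channel_stat g c) \<partial>channel_block)"
      by (subst nn_integral_indicator[symmetric], simp, subst nn_integral_distr) auto
    also have "\<dots> = (\<integral>\<^sup>+h. \<integral>\<^sup>+w. indicator A (block_channel_stat g (h, w)) \<partial>CN_vec {..<np + m} \<partial>fading_law)"
      by (rule N1.nn_integral_fst[symmetric]) measurable
    also have "\<dots> = (\<integral>\<^sup>+v. \<integral>\<^sup>+w. ennreal (lr g (v, w)) * indicator A (v, w) \<partial>CN_vec {..<m} \<partial>estimate_law)"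
      using block_law[OF np \<rho> \<kappa> sqnorm_unit_dir[OF m], of "\<lambda>h w. indicator A (h, w)" g]
      unfolding block_channel_stat_def lr_def by (simp add: case_prod_beta)
    also have "\<dots> = (\<integral>\<^sup>+b. ennreal (lr g b) * indicator A b \<partial>stat_block)"
      by (rule N2.nn_integral_fst) measurable
    also have "\<dots> = emeasure (density stat_block (\<lambda>b. ennreal (lr g b))) A"
      by (simp add: emeasure_density)
    finally show "emeasure (distr channel_block stat_block (block_channel_stat g)) A = emeasure (density stat_block (\<lambda>b. ennreal (lr g b))) A" .
  qed simp
qed

lemma channel_stats_eq_blocks:
  "channel_stats G hw = (\<lambda>k\<in>{..<l}. block_channel_stat (G k) (blocks l (np + m) hw k))"
  by (auto simp: channel_stats_def stats_def block_channel_stat_def blocks_def codeword_def block_stat_def channel_out_def idx_def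
      case_prod_beta restrict_def fun_eq_iff intro!: arg_cong2[where f="(/)"] sum.cong)

lemma channel_space_eq: "channel_space l (np + m) \<kappa> = PiM {..<l} (\<lambda>_. fading_law) \<Otimes>\<^sub>M CN_vec (idx l (np + m))"
  by (simp add: channel_space_def)

lemma ub_space_eq: "ub_space l (np + m) np \<rho> \<kappa> = PiM {..<l} (\<lambda>_. estimate_law) \<Otimes>\<^sub>M CN_vec (idx l m)"
  by (simp add: ub_space_def)

lemma prob_space_channel: "prob_space (channel_space l (np + m) \<kappa>)"
  and prob_space_ub: "prob_space (ub_space l (np + m) np \<rho> \<kappa>)"
proof -
  have "prob_space (PiM {..<l} (\<lambda>_. A) \<Otimes>\<^sub>M CN_vec I)" if A: "prob_space A" for A :: "complex measure" and I :: "(nat \<times> nat) set"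
  proof -
    interpret A: prob_space "PiM {..<l} (\<lambda>_. A)" by (intro prob_space_PiM A)
    interpret N: prob_space "CN_vec I" by (rule prob_space_CN_vec)
    interpret pair_prob_space "PiM {..<l} (\<lambda>_. A)" "CN_vec I" ..
    show ?thesis by (rule prob_space_axioms)
  qed
  then show "prob_space (channel_space l (np + m) \<kappa>)" "prob_space (ub_space l (np + m) np \<rho> \<kappa>)"
    unfolding channel_space_eq ub_space_eq by (auto intro: prob_spaces)
qed

lemma measurable_lr [measurable]: "lr g \<in> borel_measurable stat_block"
  unfolding lr_def by measurable

lemma measurable_block_info [measurable]: "block_info g \<in> borel_measurable stat_block"
  unfolding block_info_def by measurable

lemma nn_integral_channel_stats:
  assumes [measurable]: "F \<in> borel_measurable stat_law"
  shows "(\<integral>\<^sup>+hw. F (channel_stats G hw) \<partial>channel_space l (np + m) \<kappa>) = (\<integral>\<^sup>+b. (\<Prod>k<l. ennreal (lr (G k) (b k))) * F b \<partial>stat_law)"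
proof -
  let ?C = "PiM {..<l} (\<lambda>_. channel_block)"
  let ?D = "\<lambda>x. \<lambda>k\<in>{..<l}. block_channel_stat (G k) (x k)"
  have D [measurable]: "?D \<in> measurable ?C stat_law" by measurable
  have "(\<integral>\<^sup>+hw. F (channel_stats G hw) \<partial>channel_space l (np + m) \<kappa>) = (\<integral>\<^sup>+x. F (?D x) \<partial>?C)"
  proof -
    have "(\<integral>\<^sup>+x. F (?D x) \<partial>?C) = (\<integral>\<^sup>+x. F (?D x) \<partial>distr (PiM {..<l} (\<lambda>_. fading_law) \<Otimes>\<^sub>M CN_vec (idx l (np + m))) ?C (blocks l (np + m)))"
      by (simp only: distr_blocks[OF prob_spaces(1)])
    also have "\<dots> = (\<integral>\<^sup>+hw. F (?D (blocks l (np + m) hw)) \<partial>(PiM {..<l} (\<lambda>_. fading_law) \<Otimes>\<^sub>M CN_vec (idx l (np + m))))"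
      by (rule nn_integral_distr) measurable
    finally show ?thesis unfolding channel_stats_eq_blocks channel_space_eq by simp
  qed
  also have "\<dots> = (\<integral>\<^sup>+b. F b \<partial>distr ?C stat_law ?D)"
    by (rule nn_integral_distr[OF D, symmetric]) simp
  also have "distr ?C stat_law ?D = density stat_law (\<lambda>b. \<Prod>k\<in>{..<l}. ennreal (lr (G k) (b k)))"
    by (rule distr_PiM_eq_density) (auto intro: prob_spaces distr_block_channel_stat)
  also have "(\<integral>\<^sup>+b. F b \<partial>\<dots>) = (\<integral>\<^sup>+b. (\<Prod>k<l. ennreal (lr (G k) (b k))) * F b \<partial>stat_law)"
    by (rule nn_integral_density) auto
  finally show ?thesis .
qed

lemma nn_integral_ub_space:
  assumes [measurable]: "f \<in> borel_measurable borel"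
  shows "(\<integral>\<^sup>+hw. f (\<Sum>k<l. S_rv \<rho> (mu_p \<kappa> np \<rho> (fst hw k)) (sig_p2 \<kappa> np \<rho>) m (\<lambda>i. snd hw (k, i))) \<partial>ub_space l (np + m) np \<rho> \<kappa>)
    = (\<integral>\<^sup>+b. f (\<Sum>k<l. block_S (b k)) \<partial>stat_law)"
proof -
  \<comment> \<open>Restriction changes only coordinates from \<open>m\<close> on, which
    \<open>S_rv\<close> never reads.\<close>
  have eq: "S_rv \<rho> mu s m (\<lambda>i\<in>{..<m}. w i) = S_rv \<rho> mu s m w" for mu s w
  proof -
    have "W_tilde \<rho> mu s m (\<lambda>i\<in>{..<m}. w i) j = W_tilde \<rho> mu s m w j" if "j < m" for j
      using that m by (auto simp: W_tilde_def)
    then show ?thesis unfolding S_rv_eq_info[OF m \<rho>] sqnorm_def using m by simp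
  qed
  have "(\<integral>\<^sup>+b. f (\<Sum>k<l. block_S (b k)) \<partial>stat_law)
     = (\<integral>\<^sup>+b. f (\<Sum>k<l. block_S (b k)) \<partial>distr (PiM {..<l} (\<lambda>_. estimate_law) \<Otimes>\<^sub>M CN_vec (idx l m)) stat_law (blocks l m))"
    by (simp only: distr_blocks[OF prob_spaces(2)])
  also have "\<dots> = (\<integral>\<^sup>+hw. f (\<Sum>k<l. block_S (blocks l m hw k)) \<partial>(PiM {..<l} (\<lambda>_. estimate_law) \<Otimes>\<^sub>M CN_vec (idx l m)))"
    by (rule nn_integral_distr) measurable
  finally show ?thesis
    unfolding ub_space_eq by (simp add: blocks_def block_S_def case_prod_beta eq)
qed

section \<open>All coherence blocks together: change of measure and the ensemble bound\<close>

definition total_info :: "(nat \<Rightarrow> nat \<Rightarrow> complex) \<Rightarrow> (nat \<Rightarrow> complex \<times> (nat \<Rightarrow> complex)) \<Rightarrow> real" where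
  "total_info G b = (\<Sum>k<l. block_info (G k) (b k))"

definition total_lr :: "(nat \<Rightarrow> nat \<Rightarrow> complex) \<Rightarrow> (nat \<Rightarrow> complex \<times> (nat \<Rightarrow> complex)) \<Rightarrow> ennreal" where
  "total_lr G b = (\<Prod>k<l. ennreal (lr (G k) (b k)))"

lemma measurable_total [measurable]:
  assumes f: "f \<in> measurable M seed_law" and h: "h \<in> measurable M stat_law"
  shows "(\<lambda>x. total_info (f x) (h x)) \<in> borel_measurable M" "(\<lambda>x. total_lr (f x) (h x)) \<in> borel_measurable M"
proof -
  have 1: "(\<lambda>x. f x k) \<in> measurable M (CN_vec {..<m})" "(\<lambda>x. h x k) \<in> measurable M stat_block" if "k \<in> {..<l}" for k
    using measurable_compose[OF f measurable_component_singleton[OF that]] measurable_compose[OF h measurable_component_singleton[OF that]] .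
  show "(\<lambda>x. total_info (f x) (h x)) \<in> borel_measurable M"
    unfolding total_info_def by (intro borel_measurable_sum measurable_block_fns 1)
  show "(\<lambda>x. total_lr (f x) (h x)) \<in> borel_measurable M"
    unfolding total_lr_def by (intro borel_measurable_prod_ennreal measurable_compose[OF _ measurable_ennreal] measurable_block_fns 1)
qed

text \<open>The blockwise \<open>info_law\<close> combined by
  \<open>nn_integral_PiM_sum_law\<close>. The right side does not mention \<open>G\<close>: the true
  codeword has the same score law whichever codeword it is.\<close>

lemma total_info_law:
  assumes [measurable]: "f \<in> borel_measurable borel"
  shows "(\<integral>\<^sup>+b. total_lr G b * f (total_info G b) \<partial>stat_law) = (\<integral>\<^sup>+b. f (\<Sum>k<l. block_S (b k)) \<partial>stat_law)"
  unfolding total_lr_def total_info_def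
proof (rule nn_integral_PiM_sum_law)
  fix k and h :: "real \<Rightarrow> ennreal" assume [measurable]: "h \<in> borel_measurable borel"
  interpret N: prob_space "CN_vec {..<m}" by (rule prob_space_CN_vec)
  show "(\<integral>\<^sup>+b. ennreal (lr (G k) b) * h (block_info (G k) b) \<partial>stat_block) = (\<integral>\<^sup>+b. h (block_S b) \<partial>stat_block)"
  proof -
    have "(\<integral>\<^sup>+b. ennreal (lr (G k) b) * h (block_info (G k) b) \<partial>stat_block)
       = (\<integral>\<^sup>+v. \<integral>\<^sup>+w. ennreal (lr (G k) (v, w)) * h (block_info (G k) (v, w)) \<partial>CN_vec {..<m} \<partial>estimate_law)"
      by (rule N.nn_integral_fst[symmetric]) measurable
    also have "\<dots> = (\<integral>\<^sup>+v. \<integral>\<^sup>+w. h (block_S (v, w)) \<partial>CN_vec {..<m} \<partial>estimate_law)"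
      using info_law[OF m \<rho> sig_pos(1) sqnorm_unit_dir[OF m], of h]
      by (simp add: lr_def block_info_def block_S_def)
    also have "\<dots> = (\<integral>\<^sup>+b. h (block_S b) \<partial>stat_block)"
      by (rule N.nn_integral_fst) measurable
    finally show ?thesis .
  qed
qed (auto intro: prob_spaces)

text \<open>Both sides are the averaged output density, the product of the
  \<open>out_density (b k)\<close>: by definition the score of \<open>G\<close> is the logarithm of
  its own likelihood over that average. This turns the score of a wrong codeword into that of a sent
  one, weighted by \<open>exp (- total_info G b)\<close>.\<close>

lemma total_lr_average:
  assumes b: "b \<in> space stat_law" and b0: "\<And>k. k < l \<Longrightarrow> sqnorm m (snd (b k)) \<noteq> 0" and G: "G \<in> space seed_law"
  shows "(\<integral>\<^sup>+G. total_lr G b \<partial>seed_law) = total_lr G b * ennreal (exp (- total_info G b))"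
proof -
  interpret P: product_sigma_finite "\<lambda>_::nat. CN_vec {..<m}"
    by (intro product_sigma_finite.intro prob_space_imp_sigma_finite prob_space_CN_vec)
  have q: "out_density (b k) > 0" if "k < l" for k
    unfolding out_density_def by (intro mult_pos_pos f_out_eq_average(2)[OF m sig_pos(1) \<rho>] b0 that) auto
  have "(\<integral>\<^sup>+G. total_lr G b \<partial>seed_law) = (\<Prod>k<l. \<integral>\<^sup>+g. ennreal (lr g (b k)) \<partial>CN_vec {..<m})"
    unfolding total_lr_def
  proof (rule P.product_nn_integral_prod)
    fix k assume "k \<in> {..<l}"
    then have "b k \<in> space stat_block" using b by (auto simp: space_PiM)
    then have "(\<lambda>g. lr g (b k)) \<in> borel_measurable (CN_vec {..<m})" by (intro measurable_block_fns) auto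
    then show "(\<lambda>g. ennreal (lr g (b k))) \<in> borel_measurable (CN_vec {..<m})" by measurable
  qed simp
  also have "\<dots> = (\<Prod>k<l. ennreal (out_density (b k)))"
    unfolding lr_def out_density_def
    by (intro prod.cong refl f_out_eq_average(1)[OF m sig_pos(1) \<rho>] b0) auto
  also have "\<dots> = (\<Prod>k<l. ennreal (lr (G k) (b k)) * ennreal (exp (- block_info (G k) (b k))))"
  proof (intro prod.cong refl)
    fix k assume "k \<in> {..<l}"
    then have q: "out_density (b k) > 0" by (intro q) auto
    have p: "lr (G k) (b k) > 0" unfolding lr_def by (rule lik_ratio_pos[OF sig_pos(1)])
    have "block_info (G k) (b k) = ln (lr (G k) (b k) / out_density (b k))"
      unfolding block_info_def info_def lr_def out_density_def f_out_eq_radial ..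
    then have "exp (- block_info (G k) (b k)) = out_density (b k) / lr (G k) (b k)"
      using p q by (simp add: exp_minus)
    then show "ennreal (out_density (b k)) = ennreal (lr (G k) (b k)) * ennreal (exp (- block_info (G k) (b k)))"
      using p by (simp add: ennreal_mult'[symmetric])
  qed
  also have "\<dots> = total_lr G b * ennreal (exp (- total_info G b))"
    unfolding total_lr_def total_info_def prod.distrib
    by (simp add: prod_ennreal sum_negf[symmetric] exp_sum)
  finally show ?thesis .
qed

lemma AE_stat_law: "AE b in stat_law. \<forall>k<l. sqnorm m (snd (b k)) \<noteq> 0"
proof -
  interpret pair_sigma_finite estimate_law "CN_vec {..<m}"
    by (intro pair_sigma_finite.intro prob_space_imp_sigma_finite prob_spaces prob_space_CN_vec)
  have "AE b in stat_block. sqnorm m (snd b) \<noteq> 0"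
  proof (rule AE_pair_measure)
    show "{b \<in> space stat_block. sqnorm m (snd b) \<noteq> 0} \<in> sets stat_block" by measurable
    show "AE v in estimate_law. AE w in CN_vec {..<m}. sqnorm m (snd (v, w)) \<noteq> 0"
      using AE_sqnorm_neq_0[OF m] by simp
  qed
  then have "AE b in stat_law. sqnorm m (snd (b k)) \<noteq> 0" if "k \<in> {..<l}" for k
    by (intro AE_PiM_component[where M="\<lambda>_. stat_block", OF prob_spaces(4) that])
  then have "AE b in stat_law. \<forall>k\<in>{..<l}. sqnorm m (snd (b k)) \<noteq> 0"
    by (intro AE_finite_allI) auto
  then show ?thesis by (simp only: Ball_def lessThan_iff)
qed

lemma measurable_stats [measurable]: "stats \<in> measurable (PiM (idx l (np + m)) (\<lambda>_. borel)) stat_law"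
proof -
  have 1: "(\<lambda>y. y (k, i)) \<in> borel_measurable (PiM (idx l (np + m)) (\<lambda>_. borel))" if "k \<in> {..<l}" "i \<in> {..<np + m}" for k i
    using that by (intro measurable_component_singleton) (auto simp: idx_def)
  show ?thesis
    unfolding stats_def block_stat_def
    by (intro measurable_restrict measurable_Pair)
       (auto simp: measurable_cong_sets[OF refl sets_CN] intro!: borel_measurable_divide borel_measurable_sum 1)
qed

lemma measurable_channel_stats [measurable]:
  "(\<lambda>(G, hw). channel_stats G hw) \<in> measurable (seed_law \<Otimes>\<^sub>M channel_space l (np + m) \<kappa>) stat_law"
proof -
  let ?S = "seed_law \<Otimes>\<^sub>M channel_space l (np + m) \<kappa>"
  have "(\<lambda>(G, hw). channel_out l (np + m) (codeword G) (fst hw) (snd hw)) \<in> measurable ?S (PiM (idx l (np + m)) (\<lambda>_. borel))"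
    unfolding channel_out_def case_prod_beta
  proof (rule measurable_restrict)
    fix ki assume ki: "ki \<in> idx l (np + m)"
    have [measurable]: "(\<lambda>x. fst (snd x) (fst ki)) \<in> borel_measurable ?S"
      unfolding channel_space_eq using ki by (auto simp: idx_def)
    have [measurable]: "(\<lambda>x. snd (snd x) ki) \<in> borel_measurable ?S"
      unfolding channel_space_eq using ki by auto
    have 1: "(\<lambda>x. fst x (fst ki)) \<in> measurable ?S (CN_vec {..<m})"
      using ki by (auto simp: idx_def)
    have [measurable]: "(\<lambda>x. codeword (fst x) ki) \<in> borel_measurable ?S"
    proof (cases "snd ki < np")
      case True
      then show ?thesis by (simp add: codeword_def block_word_def case_prod_beta)
    next
      case False
      then have "snd ki - np < m" using ki by (auto simp: idx_def)
      from measurable_compose[OF 1 measurable_unit_dir[OF this]] show ?thesis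
        using False by (simp add: codeword_def block_word_def case_prod_beta)
    qed
    show "(\<lambda>x. fst (snd x) (fst ki) * codeword (fst x) (fst ki, snd ki) + snd (snd x) (fst ki, snd ki)) \<in> borel_measurable ?S"
      by simp
  qed
  from measurable_compose[OF this measurable_stats] show ?thesis
    by (simp add: channel_stats_def case_prod_beta)
qed

lemma sum_codeword_power:
  assumes "k < l"
  shows "(\<Sum>i<np + m. (cmod (codeword G (k, i)))\<^sup>2) = real (np + m) * \<rho>"
proof -
  have "(\<Sum>i<np + m. (cmod (codeword G (k, i)))\<^sup>2) = (\<Sum>i<np. (cmod (codeword G (k, i)))\<^sup>2) + (\<Sum>j<m. (cmod (codeword G (k, np + j)))\<^sup>2)"
  proof -
    have "(\<Sum>i<np + n. f i) = (\<Sum>i<np. f i) + (\<Sum>j<n. f (np + j))" for f :: "nat \<Rightarrow> real" and n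
      by (induction n) (auto simp: add.assoc)
    then show ?thesis .
  qed
  also have "(\<Sum>i<np. (cmod (codeword G (k, i)))\<^sup>2) = real np * \<rho>"
    using \<rho> by (simp add: codeword_def block_word_def)
  also have "(\<Sum>j<m. (cmod (codeword G (k, np + j)))\<^sup>2) = real m * \<rho> * sqnorm m (unit_dir m (G k))"
    using \<rho> by (simp add: codeword_def block_word_def sqnorm_def norm_mult power_mult_distrib sum_distrib_left)
  finally show ?thesis by (simp add: sqnorm_unit_dir[OF m] algebra_simps)
qed

text \<open>Under \<open>stat_law\<close> both terms become integrals against
  \<open>total_lr\<close> of the tested codeword; adding them reconstructs the truncated exponential
  of \<open>eps_ub\<close>, with equality.\<close>

lemma random_coding_bound:
  assumes M: "M \<ge> 2"
  defines "thr \<equiv> ln ((real M - 1) / 2)"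
  shows "(\<integral>\<^sup>+G. \<integral>\<^sup>+c. indicator {..thr} (total_info G (channel_stats G c)) \<partial>channel_space l (np + m) \<kappa> \<partial>seed_law)
      + ennreal ((real M - 1) / 2) * (\<integral>\<^sup>+G'. \<integral>\<^sup>+G. \<integral>\<^sup>+c. indicator {thr<..} (total_info G' (channel_stats G c)) \<partial>channel_space l (np + m) \<kappa> \<partial>seed_law \<partial>seed_law)
    = ennreal (eps_ub l (np + m) np \<rho> \<kappa> M)"
proof -
  define \<gamma> where "\<gamma> = (real M - 1) / 2"
  have \<gamma>: "\<gamma> > 0" using M by (simp add: \<gamma>_def)
  have thr: "thr = ln \<gamma>" by (simp add: thr_def \<gamma>_def)
  define \<psi> where "\<psi> x = exp (- max 0 (x - thr))" for x
  have [measurable]: "\<psi> \<in> borel_measurable borel" unfolding \<psi>_def by measurable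
  \<comment> \<open>Above the threshold the exponent is \<open>ln \<gamma> - x\<close>, which
    produces the factor \<open>\<gamma>\<close> that weights false alarms.\<close>
  have \<psi>: "ennreal (\<psi> x) = indicator {..thr} x + ennreal \<gamma> * (ennreal (exp (- x)) * indicator {thr<..} x)" for x
  proof (cases "x \<le> thr")
    case False
    then have "\<psi> x = \<gamma> * exp (- x)"
      using \<gamma> by (simp add: \<psi>_def thr exp_diff exp_minus field_simps)
    then show ?thesis using False \<gamma> by (simp add: ennreal_mult)
  qed (simp add: \<psi>_def)
  interpret SL: prob_space seed_law by (rule prob_spaces)
  interpret ST: prob_space stat_law by (rule prob_spaces)
  have tinf: "total_info G \<in> borel_measurable stat_law" "total_lr G \<in> borel_measurable stat_law" if "G \<in> space seed_law" for G
    using measurable_total[of "\<lambda>_. G" stat_law "\<lambda>b. b"] that by simp_all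
  have A: "(\<integral>\<^sup>+G. \<integral>\<^sup>+c. indicator {..thr} (total_info G (channel_stats G c)) \<partial>channel_space l (np + m) \<kappa> \<partial>seed_law)
     = (\<integral>\<^sup>+G. \<integral>\<^sup>+b. total_lr G b * indicator {..thr} (total_info G b) \<partial>stat_law \<partial>seed_law)"
  proof (rule nn_integral_cong)
    fix G assume "G \<in> space seed_law"
    note [measurable] = tinf[OF this]
    show "(\<integral>\<^sup>+c. indicator {..thr} (total_info G (channel_stats G c)) \<partial>channel_space l (np + m) \<kappa>) = (\<integral>\<^sup>+b. total_lr G b * indicator {..thr} (total_info G b) \<partial>stat_law)"
      unfolding total_lr_def by (rule nn_integral_channel_stats) measurable
  qed
  have B: "(\<integral>\<^sup>+G'. \<integral>\<^sup>+G. \<integral>\<^sup>+c. indicator {thr<..} (total_info G' (channel_stats G c)) \<partial>channel_space l (np + m) \<kappa> \<partial>seed_law \<partial>seed_law)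
     = (\<integral>\<^sup>+G'. \<integral>\<^sup>+b. total_lr G' b * (ennreal (exp (- total_info G' b)) * indicator {thr<..} (total_info G' b)) \<partial>stat_law \<partial>seed_law)"
  proof (rule nn_integral_cong)
    fix G' assume G': "G' \<in> space seed_law"
    note [measurable] = tinf[OF this]
    have "(\<integral>\<^sup>+G. \<integral>\<^sup>+c. indicator {thr<..} (total_info G' (channel_stats G c)) \<partial>channel_space l (np + m) \<kappa> \<partial>seed_law)
       = (\<integral>\<^sup>+G. \<integral>\<^sup>+b. total_lr G b * indicator {thr<..} (total_info G' b) \<partial>stat_law \<partial>seed_law)"
      unfolding total_lr_def by (intro nn_integral_cong nn_integral_channel_stats) measurable
    \<comment> \<open>The sent codeword \<open>G\<close> is averaged out first, with the tested
      \<open>G'\<close> and the statistic held fixed.\<close>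
    also have "\<dots> = (\<integral>\<^sup>+b. \<integral>\<^sup>+G. total_lr G b * indicator {thr<..} (total_info G' b) \<partial>seed_law \<partial>stat_law)"
      by (rule prob_Fubini[OF prob_spaces(5,6)]) measurable
    also have "\<dots> = (\<integral>\<^sup>+b. total_lr G' b * (ennreal (exp (- total_info G' b)) * indicator {thr<..} (total_info G' b)) \<partial>stat_law)"
    proof (rule nn_integral_cong_AE)
      show "AE b in stat_law. (\<integral>\<^sup>+G. total_lr G b * indicator {thr<..} (total_info G' b) \<partial>seed_law)
         = total_lr G' b * (ennreal (exp (- total_info G' b)) * indicator {thr<..} (total_info G' b))"
        using AE_stat_law AE_space
      proof eventually_elim
        case (elim b)
        then have "(\<lambda>G. total_lr G b) \<in> borel_measurable seed_law" by (intro measurable_total) auto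
        then have "(\<integral>\<^sup>+G. total_lr G b * indicator {thr<..} (total_info G' b) \<partial>seed_law) = (\<integral>\<^sup>+G. total_lr G b \<partial>seed_law) * indicator {thr<..} (total_info G' b)"
          by (rule nn_integral_multc)
        also have "(\<integral>\<^sup>+G. total_lr G b \<partial>seed_law) = total_lr G' b * ennreal (exp (- total_info G' b))"
          using elim by (intro total_lr_average G') auto
        finally show ?case by (simp only: mult.assoc)
      qed
    qed
    finally show "(\<integral>\<^sup>+G. \<integral>\<^sup>+c. indicator {thr<..} (total_info G' (channel_stats G c)) \<partial>channel_space l (np + m) \<kappa> \<partial>seed_law)
       = (\<integral>\<^sup>+b. total_lr G' b * (ennreal (exp (- total_info G' b)) * indicator {thr<..} (total_info G' b)) \<partial>stat_law)" .
  qed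
  have "(\<integral>\<^sup>+G. \<integral>\<^sup>+b. total_lr G b * indicator {..thr} (total_info G b) \<partial>stat_law \<partial>seed_law) +
      ennreal \<gamma> * (\<integral>\<^sup>+G. \<integral>\<^sup>+b. total_lr G b * (ennreal (exp (- total_info G b)) * indicator {thr<..} (total_info G b)) \<partial>stat_law \<partial>seed_law)
    = (\<integral>\<^sup>+G. (\<integral>\<^sup>+b. total_lr G b * indicator {..thr} (total_info G b) \<partial>stat_law) +
      ennreal \<gamma> * (\<integral>\<^sup>+b. total_lr G b * (ennreal (exp (- total_info G b)) * indicator {thr<..} (total_info G b)) \<partial>stat_law) \<partial>seed_law)"
    by (subst nn_integral_cmult[symmetric], measurable, subst nn_integral_add[symmetric]) measurable
  also have "\<dots> = (\<integral>\<^sup>+G. \<integral>\<^sup>+b. total_lr G b * ennreal (\<psi> (total_info G b)) \<partial>stat_law \<partial>seed_law)"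
  proof (rule nn_integral_cong)
    fix G assume "G \<in> space seed_law"
    note [measurable] = tinf[OF this]
    show "(\<integral>\<^sup>+b. total_lr G b * indicator {..thr} (total_info G b) \<partial>stat_law) +
      ennreal \<gamma> * (\<integral>\<^sup>+b. total_lr G b * (ennreal (exp (- total_info G b)) * indicator {thr<..} (total_info G b)) \<partial>stat_law)
      = (\<integral>\<^sup>+b. total_lr G b * ennreal (\<psi> (total_info G b)) \<partial>stat_law)"
      unfolding \<psi> distrib_left
      by (subst nn_integral_add, measurable, subst nn_integral_cmult[symmetric], measurable) (simp only: mult.left_commute)
  qed
  \<comment> \<open>From here on the inner integral is constant in \<open>G\<close>, so the average
    over seeds disappears.\<close>
  also have "\<dots> = (\<integral>\<^sup>+G. \<integral>\<^sup>+b. ennreal (\<psi> (\<Sum>k<l. block_S (b k))) \<partial>stat_law \<partial>seed_law)"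
    by (intro nn_integral_cong total_info_law[where f="\<lambda>x. ennreal (\<psi> x)"]) measurable
  also have "\<dots> = (\<integral>\<^sup>+b. ennreal (\<psi> (\<Sum>k<l. block_S (b k))) \<partial>stat_law)"
    by (simp add: SL.emeasure_space_1)
  also have "\<dots> = (\<integral>\<^sup>+hw. ennreal (\<psi> (\<Sum>k<l. S_rv \<rho> (mu_p \<kappa> np \<rho> (fst hw k)) (sig_p2 \<kappa> np \<rho>) m (\<lambda>i. snd hw (k, i)))) \<partial>ub_space l (np + m) np \<rho> \<kappa>)"
    by (rule nn_integral_ub_space[symmetric, where f="\<lambda>x. ennreal (\<psi> x)"]) measurable
  also have "\<dots> = ennreal (eps_ub l (np + m) np \<rho> \<kappa> M)"
  proof -
    let ?X = "\<lambda>hw. \<Sum>k<l. S_rv \<rho> (mu_p \<kappa> np \<rho> (fst hw k)) (sig_p2 \<kappa> np \<rho>) m (\<lambda>i. snd hw (k, i))"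
    interpret U: prob_space "ub_space l (np + m) np \<rho> \<kappa>" by (rule prob_space_ub)
    have [measurable]: "?X \<in> borel_measurable (ub_space l (np + m) np \<rho> \<kappa>)"
      unfolding ub_space_eq by (intro borel_measurable_sum borel_measurable_S_rv[OF m \<rho>]) (auto simp: idx_def)
    have "integrable (ub_space l (np + m) np \<rho> \<kappa>) (\<lambda>hw. \<psi> (?X hw))"
      by (rule U.integrable_const_bound[where B=1]) (auto simp: \<psi>_def)
    then have "(\<integral>\<^sup>+hw. ennreal (\<psi> (?X hw)) \<partial>ub_space l (np + m) np \<rho> \<kappa>) = ennreal (\<integral>hw. \<psi> (?X hw) \<partial>ub_space l (np + m) np \<rho> \<kappa>)"
      by (rule nn_integral_eq_integral) (auto simp: \<psi>_def)
    then show ?thesis unfolding eps_ub_def \<psi>_def thr_def by simp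
  qed
  finally show ?thesis unfolding A B \<gamma>_def .
qed

end

text \<open>The maximum is expressed by the quantifier: the rate of each admissible \<open>M\<close>
  is a lower bound. The decoder of the random-coding argument is composed with \<open>stats\<close>,
  which turns it into a decoder on channel outputs.\<close>

theorem theorem3:
  fixes l nc np :: nat and \<epsilon> \<rho> \<kappa> :: real
  assumes "l \<ge> 1" and "nc \<ge> 2" and "0 < \<epsilon>" and "\<epsilon> < 1" and "\<rho> > 0" and "\<kappa> \<ge> 0"
    and "1 \<le> np" and "np \<le> nc - 1"
  shows "\<forall>M::nat. M \<ge> 2 \<and> eps_ub l nc np \<rho> \<kappa> M \<le> \<epsilon> \<longrightarrow>
           ereal (log 2 (real M) / (real nc * real l)) \<le> R_star l nc \<epsilon> \<rho> \<kappa>"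
proof (intro allI impI)
  fix M :: nat assume M: "M \<ge> 2 \<and> eps_ub l nc np \<rho> \<kappa> M \<le> \<epsilon>"
  define m where "m = nc - np"
  have nc: "nc = np + m" using assms by (simp add: m_def)
  interpret pilot_scheme l np m \<rho> \<kappa> using assms by unfold_locales (auto simp: m_def)
  let ?thr = "ln ((real M - 1) / 2)"
  obtain cb dec where cb: "\<And>j. j \<in> {1..M} \<Longrightarrow> cb j \<in> space seed_law" and dec: "\<And>y. dec y \<in> {1..M}"
    "dec \<in> measurable stat_law (count_space UNIV)"
    and err: "(1 / real M) * (\<Sum>j\<in>{1..M}. measure (channel_space l nc \<kappa>) {c \<in> space (channel_space l nc \<kappa>). dec (channel_stats (cb j) c) \<noteq> j}) \<le> \<epsilon>"
  proof (rule threshold_decoding_random_code[of seed_law "channel_space l nc \<kappa>" channel_stats stat_law total_info M ?thr \<epsilon>])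
    show "prob_space seed_law" by (rule prob_spaces)
    show "prob_space (channel_space l nc \<kappa>)" unfolding nc by (rule prob_space_channel)
    show "(\<lambda>(g, c). channel_stats g c) \<in> measurable (seed_law \<Otimes>\<^sub>M channel_space l nc \<kappa>) stat_law"
      unfolding nc by (rule measurable_channel_stats)
    show "(\<lambda>(g, y). total_info g y) \<in> borel_measurable (seed_law \<Otimes>\<^sub>M stat_law)" by measurable
    have "ennreal (eps_ub l nc np \<rho> \<kappa> M) \<le> ennreal \<epsilon>" using M by (intro ennreal_leI) simp
    then show "(\<integral>\<^sup>+g. \<integral>\<^sup>+c. indicator {..?thr} (total_info g (channel_stats g c)) \<partial>channel_space l nc \<kappa> \<partial>seed_law)
      + ennreal ((real M - 1) / 2) * (\<integral>\<^sup>+g'. \<integral>\<^sup>+g. \<integral>\<^sup>+c. indicator {?thr<..} (total_info g' (channel_stats g c)) \<partial>channel_space l nc \<kappa> \<partial>seed_law \<partial>seed_law) \<le> ennreal \<epsilon>"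
      unfolding nc using random_coding_bound[of M] M by simp
  qed (use M assms in auto)
  have "is_code l nc M \<epsilon> \<rho> \<kappa> (\<lambda>j. codeword (cb j)) (\<lambda>y. dec (stats y))"
    unfolding is_code_def
  proof (intro conjI ballI allI impI)
    show "1 \<le> M" using M by simp
    show "(\<Sum>i<nc. (cmod (codeword (cb j) (k, i)))\<^sup>2) = real nc * \<rho>" if "k < l" for j k
      unfolding nc by (rule sum_codeword_power[OF that])
    show "dec (stats y) \<in> {1..M}" for y by (rule dec)
    show "(\<lambda>y. dec (stats y)) \<in> measurable (PiM (idx l nc) (\<lambda>_. borel)) (count_space UNIV)"
      unfolding nc by (rule measurable_compose[OF measurable_stats dec(2)])
    show "(1 / real M) * (\<Sum>j\<in>{1..M}. measure (channel_space l nc \<kappa>) {hw \<in> space (channel_space l nc \<kappa>).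
             dec (stats (channel_out l nc (codeword (cb j)) (fst hw) (snd hw))) \<noteq> j}) \<le> \<epsilon>"
      using err unfolding channel_stats_def nc .
  qed
  then have "ereal (log 2 (real M) / (real l * real nc)) \<in> {ereal (log 2 (real M) / (real l * real nc)) | M. \<exists>c g. is_code l nc M \<epsilon> \<rho> \<kappa> c g}"
    by blast
  then show "ereal (log 2 (real M) / (real nc * real l)) \<le> R_star l nc \<epsilon> \<rho> \<kappa>"
    unfolding R_star_def by (subst mult.commute) (rule Sup_upper)
qed

end
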